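(* Let $G$ be a fully dynamic graph on $n$ vertices subject to edge insertions and deletions, and let $\rho$ denote the maximum subgraph density of $G$ at the time of an update. With parameters $\theta=0$, $\eta=3$ and an integer $b\in\Theta(\log n)$, $b\ge 2$, one can deterministically maintain an orientation $\overrightarrow{G}^b$ of $G^b$ in worst-case $\mathcal{O}(\log^3 n\log\rho)$ time per edge insertion or deletion in $G$, such that $\overrightarrow{G}^b$ satisfies, for every directed edge $\overrightarrow{uv}$, $d^+(u)\le (1+\eta b^{-1})\, d^+(v)$, and moreover: (i) every vertex $v$ has out-degree at most $\mathcal{O}(b\rho)$ in $\overrightarrow{G}^b$, and (ii) every vertex $u$ has out-degree at most $\mathcal{O}(\rho)$ in the induced orientation $\overrightarrow{G}$ of $G$.
   Context: For a graph $G=(V,E)$, its density is $|E|/|V|$, and the maximum subgraph density $\rho$ is the maximum of $|E(H)|/|V(H)|$ over nonempty subgraphs $H$. For a positive integer $b$, $G^b$ is the multigraph obtained from $G$ by replacing every edge with $b$ parallel copies. In an orientation, $d^+(u)$ is the number of (parallel copies of) edges directed out of $u$. The orientation $\overrightarrow{G}$ of $G$ induced by an orientation of $G^b$ directs each edge $\{u,v\}$ of $G$ from $u$ to $v$ if more of its $b$ copies are directed from $u$ to $v$ than from $v$ to $u$ (ties broken arbitrarily). *)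

theory Defs
  imports
    Complex_Main
    "HOL-Library.Landau_Symbols"
    "Graph_Theory.Digraph"
begin

section \<open>Density, multigraphs and orientations\<close>

definition max_density :: "'v set \<Rightarrow> 'v set set \<Rightarrow> real" where
  "max_density V E =
     Max {real (card F) / real (card U) | U F.
            U \<noteq> {} \<and> U \<subseteq> V \<and> F \<subseteq> E \<and> (\<forall>e\<in>F. e \<subseteq> U)}"

text \<open>
  An undirected multigraph is given by its vertices \<open>V\<close>, its edges \<open>A\<close> and a map \<open>ends\<close> sending
  an edge to its set of endpoints.
\<close>
definition orientation_of ::
  "'v set \<Rightarrow> 'e set \<Rightarrow> ('e \<Rightarrow> 'v set) \<Rightarrow> ('v, 'e) pre_digraph \<Rightarrow> bool" where
  "orientation_of V A ends D \<longleftrightarrow>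
     verts D = V \<and> arcs D = A \<and> (\<forall>a\<in>A. {tail D a, head D a} = ends a)"

text \<open>The \<open>b\<close> parallel copies of an edge \<open>e\<close> are \<open>(e, 0), \<dots>, (e, b - 1)\<close>.\<close>
definition orientation_of_power ::
  "'v set \<Rightarrow> 'v set set \<Rightarrow> nat \<Rightarrow> ('v, 'v set \<times> nat) pre_digraph \<Rightarrow> bool" where
  "orientation_of_power V E b D \<longleftrightarrow> orientation_of V (E \<times> {..<b}) fst D"

definition copies :: "('v, 'e) pre_digraph \<Rightarrow> 'v \<Rightarrow> 'v \<Rightarrow> nat" where
  "copies D u v = card {a \<in> arcs D. arc_to_ends D a = (u, v)}"

text \<open>A relation rather than a function, since ties may be broken arbitrarily.\<close>
definition induced_orientation ::
  "'v set \<Rightarrow> 'v set set \<Rightarrow> ('v, 'v set \<times> nat) pre_digraph \<Rightarrow> ('v, 'v set) pre_digraph \<Rightarrow> bool" where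
  "induced_orientation V E D H \<longleftrightarrow>
     orientation_of V E (\<lambda>e. e) H \<and>
     (\<forall>u v. {u, v} \<in> E \<and> copies D u v > copies D v u \<longrightarrow> arc_to_ends H {u, v} = (u, v))"


section \<open>Fully dynamic graphs\<close>

datatype update = Insert nat nat | Delete nat nat

fun apply_update :: "update \<Rightarrow> nat set set \<Rightarrow> nat set set" where
  "apply_update (Insert u v) E = insert {u, v} E"
| "apply_update (Delete u v) E = E - {{u, v}}"

fun admissible :: "nat \<Rightarrow> nat set set \<Rightarrow> update \<Rightarrow> bool" where
  "admissible n E (Insert u v) \<longleftrightarrow> u < n \<and> v < n \<and> u \<noteq> v \<and> {u, v} \<notin> E"
| "admissible n E (Delete u v) \<longleftrightarrow> {u, v} \<in> E"

text \<open>The graph on \<open>{..<n}\<close> is initially empty; updates are listed in chronological order.\<close>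

definition edges_after :: "update list \<Rightarrow> nat set set" where
  "edges_after us = fold apply_update us {}"

definition valid_history :: "nat \<Rightarrow> update list \<Rightarrow> bool" where
  "valid_history n us \<longleftrightarrow>
     (\<forall>i < length us. admissible n (edges_after (take i us)) (us ! i))"


section \<open>A deterministic unit-cost word RAM\<close>

text \<open>
  The memory consists of arrays of words, where a word is a number below the modulus \<open>W\<close>.  Array
  names are fixed in the program text, so a program uses constantly many arrays; this is a RAM
  whose memory is divided into constantly many segments, and cells of fixed index serve as
  registers.  Every arithmetic operation, memory access and test costs one unit.
\<close>

type_synonym memory = "nat \<Rightarrow> nat \<Rightarrow> nat"

datatype exp =
    Const nat
  | Read nat exp
  | Add exp exp
  | Sub exp exp
  | Mul exp exp
  | Div exp exp
  | Mod exp exp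
  | Less exp exp

datatype cmd =
    Skip
  | Write nat exp exp
  | Seq cmd cmd
  | If exp cmd cmd
  | While exp cmd

definition store :: "nat \<Rightarrow> nat \<Rightarrow> nat \<Rightarrow> nat \<Rightarrow> memory \<Rightarrow> memory" where
  "store W a i x s = s(a := (s a)(i := x mod W))"

text \<open>Subtraction is truncated at zero.\<close>
fun eval :: "nat \<Rightarrow> exp \<Rightarrow> memory \<Rightarrow> nat" where
  "eval W (Const c) s = c mod W"
| "eval W (Read a e) s = s a (eval W e s)"
| "eval W (Add e f) s = (eval W e s + eval W f s) mod W"
| "eval W (Sub e f) s = (eval W e s - eval W f s) mod W"
| "eval W (Mul e f) s = (eval W e s * eval W f s) mod W"
| "eval W (Div e f) s = (eval W e s div eval W f s) mod W"
| "eval W (Mod e f) s = (eval W e s mod eval W f s) mod W"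
| "eval W (Less e f) s = (if eval W e s < eval W f s then 1 else 0) mod W"

fun cost :: "exp \<Rightarrow> nat" where
  "cost (Const c) = 1"
| "cost (Read a e) = cost e + 1"
| "cost (Add e f) = cost e + cost f + 1"
| "cost (Sub e f) = cost e + cost f + 1"
| "cost (Mul e f) = cost e + cost f + 1"
| "cost (Div e f) = cost e + cost f + 1"
| "cost (Mod e f) = cost e + cost f + 1"
| "cost (Less e f) = cost e + cost f + 1"

text \<open>
  \<open>exec W c s t s'\<close>: with word modulus \<open>W\<close>, running \<open>c\<close> on memory \<open>s\<close> halts after exactly \<open>t\<close>
  time units with memory \<open>s'\<close>.
\<close>
inductive exec :: "nat \<Rightarrow> cmd \<Rightarrow> memory \<Rightarrow> nat \<Rightarrow> memory \<Rightarrow> bool" for W where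
  exec_Skip: "exec W Skip s 1 s"
| exec_Write: "exec W (Write a e f) s (cost e + cost f + 1) (store W a (eval W e s) (eval W f s) s)"
| exec_Seq: "exec W c s t s' \<Longrightarrow> exec W d s' t' s'' \<Longrightarrow> exec W (Seq c d) s (t + t') s''"
| exec_IfT: "eval W e s \<noteq> 0 \<Longrightarrow> exec W c s t s' \<Longrightarrow> exec W (If e c d) s (cost e + 1 + t) s'"
| exec_IfF: "eval W e s = 0 \<Longrightarrow> exec W d s t s' \<Longrightarrow> exec W (If e c d) s (cost e + 1 + t) s'"
| exec_WhileF: "eval W e s = 0 \<Longrightarrow> exec W (While e c) s (cost e + 1) s"
| exec_WhileT: "eval W e s \<noteq> 0 \<Longrightarrow> exec W c s t s' \<Longrightarrow> exec W (While e c) s' t' s'' \<Longrightarrow>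
    exec W (While e c) s (cost e + 1 + t + t') s''"

inductive_cases exec_SkipE: "exec W Skip s t s'"
inductive_cases exec_WriteE: "exec W (Write a e f) s t s'"
inductive_cases exec_SeqE: "exec W (Seq c d) s t s'"
inductive_cases exec_IfE: "exec W (If e c d) s t s'"
inductive_cases exec_WhileE: "exec W (While e c) s t s'"

lemma exec_deterministic:
  "exec W c s t s' \<Longrightarrow> exec W c s u s'' \<Longrightarrow> u = t \<and> s'' = s'"
proof (induction arbitrary: u s'' rule: exec.induct)
  case (exec_Skip s)
  then show ?case by (auto elim: exec_SkipE)
next
  case (exec_Write a e f s)
  then show ?case by (auto elim: exec_WriteE)
next
  case (exec_Seq c s t s' d t' s2)
  from exec_Seq.prems show ?case
  proof (rule exec_SeqE)
    fix r q r'
    assume u: "u = r + r'" and c: "exec W c s r q" and d: "exec W d q r' s''"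
    from exec_Seq.IH(1)[OF c] have "r = t" "q = s'" by simp_all
    with exec_Seq.IH(2)[of r' s''] u d show ?thesis by simp
  qed
next
  case (exec_IfT e s c t s' d)
  from exec_IfT.prems show ?case
  proof (rule exec_IfE)
    fix r
    assume u: "u = Suc (cost e + r)" and c: "exec W c s r s''"
    from exec_IfT.IH[OF c] u show ?thesis by simp
  qed (use exec_IfT.hyps in simp)
next
  case (exec_IfF e s d t s' c)
  from exec_IfF.prems show ?case
  proof (rule exec_IfE)
    fix r
    assume u: "u = Suc (cost e + r)" and c: "exec W d s r s''"
    from exec_IfF.IH[OF c] u show ?thesis by simp
  qed (use exec_IfF.hyps in simp)
next
  case (exec_WhileF e s c)
  from exec_WhileF.prems show ?case
    by (rule exec_WhileE) (use exec_WhileF.hyps in simp_all)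
next
  case (exec_WhileT e s c t s' t' s2)
  from exec_WhileT.prems show ?case
  proof (rule exec_WhileE)
    assume "eval W e s = 0"
    with exec_WhileT.hyps(1) show ?thesis by simp
  next
    fix r q r'
    assume u: "u = Suc (cost e + r + r')" and c: "exec W c s r q" and w: "exec W (While e c) q r' s''"
    from exec_WhileT.IH(1)[OF c] have "r = t" "q = s'" by simp_all
    with exec_WhileT.IH(2)[of r' s''] u w show ?thesis by simp
  qed
qed

text \<open>Words of \<open>k \<cdot> \<lceil>log (n + 2)\<rceil>\<close> bits.\<close>
definition word_modulus :: "nat \<Rightarrow> nat \<Rightarrow> nat" where
  "word_modulus k n = 2 ^ (k * nat \<lceil>log 2 (real (n + 2))\<rceil>)"


section \<open>Dynamic orientation algorithms\<close>

text \<open>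
  Array 0 is used for input: cells 0 and 1 initially hold \<open>n\<close> and \<open>b\<close>, all other memory is
  zero, and the endpoints of the edge to be inserted or deleted are placed in cells 2 and 3.
\<close>
definition initial_memory :: "nat \<Rightarrow> nat \<Rightarrow> nat \<Rightarrow> memory" where
  "initial_memory W n b = store W 0 1 b (store W 0 0 n (\<lambda>a i. 0))"

fun exec_update :: "nat \<Rightarrow> cmd \<Rightarrow> cmd \<Rightarrow> update \<Rightarrow> memory \<Rightarrow> nat \<Rightarrow> memory \<Rightarrow> bool" where
  "exec_update W ins del (Insert u v) s t s' = exec W ins (store W 0 3 v (store W 0 2 u s)) t s'"
| "exec_update W ins del (Delete u v) s t s' = exec W del (store W 0 3 v (store W 0 2 u s)) t s'"

text \<open>
  Array 1 is used for output: it explicitly contains the tail of every edge copy, the copies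
  \<open>({u, v}, i)\<close> with \<open>u < v\<close> being laid out as a three-dimensional table.
\<close>
definition stores_orientation ::
  "nat \<Rightarrow> nat \<Rightarrow> memory \<Rightarrow> (nat, nat set \<times> nat) pre_digraph \<Rightarrow> bool" where
  "stores_orientation n b s D \<longleftrightarrow>
     (\<forall>(e, i) \<in> arcs D. s 1 ((Min e * n + Max e) * b + i) = tail D (e, i))"

end

theory Submission
  imports Defs
begin

text \<open>
  Write \<open>d\<close> for the out-degree and \<open>T j = j + max 1 (j div b)\<close>.  Every arc \<open>u \<rightarrow> v\<close> carries an estimate
  \<open>e\<close> of \<open>d u\<close>, and the invariant is \<open>e \<le> T (d v)\<close>.  The arcs into \<open>v\<close> are kept in bags by estimate,
  so when \<open>d v\<close> is about to drop, an arc that would violate the invariant is found by looking at two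
  bags; it is reversed, and the loss moves on to its old tail.  When \<open>d u\<close> is about to grow to \<open>y\<close>,
  only the arcs in positions \<open>p \<equiv> y\<close> modulo a power of two \<open>L \<approx> y / (8 * b)\<close> of the list of arcs
  leaving \<open>u\<close> are inspected; a violating one is reversed and the gain moves on to its old head,
  otherwise these \<open>O(b)\<close> arcs get the new estimate.  Hence an estimate is off by less than \<open>L\<close>; in
  particular it is exact up to degree \<open>8 * b\<close>.

  Along a chain of reversals the degree \<open>d\<close> changes by at least \<open>max 1 (d / (4 * b))\<close> in one
  direction, so \<open>ln (1 + d / (4 * b))\<close> bounds the length by \<open>O(b * log \<rho>)\<close>, with \<open>O(b + log n)\<close> work
  per reversal and \<open>b\<close> chains per update.

  After an update all \<open>b\<close> copies of each edge are present, so \<open>d u + d v \<ge> b\<close> for every arc \<open>u \<rightarrow> v\<close>;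
  therefore \<open>d v\<close> is so large that the additive \<open>1\<close> in \<open>T\<close> is at most \<open>3 * d v / b\<close>.  For the density
  bound, among the sets \<open>S i\<close> of vertices \<open>x\<close> with \<open>d x * (1 + 3 / b) ^ i \<ge> d v\<close>, one of the first
  \<open>log n\<close> has \<open>card (S (i + 1)) \<le> 2 * card (S i)\<close>, and all arcs leaving \<open>S i\<close> lie within \<open>S (i + 1)\<close>.
\<close>

section \<open>Slack, refresh times and the chain potential\<close>

text \<open>Exact out-degrees in the bags would force every change of \<open>d u\<close> to be
  announced to the heads of all arcs leaving \<open>u\<close>. Estimates avoid this in both
  directions. A gain at \<open>u\<close> may ignore the arcs that are not due: their estimates do
  not move, and the invariant bounds estimates, not degrees. A loss at \<open>u\<close> only lowers
  the estimates that it rewrites, so it endangers nothing but the arcs into \<open>u\<close>, and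
  these are sorted by estimate. The price is staleness, which the constants keep below the slack: an
  error below \<open>L\<close> with \<open>4 * b * L\<close> at most the degree is a
  \<open>1 / (4 * b)\<close> fraction, while a violation shows a gap of about a \<open>1 / b\<close>
  fraction. Hence even a stale violation witnesses a true gap between degrees. The additive
  \<open>1\<close> in \<open>T\<close> serves small degrees, where \<open>j div b\<close> vanishes:
  it lets a new arc leave its endpoint of smaller degree. Its cost is made up for only when all
  copies of an edge are present, so the density bound is available between updates, and degrees
  inside an update are bounded by counting.\<close>

definition slack_bound :: "nat \<Rightarrow> nat \<Rightarrow> nat" where
  "slack_bound b j = j + max 1 (j div b)"

text \<open>Half of the factor \<open>8\<close> is lost in rounding to a power of two. What remains,
  \<open>4 * b * refresh_step b y \<le> y\<close> for steps above one, limits staleness to about a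
  quarter of the slack \<open>y / b\<close>.\<close>

definition refresh_level :: "nat \<Rightarrow> nat \<Rightarrow> nat" where
  "refresh_level b y = (LEAST k. y < 8 * b * 2 ^ k)"

text \<open>Being powers of two, steps at smaller degrees divide those at larger ones.\<close>
definition refresh_step :: "nat \<Rightarrow> nat \<Rightarrow> nat" where
  "refresh_step b y = 2 ^ refresh_level b y"

text \<open>The estimate \<open>e\<close> of the arc in position \<open>p\<close> was last set at degree \<open>e\<close>; since then the degree
  has moved to \<open>d\<close> without crossing a value at which position \<open>p\<close> is due for a refresh.\<close>
definition fresh :: "nat \<Rightarrow> nat \<Rightarrow> nat \<Rightarrow> nat \<Rightarrow> bool" where
  "fresh b p e d \<longleftrightarrow>
     (\<forall>t. min e d < t \<and> t \<le> max e d \<longrightarrow> t mod refresh_step b t \<noteq> p mod refresh_step b t)"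

lemma slack_bound_gt: "j < slack_bound b j"
  by (simp add: slack_bound_def)

lemma slack_bound_mono: "i \<le> j \<Longrightarrow> slack_bound b i \<le> slack_bound b j"
  unfolding slack_bound_def by (intro add_mono max.mono div_le_mono) auto

text \<open>When a degree drops from \<open>d\<close> to \<open>d - 1\<close>, only the estimates
  \<open>slack_bound b (d - 1) + 1\<close> and \<open>slack_bound b (d - 1) + 2\<close> can become
  illegal. This is why two bags suffice in a deletion.\<close>

lemma slack_bound_Suc: "b > 0 \<Longrightarrow> slack_bound b (Suc j) \<le> slack_bound b j + 2"
proof -
  assume b: "b > 0"
  have "Suc j div b \<le> (j + b) div b" using b by (intro div_le_mono) simp
  also have "\<dots> = Suc (j div b)" using b by simp
  finally show ?thesis by (simp add: slack_bound_def)
qed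

lemma slack_bound_le: "slack_bound b j \<le> 2 * j + 1"
proof -
  have "j div b \<le> j" by simp
  then show ?thesis unfolding slack_bound_def by linarith
qed

section \<open>Refresh steps and the accuracy of estimates\<close>

lemma refresh_level_less:
  assumes "b > 0" shows "y < 8 * b * 2 ^ refresh_level b y"
proof -
  have "y < 2 ^ y" by simp
  also have "\<dots> \<le> 8 * b * 2 ^ y" using assms by simp
  finally show ?thesis unfolding refresh_level_def by (rule LeastI)
qed

lemma refresh_level_ge: "k < refresh_level b y \<Longrightarrow> 8 * b * 2 ^ k \<le> y"
  unfolding refresh_level_def using not_less_Least not_less by blast

lemma refresh_level_eqI:
  "y < 8 * b * 2 ^ k \<Longrightarrow> (\<And>j. j < k \<Longrightarrow> 8 * b * 2 ^ j \<le> y) \<Longrightarrow> refresh_level b y = k"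
  unfolding refresh_level_def by (rule Least_equality) (auto simp: not_less[symmetric])

lemma refresh_step_pos [simp]: "refresh_step b y > 0"
  by (simp add: refresh_step_def)

lemma less_refresh_step: "b > 0 \<Longrightarrow> y < 8 * b * refresh_step b y"
  unfolding refresh_step_def by (rule refresh_level_less)

lemma refresh_step_le:
  assumes "refresh_step b y \<noteq> 1" shows "4 * b * refresh_step b y \<le> y"
proof -
  from assms obtain k where k: "refresh_level b y = Suc k"
    by (cases "refresh_level b y") (auto simp: refresh_step_def)
  from refresh_level_ge[of k b y] k show ?thesis by (simp add: refresh_step_def)
qed

lemma refresh_step_dvd:
  assumes "b > 0" "t \<le> y" shows "refresh_step b t dvd refresh_step b y"
proof -
  have "refresh_level b t \<le> refresh_level b y"
    using refresh_level_less[OF assms(1), of y] assms(2)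
    unfolding refresh_level_def[of b t] by (intro Least_le) simp
  then show ?thesis by (simp add: refresh_step_def le_imp_power_dvd)
qed

lemma fresh_same [simp]: "fresh b p d d"
  by (simp add: fresh_def)

text \<open>Let \<open>l\<close> be the step at the larger end. Any \<open>l\<close> consecutive
  values contain one congruent to \<open>p\<close> modulo \<open>l\<close>; since smaller steps
  divide \<open>l\<close>, it is a refresh time, which freshness excludes. With \<open>l = 1\<close>
  no difference at all is possible, so a difference also forces a large degree.\<close>

lemma fresh_dist:
  assumes b: "b > 0" and f: "fresh b p e d" and ne: "e \<noteq> d"
  shows "max e d - min e d < refresh_step b (max e d)" "4 * b * refresh_step b (max e d) \<le> max e d"
proof -
  define x y l where "x = min e d" and "y = max e d" and "l = refresh_step b y"
  have xy: "x < y" using ne by (auto simp: x_def y_def)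
  have l: "l > 0" by (simp add: l_def)
  show 1: "max e d - min e d < refresh_step b (max e d)"
  proof (rule ccontr)
    assume "\<not> ?thesis"
    then have big: "l \<le> y - x" by (simp add: x_def y_def l_def)
    \<comment> \<open>\<open>y - r\<close> is the last value up to \<open>y\<close> congruent to
      \<open>p\<close>. The remainder is taken over the integers because \<open>p\<close> may exceed
      \<open>y\<close>.\<close>
    define r where "r = nat ((int y - int p) mod int l)"
    have r: "int r = (int y - int p) mod int l" using l by (simp add: r_def)
    have rl: "r < l" using l r by (metis of_nat_less_iff of_nat_0_less_iff pos_mod_bound)
    define t where "t = y - r"
    have t: "x < t" "t \<le> y" "int t = int y - int r" using rl big xy by (auto simp: t_def)
    have "int t mod int l = int p mod int l"
      unfolding t(3) r by (simp add: mod_diff_right_eq mod_simps)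
    then have "t mod l = p mod l" by (metis of_nat_eq_iff of_nat_mod)
    moreover have "refresh_step b t dvd l" unfolding l_def by (rule refresh_step_dvd[OF b t(2)])
    ultimately have "t mod refresh_step b t = p mod refresh_step b t"
      by (metis mod_mod_cancel)
    with f t(1,2) show False unfolding fresh_def x_def y_def by blast
  qed
  have "refresh_step b (max e d) \<noteq> 1" using 1 xy by (auto simp: x_def y_def)
  then show "4 * b * refresh_step b (max e d) \<le> max e d" by (rule refresh_step_le)
qed

lemma fresh_incr:
  assumes "fresh b p e d" "Suc d mod refresh_step b (Suc d) \<noteq> p mod refresh_step b (Suc d)"
  shows "fresh b p e (Suc d)"
  unfolding fresh_def
proof (intro allI impI)
  fix t assume t: "min e (Suc d) < t \<and> t \<le> max e (Suc d)"
  show "t mod refresh_step b t \<noteq> p mod refresh_step b t"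
  proof (cases "t = Suc d")
    case True then show ?thesis using assms(2) by simp
  next
    case False
    with t have "min e d < t \<and> t \<le> max e d" by (auto simp: min_def max_def split: if_splits)
    with assms(1) show ?thesis unfolding fresh_def by blast
  qed
qed

lemma fresh_decr:
  assumes "fresh b p e (Suc d)" "Suc d mod refresh_step b (Suc d) \<noteq> p mod refresh_step b (Suc d)"
  shows "fresh b p e d"
  unfolding fresh_def
proof (intro allI impI)
  fix t assume t: "min e d < t \<and> t \<le> max e d"
  show "t mod refresh_step b t \<noteq> p mod refresh_step b t"
  proof (cases "t = Suc d")
    case True then show ?thesis using assms(2) by simp
  next
    case False
    with t have "min e (Suc d) < t \<and> t \<le> max e (Suc d)" by (auto simp: min_def max_def split: if_splits)
    with assms(1) show ?thesis unfolding fresh_def by blast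
  qed
qed

text \<open>A degree that is a refresh time for a position cannot exceed the recorded estimate, so the
  refreshes that accompany a decrement only ever lower estimates.  This also covers the arc that is
  moved from the last position \<open>d - 1\<close>, since \<open>d - 1\<close> is always a refresh time for that position.\<close>
lemma fresh_estimate_ge:
  assumes "fresh b p e d" "t \<le> d" "t mod refresh_step b t = p mod refresh_step b t"
  shows "t \<le> e"
  using assms unfolding fresh_def by (cases "t \<le> e") (auto simp: min_def max_def)

section \<open>Degree gaps forced by violations\<close>

lemma div_twice_ge: "b > 0 \<Longrightarrow> b \<le> x \<Longrightarrow> x \<le> 2 * b * (x div b)" for b x :: nat
proof -
  assume b: "b > 0" "b \<le> x"
  have "x = b * (x div b) + x mod b" by simp
  moreover have "x mod b < b" using b by simp
  moreover have "b \<le> b * (x div b)" using b by (simp add: div_greater_zero_iff Suc_le_eq)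
  ultimately show ?thesis by linarith
qed

text \<open>Here a gain passes from a vertex of degree \<open>d\<close> to one of degree
  \<open>j\<close>. Below \<open>b\<close> the additive one provides the gap, from \<open>b\<close>
  on \<open>j div b\<close> does, which is at least \<open>j / (2 * b)\<close>. The weaker constant
  \<open>4 * b\<close> is what a stale estimate leaves in \<open>stale_violation_gap\<close>, so
  that one potential serves both directions.\<close>

lemma violation_gap:
  assumes b: "b > 0" and v: "slack_bound b j < Suc d"
  shows "Suc j \<le> d" "j \<le> 4 * b * (d - j)"
proof -
  have m: "j + max 1 (j div b) \<le> d" using v by (simp add: slack_bound_def)
  then show "Suc j \<le> d" by linarith
  have "j \<le> 4 * b * max 1 (j div b)"
  proof (cases "b \<le> j")
    case True
    have "j \<le> 2 * b * (j div b)" by (rule div_twice_ge[OF b True])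
    also have "\<dots> \<le> 4 * b * max 1 (j div b)" by (intro mult_mono) auto
    finally show ?thesis .
  next
    case False
    then have "j \<le> 4 * b * 1" using b by simp
    also have "\<dots> \<le> 4 * b * max 1 (j div b)" by (intro mult_mono) auto
    finally show ?thesis .
  qed
  also have "\<dots> \<le> 4 * b * (d - j)" using m by (intro mult_mono) auto
  finally show "j \<le> 4 * b * (d - j)" .
qed

text \<open>A deletion sees the estimate \<open>e\<close> of the violating arc, but progress
  concerns the true degree \<open>w\<close> of its tail. If \<open>e\<close> exceeds
  \<open>w\<close>, the gap \<open>e - d\<close> of about \<open>d / b\<close> shrinks by at most
  \<open>e / (4 * b)\<close>. As \<open>e\<close> is at most about \<open>3 * d / 2\<close>, a gap
  of \<open>d / (4 * b)\<close> survives.\<close>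

lemma stale_violation_gap:
  assumes b: "b \<ge> 2" and d: "d > 0" and lo: "slack_bound b (d - 1) < e" and hi: "e \<le> slack_bound b d"
    and f: "fresh b p e w"
  shows "Suc d \<le> w" "d \<le> 4 * b * (w - d)"
proof -
  have b0: "b > 0" using b by simp
  have e1: "d + max 1 ((d - 1) div b) \<le> e" using lo d by (simp add: slack_bound_def)
  have base: "Suc d \<le> e" "d \<le> 4 * b * (e - d)"
  proof -
    show "Suc d \<le> e" using e1 by linarith
    have "d \<le> 4 * b * max 1 ((d - 1) div b)"
    proof (cases "b \<le> d - 1")
      case True
      have "d - 1 \<le> 2 * b * ((d - 1) div b)" by (rule div_twice_ge[OF b0 True])
      then have "d \<le> 2 * (2 * b * ((d - 1) div b))" using True b by linarith
      also have "\<dots> = 4 * b * ((d - 1) div b)" by simp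
      also have "\<dots> \<le> 4 * b * max 1 ((d - 1) div b)" by (intro mult_mono) auto
      finally show ?thesis .
    next
      case False
      then have "d \<le> 4 * b * 1" using b by simp
      also have "\<dots> \<le> 4 * b * max 1 ((d - 1) div b)" by (intro mult_mono) auto
      finally show ?thesis .
    qed
    also have "\<dots> \<le> 4 * b * (e - d)" using e1 by (intro mult_mono) auto
    finally show "d \<le> 4 * b * (e - d)" .
  qed
  have "Suc d \<le> w \<and> d \<le> 4 * b * (w - d)"
  proof (cases "e \<le> w")
    case True
    then have "4 * b * (e - d) \<le> 4 * b * (w - d)" by (intro mult_mono) auto
    with True base show ?thesis by linarith
  next
    case False
    then have mx: "max e w = e" "min e w = w" "e \<noteq> w" by auto
    have err: "e - w < refresh_step b e" "4 * b * refresh_step b e \<le> e"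
      using fresh_dist[OF b0 f mx(3)] unfolding mx(1,2) by auto
    have r2: "refresh_step b e \<ge> 2" using err(1) False by linarith
    \<comment> \<open>An overestimate exists only where the step is at least two. The resulting size
      of \<open>e\<close> pays for the rounding terms \<open>4 * b\<close> and \<open>2\<close> in
      the estimates below.\<close>
    have e8: "8 * b \<le> e"
    proof -
      have "4 * b * 2 \<le> 4 * b * refresh_step b e" using r2 by (intro mult_mono) auto
      then show ?thesis using err(2) by linarith
    qed
    have small: "4 * b * (e - w) \<le> e"
    proof -
      have "4 * b * (e - w) \<le> 4 * b * refresh_step b e" using err(1) by (intro mult_mono) auto
      with err(2) show ?thesis by linarith
    qed
    have half: "2 * (d div b) \<le> d"
    proof -
      have "d div b * 2 \<le> d div b * b" using b by (intro mult_mono) auto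
      also have "\<dots> \<le> d" by (simp add: div_times_less_eq_dividend)
      finally show ?thesis by simp
    qed
    have hi': "2 * e \<le> 3 * d + 2" using hi half unfolding slack_bound_def by linarith
    have q: "4 * d \<le> 4 * b * ((d - 1) div b) + 4 * b"
    proof -
      have "d - 1 = b * ((d - 1) div b) + (d - 1) mod b" by simp
      moreover have "(d - 1) mod b < b" using b by simp
      ultimately have "d \<le> b * ((d - 1) div b) + b" using d by linarith
      then have "4 * d \<le> 4 * (b * ((d - 1) div b) + b)" by (rule mult_le_mono2)
      then show ?thesis by (simp only: distrib_left mult.assoc)
    qed
    have "4 * b * ((d - 1) div b) \<le> 4 * b * (e - d)" using e1 by (intro mult_mono) auto
    then have ed: "4 * d \<le> 4 * b * (e - d) + 4 * b" using q by linarith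
    \<comment> \<open>Over the integers, \<open>w - d\<close> can be bounded before its sign is
      known; \<open>d < w\<close> is then a consequence.\<close>
    have i: "4 * int b * (int e - int d) = int (4 * b * (e - d))"
      using base(1) by (simp add: of_nat_diff)
    have i2: "4 * int b * (int e - int w) = int (4 * b * (e - w))"
      using False by (simp add: of_nat_diff)
    have "4 * int b * (int w - int d) = int (4 * b * (e - d)) - int (4 * b * (e - w))"
      unfolding i[symmetric] i2[symmetric] by (simp add: algebra_simps)
    also have "\<dots> \<ge> int d"
      using ed small hi' e8 b by linarith
    finally have k: "4 * int b * (int w - int d) \<ge> int d" .
    have "int w > int d"
    proof (rule ccontr)
      assume "\<not> int w > int d"
      then have "4 * int b * (int w - int d) \<le> 0" by (simp add: mult_nonneg_nonpos)
      with k d show False by linarith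
    qed
    then have wd: "d < w" by simp
    then have "4 * int b * (int w - int d) = int (4 * b * (w - d))" by (simp add: of_nat_diff)
    with k wd show ?thesis by linarith
  qed
  then show "Suc d \<le> w" "d \<le> 4 * b * (w - d)" by auto
qed

section \<open>A logarithmic potential for chains of reversals\<close>

definition chain_potential :: "nat \<Rightarrow> nat \<Rightarrow> nat" where
  "chain_potential b d = nat \<lfloor>16 * real b * ln (1 + real d / (4 * real b))\<rfloor>"

lemma chain_potential_mono:
  assumes "b > 0" "d \<le> d'" shows "chain_potential b d \<le> chain_potential b d'"
proof -
  have "ln (1 + real d / (4 * real b)) \<le> ln (1 + real d' / (4 * real b))"
    using assms by (subst ln_le_cancel_iff) (auto intro!: divide_right_mono add_pos_nonneg)
  then show ?thesis unfolding chain_potential_def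
    using assms by (intro nat_mono floor_mono mult_left_mono) auto
qed

text \<open>The gap makes \<open>4 * b + d\<close> grow by a factor of at least
  \<open>1 + 1 / (8 * b)\<close>, whose logarithm is at least \<open>1 / (16 * b)\<close>. The
  factor \<open>16 * b\<close> in the potential turns this into a full unit, so rounding down keeps
  the increase strict.\<close>

lemma chain_potential_less:
  assumes b: "b > 0" and "Suc d \<le> d'" and gap: "d \<le> 4 * b * (d' - d)"
  shows "chain_potential b d < chain_potential b d'"
proof -
  define B x y where "B = 4 * real b" and "x = real d" and "y = real d'"
  have B: "B \<ge> 4" using b by (simp add: B_def)
  have x0: "x \<ge> 0" by (simp add: x_def)
  have xy: "x + 1 \<le> y" using assms(2) by (simp add: x_def y_def)
  have "real d \<le> real (4 * b * (d' - d))" using gap by (rule of_nat_mono)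
  then have g: "x \<le> B * (y - x)" using assms(2) by (simp add: x_def y_def B_def of_nat_diff)
  have "B \<le> B * (y - x)" using xy B by simp
  then have g2: "B + x \<le> 2 * B * (y - x)" using g by linarith
  define z where "z = (y - x) / (B + x)"
  have pos: "B + x > 0" using B x0 by simp
  have z: "1 / (2 * B) \<le> z" using g2 pos B by (simp add: z_def field_simps)
  have eq: "1 + y / B = (1 + x / B) * (1 + z)"
  proof -
    have "1 + x / B = (B + x) / B" using B by (simp add: add_divide_distrib)
    moreover have "1 + z = (B + y) / (B + x)" using pos by (simp add: z_def field_simps)
    ultimately have "(1 + x / B) * (1 + z) = (B + x) / B * ((B + y) / (B + x))" by simp
    also have "\<dots> = (B + y) / B" using pos by simp
    finally show ?thesis using B by (simp add: add_divide_distrib)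
  qed
  have px: "1 + x / B > 0" using B x0 by (simp add: add_pos_nonneg)
  have z0: "z > 0" using xy pos by (simp add: z_def)
  have "ln (1 + y / B) = ln (1 + x / B) + ln (1 + z)"
    unfolding eq using px z0 by (simp add: ln_mult)
  moreover have "ln (1 + z) \<ge> 1 / (4 * B)"
  proof -
    define w where "w = 1 / (2 * B)"
    have w: "0 < w" "w \<le> 1" using B by (auto simp: w_def field_simps)
    have "w - w\<^sup>2 \<le> ln (1 + w)" using ln_one_plus_pos_lower_bound[of w] w by simp
    moreover have "w\<^sup>2 \<le> w * (1/2)" unfolding power2_eq_square using w B
      by (intro mult_left_mono) (auto simp: w_def field_simps)
    moreover have "ln (1 + w) \<le> ln (1 + z)"
      using z w by (intro ln_mono) (auto simp: w_def add_pos_nonneg)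
    ultimately have "w / 2 \<le> ln (1 + z)" by linarith
    then show ?thesis by (simp add: w_def)
  qed
  ultimately have "ln (1 + x / B) + 1 / (4 * B) \<le> ln (1 + y / B)" by linarith
  then have "4 * B * (ln (1 + x / B) + 1 / (4 * B)) \<le> 4 * B * ln (1 + y / B)"
    using B by (intro mult_left_mono) auto
  then have "4 * B * ln (1 + x / B) + 1 \<le> 4 * B * ln (1 + y / B)"
    using B by (simp add: distrib_left)
  moreover have "4 * B * ln (1 + x / B) \<ge> 0" using B x0 by simp
  ultimately show ?thesis unfolding chain_potential_def B_def x_def y_def
    by (simp only: mult.assoc[symmetric] mult_numeral_left_semiring_numeral) linarith
qed

text \<open>For \<open>j < b\<close> an underestimate is impossible: it would be within a
  \<open>1 / (4 * b)\<close> fraction of a degree of at least \<open>8 * b\<close>, whereas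
  \<open>e \<le> b\<close>. So \<open>d \<le> j + 1\<close>, and \<open>b \<le> d + j\<close> gives
  \<open>b \<le> 3 * j\<close>, which makes the additive one worth at most \<open>3 * j / b\<close>;
  this is where the constant \<open>3\<close> is needed. For \<open>j \<ge> b\<close>, slack and
  staleness together cost less.\<close>

lemma fresh_valid:
  assumes b: "b \<ge> 2" and bj: "b \<le> d + j" and e: "e \<le> slack_bound b j" and f: "fresh b p e d"
  shows "real d \<le> (1 + 3 / real b) * real j"
proof -
  have b0: "b > 0" using b by simp
  have stale: "4 * b * (d - e) < d \<and> 8 * b \<le> d" if "e < d"
  proof -
    from that have mx: "max e d = d" "min e d = e" "e \<noteq> d" by auto
    have err: "d - e < refresh_step b d" "4 * b * refresh_step b d \<le> d"
      using fresh_dist[OF b0 f mx(3)] unfolding mx(1,2) by auto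
    have "4 * b * (d - e) < 4 * b * refresh_step b d" using err(1) b0 by simp
    moreover have "4 * b * 2 \<le> 4 * b * refresh_step b d" using err(1) that by (intro mult_mono) auto
    ultimately show ?thesis using err(2) by linarith
  qed
  have "b * d \<le> (b + 3) * j"
  proof (cases "j < b")
    case True
    then have sb: "slack_bound b j = Suc j" by (simp add: slack_bound_def)
    have "d \<le> Suc j"
    proof (cases "e < d")
      case True
      with stale e sb \<open>j < b\<close> have s: "4 * b * (d - e) < d" "8 * b \<le> d" "e \<le> b" by auto
      have "8 * (d - e) \<le> 4 * b * (d - e)" using b by (intro mult_mono) auto
      with s b show ?thesis by linarith
    qed (use e sb in simp)
    moreover from this have "b \<le> 3 * j" using bj b by linarith
    moreover from calculation(1) have "b * d \<le> b * Suc j" by (intro mult_left_mono) auto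
    ultimately have "b * d \<le> b * j + 3 * j" by simp
    then show ?thesis by (simp add: algebra_simps)
  next
    case False
    then have "j div b \<ge> 1" using b0 by (simp add: div_greater_zero_iff Suc_le_eq)
    then have "e \<le> j + j div b" using e by (simp add: slack_bound_def)
    then have "b * e \<le> b * (j + j div b)" by simp
    also have "\<dots> = b * j + b * (j div b)" by (simp add: distrib_left)
    also have "\<dots> \<le> b * j + j" by (simp add: times_div_less_eq_dividend)
    finally have be: "b * e \<le> b * j + j" .
    show ?thesis
    proof (cases "e < d")
      case True
      from stale[OF this] have "4 * b * (d - e) < d" by simp
      then have "4 * (b * d) < 4 * (b * e) + d" using True
        by (simp add: diff_mult_distrib2)
      then have s: "4 * (b * d) < 4 * (b * j) + 4 * j + d" using be by linarith
      \<comment> \<open>The factor \<open>4 * b - 1\<close> collects the \<open>d\<close> on both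
        sides of the staleness bound; the target then holds with surplus
        \<open>(7 * b - 3) * j\<close>.\<close>
      have "(4 * b - 1) * (b * d) \<le> (4 * b - 1) * ((b + 3) * j)"
      proof -
        have "4 * (b * d) - d \<le> 4 * (b * j) + 4 * j" using s by linarith
        then have "b * (4 * (b * d) - d) \<le> b * (4 * (b * j) + 4 * j)" by simp
        then have 1: "(4 * b - 1) * (b * d) \<le> 4 * b * b * j + 4 * b * j"
          by (simp add: algebra_simps)
        have "(4 * int b - 1) * ((int b + 3) * int j) - (4 * int b * int b * int j + 4 * int b * int j)
          = (7 * int b - 3) * int j" by (simp add: algebra_simps)
        also have "\<dots> \<ge> 0" using b by simp
        finally have "int (4 * b * b * j + 4 * b * j) \<le> int ((4 * b - 1) * ((b + 3) * j))"
          using b by (simp add: of_nat_diff)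
        with 1 show ?thesis by linarith
      qed
      then show ?thesis using b by simp
    next
      case False
      then have "b * d \<le> b * e" by (intro mult_left_mono) auto
      then have "b * d \<le> b * j + 3 * j" using be by linarith
      then show ?thesis by (simp only: distrib_right)
    qed
  qed
  then have "real (b * d) \<le> real ((b + 3) * j)" by (rule of_nat_mono)
  then have "real b * real d \<le> real b * ((1 + 3 / real b) * real j)"
    using b0 by (simp add: algebra_simps)
  then show ?thesis using b0 by simp
qed

section \<open>Density and bags\<close>

lemma outdegree_le_density:
  fixes A :: "'a set" and tl hd :: "'a \<Rightarrow> 'v" and b m :: nat
  defines "dg \<equiv> \<lambda>v. card {a \<in> A. tl a = v}"
  assumes fin: "finite A" "finite V" and b: "b > 0"
    and tl: "\<And>a. a \<in> A \<Longrightarrow> tl a \<in> V" and hd: "\<And>a. a \<in> A \<Longrightarrow> hd a \<in> V"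
    and valid: "\<And>a. a \<in> A \<Longrightarrow> real (dg (tl a)) \<le> (1 + 3 / real b) * real (dg (hd a))"
    and dense: "\<And>U. U \<subseteq> V \<Longrightarrow> U \<noteq> {} \<Longrightarrow>
        real (card {a \<in> A. tl a \<in> U \<and> hd a \<in> U}) \<le> D * real (card U)"
    and m: "card V \<le> 2 ^ m" and v: "v \<in> V"
  shows "real (dg v) \<le> 2 * (1 + 3 / real b) ^ m * D"
proof -
  define q where "q = 1 + 3 / real b"
  have q: "q \<ge> 1" by (simp add: q_def)
  define S where "S = (\<lambda>i. {x \<in> V. real (dg v) \<le> q ^ i * real (dg x)})"
  have SV: "S i \<subseteq> V" and finS: "finite (S i)" for i
    using fin(2) by (auto simp: S_def)
  have vS: "v \<in> S i" for i
    using v q by (auto simp: S_def mult_le_cancel_right1 one_le_power)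
  \<comment> \<open>If every step more than doubled the set, then starting from
    \<open>v \<in> S 0\<close> the set \<open>S (Suc m)\<close> would outgrow
    \<open>V\<close>.\<close>
  obtain i where i: "i \<le> m" "card (S (Suc i)) \<le> 2 * card (S i)"
  proof (rule ccontr)
    assume nt: "\<not> thesis"
    have gr: "2 * card (S i) < card (S (Suc i))" if "i \<le> m" for i
    proof (rule ccontr)
      assume "\<not> ?thesis"
      then have thesis using that by (intro \<open>\<And>i. i \<le> m \<Longrightarrow> card (S (Suc i)) \<le> 2 * card (S i) \<Longrightarrow> thesis\<close>) auto
      with nt show False ..
    qed
    have "2 ^ i \<le> card (S i)" if "i \<le> Suc m" for i
      using that
    proof (induction i)
      case 0
      then show ?case using vS[of 0] finS[of 0] by (simp add: Suc_le_eq card_gt_0_iff) blast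
    next
      case (Suc i)
      then show ?case using gr[of i] by simp
    qed
    from this[of "Suc m"] have "2 * 2 ^ m \<le> card (S (Suc m))" by simp
    also have "\<dots> \<le> 2 ^ m" using card_mono[OF fin(2) SV, of "Suc m"] m by linarith
    finally show False by simp
  qed
  have closed: "hd a \<in> S (Suc i)" if "a \<in> A" "tl a \<in> S i" for a
  proof -
    have "real (dg v) \<le> q ^ i * real (dg (tl a))" using that by (simp add: S_def)
    also have "\<dots> \<le> q ^ i * (q * real (dg (hd a)))"
      using valid[OF that(1)] q by (intro mult_left_mono) (auto simp: q_def)
    finally show ?thesis using hd[OF that(1)] by (simp add: S_def mult.assoc mult.left_commute)
  qed
  have mono: "S i \<subseteq> S (Suc i)"
  proof
    fix x assume x: "x \<in> S i"
    have "q ^ i * real (dg x) \<le> q ^ Suc i * real (dg x)"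
      using q by (intro mult_right_mono power_increasing) auto
    with x show "x \<in> S (Suc i)" by (auto simp: S_def)
  qed
  have sumdg: "(\<Sum>x\<in>S i. dg x) = card {a \<in> A. tl a \<in> S i}"
  proof -
    have "{a \<in> A. tl a \<in> S i} = (\<Union>x\<in>S i. {a \<in> A. tl a = x})" by auto
    moreover have "card (\<Union>x\<in>S i. {a \<in> A. tl a = x}) = (\<Sum>x\<in>S i. dg x)"
      unfolding dg_def using fin(1) finS by (subst card_UN_disjoint) auto
    ultimately show ?thesis by simp
  qed
  have "real (card (S i)) * real (dg v) = (\<Sum>x\<in>S i. real (dg v))" by simp
  also have "\<dots> \<le> (\<Sum>x\<in>S i. q ^ i * real (dg x))"
    by (intro sum_mono) (simp add: S_def)
  also have "\<dots> = q ^ i * real (\<Sum>x\<in>S i. dg x)" by (simp add: sum_distrib_left)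
  also have "\<dots> \<le> q ^ i * real (card {a \<in> A. tl a \<in> S (Suc i) \<and> hd a \<in> S (Suc i)})"
    unfolding sumdg using q fin(1) closed mono
    by (intro mult_left_mono of_nat_mono card_mono) auto
  also have "\<dots> \<le> q ^ i * (D * real (card (S (Suc i))))"
    using vS[of "Suc i"] q by (intro mult_left_mono dense SV) auto
  finally have main: "real (card (S i)) * real (dg v) \<le> q ^ i * (D * real (card (S (Suc i))))" .
  have cpos: "card (S i) > 0" using vS[of i] finS[of i] by (auto simp: card_gt_0_iff)
  \<comment> \<open>The density hypothesis for a single vertex already forces \<open>D\<close> to be
    nonnegative.\<close>
  have "0 \<le> D * real (card {v})"
    using dense[of "{v}"] v by (intro order_trans[OF _ dense[of "{v}"]]) auto
  then have D: "D \<ge> 0" by simp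
  have "q ^ i * (D * real (card (S (Suc i)))) \<le> q ^ m * (D * (2 * real (card (S i))))"
    using i q D of_nat_mono[OF i(2), where ?'a = real]
    by (intro mult_mono power_increasing) auto
  with main have "real (card (S i)) * real (dg v) \<le> real (card (S i)) * (2 * q ^ m * D)"
    by (simp add: mult_ac)
  then have "real (dg v) \<le> 2 * q ^ m * D"
    by (rule mult_left_le_imp_le) (use cpos in simp)
  then show ?thesis unfolding q_def .
qed

text \<open>The bound for removing an edge is needed because the cost of a deletion depends on the
  degrees before it, while the running time is stated with the density after it. One edge changes a
  quotient by at most one since a nonempty subgraph has a vertex.\<close>

lemma max_density_props:
  assumes V: "finite V" "V \<noteq> {}" and E: "finite E"
  shows max_density_nonneg: "max_density V E \<ge> 0"
    and max_density_ge: "U \<noteq> {} \<Longrightarrow> U \<subseteq> V \<Longrightarrow> F \<subseteq> E \<Longrightarrow> \<forall>e\<in>F. e \<subseteq> U \<Longrightarrow>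
      real (card F) / real (card U) \<le> max_density V E"
    and max_density_Diff: "max_density V E \<le> max_density V (E - {e}) + 1"
    and max_density_mono: "F \<subseteq> E \<Longrightarrow> max_density V F \<le> max_density V E"
proof -
  define X where "X = (\<lambda>E. {real (card F) / real (card U) | U F.
            U \<noteq> {} \<and> U \<subseteq> V \<and> F \<subseteq> E \<and> (\<forall>e\<in>F. e \<subseteq> U)})"
  have md: "max_density V E = Max (X E)" for E by (simp add: max_density_def X_def)
  have fin: "finite (X E')" if "finite E'" for E'
  proof -
    have "X E' \<subseteq> (\<lambda>(U, F). real (card F) / real (card U)) ` (Pow V \<times> Pow E')"
      by (auto simp: X_def)
    then show ?thesis using V(1) that by (auto intro: finite_subset)
  qed
  have ne: "0 \<in> X E'" for E'
  proof -
    have "real (card {}) / real (card V) \<in> X E'" 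
      unfolding X_def mem_Collect_eq by (intro exI[of _ V] exI[of _ "{}"]) (use V(2) in auto)
    then show ?thesis by simp
  qed
  show "max_density V E \<ge> 0" unfolding md by (rule Max_ge[OF fin[OF E] ne])
  show "real (card F) / real (card U) \<le> max_density V E"
    if "U \<noteq> {}" "U \<subseteq> V" "F \<subseteq> E" "\<forall>e\<in>F. e \<subseteq> U" for U F
    unfolding md by (rule Max_ge[OF fin[OF E]]) (use that in \<open>auto simp: X_def\<close>)
  show "max_density V F \<le> max_density V E" if "F \<subseteq> E" for F
    unfolding md
  proof (rule Max_mono)
    show "X F \<subseteq> X E" using that unfolding X_def by blast
  qed (use fin[OF E] ne in auto)
  show "max_density V E \<le> max_density V (E - {e}) + 1"
    unfolding md
  proof (rule Max.boundedI[OF fin[OF E]])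
    show "X E \<noteq> {}" using ne by blast
    fix x assume "x \<in> X E"
    then obtain U F where UF: "x = real (card F) / real (card U)" "U \<noteq> {}" "U \<subseteq> V" "F \<subseteq> E"
      "\<forall>e\<in>F. e \<subseteq> U" by (auto simp: X_def)
    have fU: "finite U" "finite F"
      using finite_subset[OF UF(3) V(1)] finite_subset[OF UF(4) E] by auto
    have cU: "card U \<ge> 1" using UF(2) fU by (simp add: Suc_le_eq card_gt_0_iff)
    have "card F \<le> card (F - {e}) + 1" 
      using card_Suc_Diff1[OF fU(2), of e] by (cases "e \<in> F") auto
    then have "x \<le> (real (card (F - {e})) + 1) / real (card U)"
      unfolding UF(1) using cU by (intro divide_right_mono) auto
    also have "\<dots> = real (card (F - {e})) / real (card U) + 1 / real (card U)"
      by (simp add: add_divide_distrib)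
    also have "1 / real (card U) \<le> 1" using cU by simp
    also have "real (card (F - {e})) / real (card U) \<le> Max (X (E - {e}))"
    proof (rule Max_ge[OF fin])
      show "real (card (F - {e})) / real (card U) \<in> X (E - {e})"
        unfolding X_def mem_Collect_eq by (intro exI[of _ U] exI[of _ "F - {e}"]) (use UF in auto)
    qed (use E in simp)
    finally show "x \<le> Max (X (E - {e})) + 1" by simp
  qed
qed

text \<open>Items \<open>X\<close> are partitioned by \<open>key\<close> into bags; bag \<open>k\<close> occupies the cells
  \<open>k * M, \<dots>, k * M + cnt k - 1\<close> of \<open>arr\<close>, and \<open>pos\<close> inverts \<open>arr\<close>.\<close>
definition bags :: "nat \<Rightarrow> nat \<Rightarrow> (nat \<Rightarrow> nat) \<Rightarrow> (nat \<Rightarrow> nat) \<Rightarrow> (nat \<Rightarrow> nat) \<Rightarrow> (nat \<Rightarrow> nat) \<Rightarrow> nat set \<Rightarrow> bool" where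
  "bags M N arr cnt pos key X \<longleftrightarrow>
     (\<forall>x\<in>X. key x < N \<and> pos x < cnt (key x) \<and> arr (key x * M + pos x) = x) \<and>
     (\<forall>k<N. \<forall>i<cnt k. \<exists>x\<in>X. key x = k \<and> pos x = i) \<and> (\<forall>k<N. cnt k < M)"

section \<open>Updates of bags\<close>

lemma slot_eq_iff: "i < M \<Longrightarrow> j < M \<Longrightarrow> (k * M + i = l * M + j) = (k = l \<and> i = j)" for M :: nat
  by (metis div_mult_self3 div_less add_cancel_right_right add_left_imp_eq less_nat_zero_code)

lemma bagsD:
  assumes "bags M N arr cnt pos key X" "x \<in> X"
  shows "key x < N" "pos x < cnt (key x)" "arr (key x * M + pos x) = x" "cnt (key x) < M" "pos x < M"
  using assms unfolding bags_def by (auto intro: less_trans)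

lemma bags_slot:
  assumes "bags M N arr cnt pos key X" "k < N" "i < cnt k"
  shows "arr (k * M + i) \<in> X" "key (arr (k * M + i)) = k" "pos (arr (k * M + i)) = i"
  using assms unfolding bags_def by (metis)+

lemma bags_inj:
  assumes "bags M N arr cnt pos key X" "x \<in> X" "y \<in> X" "key x = key y" "pos x = pos y"
  shows "x = y"
  using assms unfolding bags_def by metis

text \<open>\<open>pos\<close> maps a bag bijectively onto an initial segment of cells. For bags
  keyed by tail this makes the counter array a table of out-degrees.\<close>

lemma bags_cnt:
  assumes B: "bags M N arr cnt pos key X" and k: "k < N"
  shows "cnt k = card {x \<in> X. key x = k}"
proof -
  have "bij_betw pos {x \<in> X. key x = k} {..<cnt k}"
    unfolding bij_betw_def
  proof
    show "inj_on pos {x \<in> X. key x = k}"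
      using bags_inj[OF B] by (auto simp: inj_on_def)
    show "pos ` {x \<in> X. key x = k} = {..<cnt k}"
      using B k unfolding bags_def by (auto simp: image_iff) metis
  qed
  then show ?thesis by (metis bij_betw_same_card card_lessThan)
qed

lemma bags_push:
  assumes B: "bags M N arr cnt pos key X" and x: "x \<notin> X" and k: "k < N" and c: "Suc (cnt k) < M"
  shows "bags M N (arr(k * M + cnt k := x)) (cnt(k := Suc (cnt k))) (pos(x := cnt k)) (key(x := k)) (insert x X)"
proof -
  have ne: "y \<noteq> x" if "y \<in> X" for y using that x by auto
  have slot: "key y * M + pos y \<noteq> k * M + cnt k" if "y \<in> X" for y
    using bagsD[OF B that] c by (auto simp: slot_eq_iff)
  show ?thesis
    unfolding bags_def
  proof (intro conjI ballI allI impI)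
    fix y assume y: "y \<in> insert x X"
    show "(key(x := k)) y < N" using y k bagsD(1)[OF B] by auto
    show "(pos(x := cnt k)) y < (cnt(k := Suc (cnt k))) ((key(x := k)) y)"
      using y bagsD(2)[OF B] by (auto intro: less_SucI)
    show "(arr(k * M + cnt k := x)) ((key(x := k)) y * M + (pos(x := cnt k)) y) = y"
      using y slot bagsD(3)[OF B] by (cases "y = x") auto
  next
    fix l i assume l: "l < N" "i < (cnt(k := Suc (cnt k))) l"
    show "\<exists>y\<in>insert x X. (key(x := k)) y = l \<and> (pos(x := cnt k)) y = i"
    proof (cases "l = k \<and> i = cnt k")
      case True then show ?thesis by auto
    next
      case False
      then have "i < cnt l" using l by (auto split: if_splits simp: less_Suc_eq)
      then obtain y where "y \<in> X" "key y = l" "pos y = i" using B l(1) unfolding bags_def by blast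
      then show ?thesis using ne[of y] by (intro bexI[of _ y]) auto
    qed
  next
    fix l assume "l < N" then show "(cnt(k := Suc (cnt k))) l < M"
      using B c unfolding bags_def by auto
  qed
qed

text \<open>The last item fills the gap. If \<open>x\<close> is itself last, the writes to
  \<open>arr\<close> and \<open>pos\<close> restore what is there, so the program needs no case
  distinction. The further conclusions identify the moved item, whose new position makes its old
  estimate unreliable when the bags are keyed by tail.\<close>

lemma bags_remove:
  assumes B: "bags M N arr cnt pos key X" and x: "x \<in> X"
  defines "l \<equiv> cnt (key x) - 1" defines "y \<equiv> arr (key x * M + l)"
  shows "bags M N (arr(key x * M + pos x := y)) (cnt(key x := l)) (pos(y := pos x)) key (X - {x})"
    and "y \<in> X" "key y = key x" "pos y = l"
proof -
  note xD = bagsD[OF B x]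
  have l: "l < cnt (key x)" "Suc l = cnt (key x)" using xD by (auto simp: l_def)
  show y: "y \<in> X" "key y = key x" "pos y = l"
    unfolding y_def by (rule bags_slot[OF B xD(1) l(1)])+
  show "bags M N (arr(key x * M + pos x := y)) (cnt(key x := l)) (pos(y := pos x)) key (X - {x})"
    unfolding bags_def
  proof (intro conjI ballI allI impI)
    fix z assume z: "z \<in> X - {x}"
    note zD = bagsD[OF B, of z]
    show "key z < N" using z zD by auto
    have ney: "key z = key x \<Longrightarrow> z \<noteq> y \<Longrightarrow> pos z \<noteq> l" using bags_inj[OF B, of z y] z y by auto
    have nyx: "z = y \<Longrightarrow> pos x \<noteq> l" using bags_inj[OF B, of x y] z y x by auto
    show "(pos(y := pos x)) z < (cnt(key x := l)) (key z)"
    proof (cases "z = y")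
      case True
      then have "pos x < Suc l" "pos x \<noteq> l" using nyx xD(2) l(2) by auto
      then show ?thesis using True y by simp
    next
      case False
      show ?thesis
      proof (cases "key z = key x")
        case True
        then have "pos z < Suc l" "pos z \<noteq> l" using ney False zD(2) z l(2) by auto
        then show ?thesis using True False by simp
      qed (use False zD(2) z in simp)
    qed
    have "key z * M + pos z \<noteq> key x * M + pos x"
      using zD z xD bags_inj[OF B, of z x] x by (auto simp: slot_eq_iff)
    then show "(arr(key x * M + pos x := y)) (key z * M + (pos(y := pos x)) z) = z"
      using z zD y by (cases "z = y") auto
  next
    fix k i assume k: "k < N" "i < (cnt(key x := l)) k"
    then have "i < cnt k" using l by (auto split: if_splits)
    then obtain z where z: "z \<in> X" "key z = k" "pos z = i" using B k(1) unfolding bags_def by blast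
    show "\<exists>z\<in>X - {x}. key z = k \<and> (pos(y := pos x)) z = i"
    proof (cases "z = x")
      case True
      then have "k = key x" "i = pos x" using z by auto
      moreover have "x \<noteq> y" using k y calculation by auto
      ultimately show ?thesis using y by (intro bexI[of _ y]) auto
    next
      case False
      moreover have "z \<noteq> y" using z k y by auto
      ultimately show ?thesis using z by (intro bexI[of _ z]) auto
    qed
  next
    fix k assume "k < N" then show "(cnt(key x := l)) k < M"
      using B l xD unfolding bags_def by auto
  qed
qed

text \<open>For insertions: the arc that is passed on vacates exactly the slot that the incoming arc
  takes, so no counter and no other position changes, and freshness elsewhere is untouched.\<close>

lemma bags_replace:
  assumes B: "bags M N arr cnt pos key X" and x: "x \<in> X" and z: "z \<notin> X"
    and k: "k = key x" and i: "i = pos x"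
  shows "bags M N (arr(k * M + i := z)) cnt (pos(z := i)) (key(z := k)) (insert z (X - {x}))"
proof -
  note xD = bagsD[OF B x]
  show ?thesis
    unfolding bags_def k i
  proof (intro conjI ballI allI impI)
    fix y assume y: "y \<in> insert z (X - {x})"
    note yD = bagsD[OF B, of y]
    show "(key(z := key x)) y < N" using y yD xD by auto
    show "(pos(z := pos x)) y < cnt ((key(z := key x)) y)" using y yD xD by auto
    have "y \<noteq> z \<Longrightarrow> key y * M + pos y \<noteq> key x * M + pos x"
      using yD y xD bags_inj[OF B, of y x] x by (auto simp: slot_eq_iff)
    then show "(arr(key x * M + pos x := z)) ((key(z := key x)) y * M + (pos(z := pos x)) y) = y"
      using y yD by (cases "y = z") auto
  next
    fix l j assume l: "l < N" "j < cnt l"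
    then obtain y where y: "y \<in> X" "key y = l" "pos y = j" using B unfolding bags_def by blast
    show "\<exists>y\<in>insert z (X - {x}). (key(z := key x)) y = l \<and> (pos(z := pos x)) y = j"
    proof (cases "y = x")
      case True then show ?thesis using y by (intro bexI[of _ z]) auto
    next
      case False then show ?thesis using y z by (intro bexI[of _ y]) auto
    qed
  next
    fix k assume "k < N" then show "cnt k < M" using B unfolding bags_def by auto
  qed
qed

text \<open>For deletions: the arc to be deleted and the reversed arc exchange slots, so both
  vertices keep their out-degrees and all other arcs their positions.\<close>

lemma bags_swap:
  assumes B: "bags M N arr cnt pos key X" and x: "x \<in> X" and y: "y \<in> X"
    and k: "k = key x" "l = key y" and i: "i = pos x" "j = pos y"
  shows "bags M N (arr(k * M + i := y, l * M + j := x)) cnt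
           (pos(x := j, y := i)) (key(x := l, y := k)) X"
proof -
  note xD = bagsD[OF B x] and yD = bagsD[OF B y]
  show ?thesis
    unfolding bags_def k i
  proof (intro conjI ballI allI impI)
    fix z assume z: "z \<in> X"
    note zD = bagsD[OF B z]
    show "(key(x := key y, y := key x)) z < N" using zD xD yD by auto
    show "(pos(x := pos y, y := pos x)) z < cnt ((key(x := key y, y := key x)) z)"
      using zD xD yD by auto
    have "z \<noteq> x \<Longrightarrow> key z * M + pos z \<noteq> key x * M + pos x"
      using zD xD bags_inj[OF B z x] by (auto simp: slot_eq_iff)
    moreover have "z \<noteq> y \<Longrightarrow> key z * M + pos z \<noteq> key y * M + pos y"
      using zD yD bags_inj[OF B z y] by (auto simp: slot_eq_iff)
    ultimately show "(arr(key x * M + pos x := y, key y * M + pos y := x))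
        ((key(x := key y, y := key x)) z * M + (pos(x := pos y, y := pos x)) z) = z"
      using zD xD yD bags_inj[OF B x y] by (cases "z = x"; cases "z = y") (auto simp: slot_eq_iff)
  next
    fix m t assume m: "m < N" "t < cnt m"
    then obtain z where z: "z \<in> X" "key z = m" "pos z = t" using B unfolding bags_def by blast
    show "\<exists>z\<in>X. (key(x := key y, y := key x)) z = m \<and> (pos(x := pos y, y := pos x)) z = t"
    proof (cases "z = x")
      case True then show ?thesis using z y by (intro bexI[of _ y]) auto
    next
      case False
      show ?thesis
      proof (cases "z = y")
        case True then show ?thesis using z x False by (intro bexI[of _ x]) auto
      qed (use False z in \<open>auto intro!: bexI[of _ z]\<close>)
    qed
  next
    fix k assume "k < N" then show "cnt k < M" using B unfolding bags_def by auto
  qed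
qed

section \<open>Timed correctness of programs\<close>

definition bounded_memory :: "nat \<Rightarrow> memory \<Rightarrow> bool" where
  "bounded_memory W s \<longleftrightarrow> (\<forall>a i. s a i < W)"

text \<open>Evaluation in unbounded arithmetic; it agrees with \<open>eval\<close> as long as nothing overflows.\<close>
fun ev :: "exp \<Rightarrow> memory \<Rightarrow> nat" where
  "ev (Const c) s = c"
| "ev (Read a e) s = s a (ev e s)"
| "ev (Add e f) s = ev e s + ev f s"
| "ev (Sub e f) s = ev e s - ev f s"
| "ev (Mul e f) s = ev e s * ev f s"
| "ev (Div e f) s = ev e s div ev f s"
| "ev (Mod e f) s = ev e s mod ev f s"
| "ev (Less e f) s = (if ev e s < ev f s then 1 else 0)"

text \<open>\<open>Sub\<close>, \<open>Div\<close> and \<open>Mod\<close> never exceed their first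
  operand and a test yields at most one, so only constants, sums and products need a bound.\<close>

fun fits :: "nat \<Rightarrow> exp \<Rightarrow> memory \<Rightarrow> bool" where
  "fits W (Const c) s \<longleftrightarrow> c < W"
| "fits W (Read a e) s \<longleftrightarrow> fits W e s"
| "fits W (Add e f) s \<longleftrightarrow> fits W e s \<and> fits W f s \<and> ev e s + ev f s < W"
| "fits W (Sub e f) s \<longleftrightarrow> fits W e s \<and> fits W f s"
| "fits W (Mul e f) s \<longleftrightarrow> fits W e s \<and> fits W f s \<and> ev e s * ev f s < W"
| "fits W (Div e f) s \<longleftrightarrow> fits W e s \<and> fits W f s"
| "fits W (Mod e f) s \<longleftrightarrow> fits W e s \<and> fits W f s"
| "fits W (Less e f) s \<longleftrightarrow> fits W e s \<and> fits W f s"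

lemma eval_eq_ev:
  assumes W: "W > 1" and s: "bounded_memory W s"
  shows "fits W e s \<Longrightarrow> eval W e s = ev e s \<and> ev e s < W"
proof (induction e)
  case (Sub e f)
  then show ?case by (auto intro: le_less_trans[OF diff_le_self])
next
  case (Div e f)
  then have "ev e s div ev f s < W" by (auto intro: le_less_trans[OF div_le_dividend])
  with Div show ?case by simp
next
  case (Mod e f)
  then have "ev e s mod ev f s < W" by (auto intro: le_less_trans[OF mod_less_eq_dividend])
  with Mod show ?case by simp
qed (use W s in \<open>auto simp: bounded_memory_def\<close>)

fun loop_free :: "cmd \<Rightarrow> bool" where
  "loop_free (Seq c d) \<longleftrightarrow> loop_free c \<and> loop_free d"
| "loop_free (If e c d) \<longleftrightarrow> loop_free c \<and> loop_free d"
| "loop_free (While e c) \<longleftrightarrow> False"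
| "loop_free _ \<longleftrightarrow> True"

text \<open>The value on loops is irrelevant.\<close>
fun run :: "cmd \<Rightarrow> memory \<Rightarrow> memory" where
  "run Skip s = s"
| "run (Write a e f) s = s(a := (s a)(ev e s := ev f s))"
| "run (Seq c d) s = run d (run c s)"
| "run (If e c d) s = (if ev e s \<noteq> 0 then run c s else run d s)"
| "run (While e c) s = s"

fun runs_ok :: "nat \<Rightarrow> cmd \<Rightarrow> memory \<Rightarrow> bool" where
  "runs_ok W Skip s \<longleftrightarrow> True"
| "runs_ok W (Write a e f) s \<longleftrightarrow> fits W e s \<and> fits W f s"
| "runs_ok W (Seq c d) s \<longleftrightarrow> runs_ok W c s \<and> runs_ok W d (run c s)"
| "runs_ok W (If e c d) s \<longleftrightarrow> fits W e s \<and>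
     (if ev e s \<noteq> 0 then runs_ok W c s else runs_ok W d s)"
| "runs_ok W (While e c) s \<longleftrightarrow> False"

text \<open>Adding both branches of a conditional is crude but depends on the program text alone.
  The value on loops is a dummy, as \<open>runs_ok\<close> rejects them.\<close>

fun max_cost :: "cmd \<Rightarrow> nat" where
  "max_cost Skip = 1"
| "max_cost (Write a e f) = cost e + cost f + 1"
| "max_cost (Seq c d) = max_cost c + max_cost d"
| "max_cost (If e c d) = cost e + 1 + (max_cost c + max_cost d)"
| "max_cost (While e c) = 0"

lemma exec_bounded_memory:
  "exec W c s t s' \<Longrightarrow> W > 1 \<Longrightarrow> bounded_memory W s \<Longrightarrow> bounded_memory W s'"
  by (induction rule: exec.induct) (auto simp: bounded_memory_def store_def)

lemma exec_run:
  assumes W: "W > 1"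
  shows "bounded_memory W s \<Longrightarrow> runs_ok W c s \<Longrightarrow> \<exists>t \<le> max_cost c. exec W c s t (run c s)"
proof (induction c arbitrary: s)
  case Skip
  then show ?case using exec_Skip[of W s] by auto
next
  case (Write a e f)
  have "store W a (eval W e s) (eval W f s) s = run (Write a e f) s"
    using eval_eq_ev[OF W Write(1)] Write(2) by (simp add: store_def)
  then have "exec W (Write a e f) s (cost e + cost f + 1) (run (Write a e f) s)"
    using exec_Write[of W a e f s] by metis
  moreover have "cost e + cost f + 1 \<le> max_cost (Write a e f)" by simp
  ultimately show ?case by blast
next
  case (Seq c d)
  from Seq obtain t where t: "t \<le> max_cost c" "exec W c s t (run c s)" by auto
  from Seq exec_bounded_memory[OF t(2) W] obtain t' where
    "t' \<le> max_cost d" "exec W d (run c s) t' (run d (run c s))" by fastforce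
  then have "exec W (Seq c d) s (t + t') (run (Seq c d) s)" "t + t' \<le> max_cost (Seq c d)"
    using t by (auto intro: exec_Seq)
  then show ?case by blast
next
  case (If e c d)
  note ee = eval_eq_ev[OF W If.prems(1), of e]
  show ?case
  proof (cases "ev e s \<noteq> 0")
    case True
    with If obtain t where "t \<le> max_cost c" "exec W c s t (run c s)" by auto
    then have "exec W (If e c d) s (cost e + 1 + t) (run (If e c d) s)"
      "cost e + 1 + t \<le> max_cost (If e c d)"
      using True ee If.prems exec_IfT[of W e s c t "run c s" d] by auto
    then show ?thesis by blast
  next
    case False
    with If obtain t where "t \<le> max_cost d" "exec W d s t (run d s)" by auto
    then have "exec W (If e c d) s (cost e + 1 + t) (run (If e c d) s)"
      "cost e + 1 + t \<le> max_cost (If e c d)"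
      using False ee If.prems exec_IfF[of W e s d t "run d s" c] by auto
    then show ?thesis by blast
  qed
qed auto

text \<open>Boundedness of the memory is assumed and re-established here once and for all, so
  postconditions need not mention it.\<close>

definition timed :: "nat \<Rightarrow> cmd \<Rightarrow> memory \<Rightarrow> nat \<Rightarrow> (memory \<Rightarrow> bool) \<Rightarrow> bool" where
  "timed W c s T Q \<longleftrightarrow> (bounded_memory W s \<longrightarrow>
     (\<exists>t s'. exec W c s t s' \<and> t \<le> T \<and> bounded_memory W s' \<and> Q s'))"

lemma timed_run:
  assumes "W > 1" and "bounded_memory W s \<Longrightarrow> runs_ok W c s \<and> Q (run c s)"
  shows "timed W c s (max_cost c) Q"
  unfolding timed_def using exec_run[OF assms(1)] exec_bounded_memory[OF _ assms(1)] assms(2) by meson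

lemma timed_weaken:
  "timed W c s T Q \<Longrightarrow> T \<le> T' \<Longrightarrow> (\<And>s'. Q s' \<Longrightarrow> Q' s') \<Longrightarrow> timed W c s T' Q'"
  unfolding timed_def by (meson le_trans)

lemma timed_Seq:
  assumes "timed W c s T R" "\<And>s'. R s' \<Longrightarrow> timed W d s' T' Q"
  shows "timed W (Seq c d) s (T + T') Q"
  using assms unfolding timed_def by (meson exec_Seq add_mono)

lemma timed_If:
  assumes W: "W > 1" and "fits W e s"
    and "ev e s \<noteq> 0 \<Longrightarrow> timed W c s T Q" "ev e s = 0 \<Longrightarrow> timed W d s T Q"
  shows "timed W (If e c d) s (cost e + 1 + T) Q"
  unfolding timed_def
proof
  assume s: "bounded_memory W s"
  have ee: "eval W e s = ev e s" using eval_eq_ev[OF W s assms(2)] by simp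
  show "\<exists>t s'. exec W (If e c d) s t s' \<and> t \<le> cost e + 1 + T \<and> bounded_memory W s' \<and> Q s'"
  proof (cases "ev e s = 0")
    case True
    with assms(4) s obtain t s' where "exec W d s t s'" "t \<le> T" "bounded_memory W s'" "Q s'"
      unfolding timed_def by blast
    with True ee show ?thesis
      using exec_IfF[of W e s d t s' c] by (intro exI[of _ "cost e + 1 + t"] exI[of _ s']) auto
  next
    case False
    with assms(3) s obtain t s' where "exec W c s t s'" "t \<le> T" "bounded_memory W s'" "Q s'"
      unfolding timed_def by blast
    with False ee show ?thesis
      using exec_IfT[of W e s c t s' d] by (intro exI[of _ "cost e + 1 + t"] exI[of _ s']) auto
  qed
qed

text \<open>The variant is an argument of the invariant and may drop by more than one in a round.
  The extra round in \<open>Suc m\<close> pays for the final, failing test.\<close>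

lemma timed_While:
  assumes W: "W > 1" and init: "I s m"
    and step: "\<And>s m. bounded_memory W s \<Longrightarrow> I s m \<Longrightarrow> fits W e s \<and>
       (ev e s \<noteq> 0 \<longrightarrow> 0 < m \<and> timed W c s T (\<lambda>s'. \<exists>m'<m. I s' m'))"
  shows "timed W (While e c) s (Suc m * (T + cost e + 1)) (\<lambda>s'. ev e s' = 0 \<and> (\<exists>m. I s' m))"
  using init
proof (induction m arbitrary: s rule: less_induct)
  case (less m)
  show ?case
    unfolding timed_def
  proof
    assume s: "bounded_memory W s"
    note st = step[OF s less.prems]
    have ee: "eval W e s = ev e s" using eval_eq_ev[OF W s] st by blast
    show "\<exists>t s'. exec W (While e c) s t s' \<and> t \<le> Suc m * (T + cost e + 1) \<and> bounded_memory W s' \<and>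
        ev e s' = 0 \<and> (\<exists>m. I s' m)"
    proof (cases "ev e s = 0")
      case True
      then have "exec W (While e c) s (cost e + 1) s" using ee by (intro exec_WhileF) simp
      then show ?thesis using True s less.prems by (intro exI[of _ "cost e + 1"] exI[of _ s]) auto
    next
      case False
      with st s obtain t s1 m' where 1: "exec W c s t s1" "t \<le> T" "bounded_memory W s1" "m' < m" "I s1 m'"
        unfolding timed_def by blast
      from less.IH[OF 1(4,5)] 1(3) obtain t' s2 where
        2: "exec W (While e c) s1 t' s2" "t' \<le> Suc m' * (T + cost e + 1)" "bounded_memory W s2"
          "ev e s2 = 0" "\<exists>m. I s2 m"
        unfolding timed_def by blast
      have "exec W (While e c) s (cost e + 1 + t + t') s2"
        using exec_WhileT[of W e s c t s1 t' s2] False ee 1 2 by simp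
      moreover have "cost e + 1 + t + t' \<le> Suc m * (T + cost e + 1)"
      proof -
        have "Suc m' * (T + cost e + 1) \<le> m * (T + cost e + 1)" using 1(4) by (intro mult_right_mono) auto
        then show ?thesis using 1(2) 2(2) by simp
      qed
      ultimately show ?thesis using 2 by blast
    qed
  qed
qed

section \<open>The program\<close>

abbreviation reg :: "nat \<Rightarrow> exp" where "reg r \<equiv> Read r (Const 0)"
abbreviation setreg :: "nat \<Rightarrow> exp \<Rightarrow> cmd" where "setreg r e \<equiv> Write r (Const 0) e"
abbreviation n_exp :: exp where "n_exp \<equiv> Read 0 (Const 0)"
abbreviation b_exp :: exp where "b_exp \<equiv> Read 0 (Const 1)"

definition stride_exp :: exp where
  "stride_exp = Mul (Const 4) (Mul n_exp b_exp)"

definition slot_exp :: "exp \<Rightarrow> exp \<Rightarrow> exp" where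
  "slot_exp k i = Add (Mul k stride_exp) i"

text \<open>The index of an arc determines the sum of its endpoints; subtracting the stored tail
  gives the head without a second table.\<close>

definition head_exp :: "nat \<Rightarrow> exp" where
  "head_exp r = Sub (Add (Div (Div (reg r) b_exp) n_exp) (Mod (Div (reg r) b_exp) n_exp)) (Read 1 (reg r))"

text \<open>With truncated subtraction, \<open>x + (1 - x)\<close> equals
  \<open>max 1 x\<close>.\<close>

definition slack_exp :: "exp \<Rightarrow> exp" where
  "slack_exp e = Add e (Add (Div e b_exp) (Sub (Const 1) (Div e b_exp)))"

text \<open>Array 1 holds the tail of every arc.  Arrays 2, 3, 4 are the bags of arcs keyed by tail, so
  that array 3 holds the out-degrees.  Arrays 6, 7, 8 are the bags of arcs keyed by array 5, which
  combines the head of an arc with an estimate of the out-degree of its tail.  Arrays from 10 on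
  serve as registers.\<close>

definition push_cmd :: "nat \<Rightarrow> nat \<Rightarrow> nat \<Rightarrow> nat \<Rightarrow> nat \<Rightarrow> nat \<Rightarrow> cmd" where
  "push_cmd arr cnt pos key r k =
     Seq (Write arr (slot_exp (reg k) (Read cnt (reg k))) (reg r))
    (Seq (Write pos (reg r) (Read cnt (reg k)))
    (Seq (Write key (reg r) (reg k))
         (Write cnt (reg k) (Add (Read cnt (reg k)) (Const 1)))))"

text \<open>The counter is lowered first, after which it names the last occupied cell.\<close>

definition remove_cmd :: "nat \<Rightarrow> nat \<Rightarrow> nat \<Rightarrow> nat \<Rightarrow> nat \<Rightarrow> cmd" where
  "remove_cmd arr cnt pos key r =
     Seq (setreg 30 (Read key (reg r)))
    (Seq (Write cnt (reg 30) (Sub (Read cnt (reg 30)) (Const 1)))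
    (Seq (setreg 31 (Read arr (slot_exp (reg 30) (Read cnt (reg 30)))))
    (Seq (Write arr (slot_exp (reg 30) (Read pos (reg r))) (reg 31))
         (Write pos (reg 31) (Read pos (reg r))))))"

definition remove_in :: "nat \<Rightarrow> cmd" where
  "remove_in r = remove_cmd 6 7 8 5 r"

definition add_in :: "nat \<Rightarrow> nat \<Rightarrow> cmd" where
  "add_in r e = Seq (setreg 32 (slot_exp (head_exp r) (reg e))) (push_cmd 6 7 8 5 r 32)"

definition refresh_arc :: "nat \<Rightarrow> nat \<Rightarrow> cmd" where
  "refresh_arc r e = Seq (remove_in r) (add_in r e)"

definition step_loop :: cmd where
  "step_loop = Seq (setreg 21 (Const 1))
     (While (Less (Mul (Mul (Const 8) b_exp) (reg 21)) (Add (reg 20) (Const 1)))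
        (setreg 21 (Add (reg 21) (reg 21))))"

definition out_arc_exp :: exp where
  "out_arc_exp = Read 2 (slot_exp (reg 11) (reg 22))"

definition scan_body :: cmd where
  "scan_body =
     Seq (setreg 24 out_arc_exp)
    (Seq (setreg 25 (head_exp 24))
         (If (Less (slack_exp (Read 3 (reg 25))) (reg 20))
            (setreg 23 (Const 1))
            (setreg 22 (Add (reg 22) (reg 21)))))"

text \<open>The product of two truth values serves as their conjunction: positions remain, and no
  violation has been found.\<close>

definition scan_cond :: exp where
  "scan_cond = Mul (Less (reg 22) (reg 13)) (Sub (Const 1) (reg 23))"

definition scan_loop :: cmd where
  "scan_loop = Seq (setreg 23 (Const 0)) (Seq (setreg 22 (Mod (reg 20) (reg 21)))
     (While scan_cond scan_body))"

definition refresh_body :: cmd where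
  "refresh_body = Seq (setreg 24 out_arc_exp) (Seq (refresh_arc 24 26) (setreg 22 (Add (reg 22) (reg 21))))"

definition refresh_loop :: cmd where
  "refresh_loop = Seq (setreg 22 (Mod (reg 20) (reg 21)))
     (While (Less (reg 22) (reg 13)) refresh_body)"

definition replace_out :: cmd where
  "replace_out =
     Seq (Write 2 (slot_exp (reg 11) (reg 22)) (reg 10))
    (Seq (Write 4 (reg 10) (reg 22))
         (Write 1 (reg 10) (reg 11)))"

text \<open>After a violation the incoming arc gets the estimate in register 13, the old degree: one
  arc enters and another leaves. The evicted arc and its former head become the arc and tail of the
  next step.\<close>

definition insert_step :: cmd where
  "insert_step =
     Seq (Seq (setreg 13 (Read 3 (reg 11))) (setreg 20 (Add (reg 13) (Const 1))))
    (Seq step_loop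
    (Seq scan_loop
         (If (reg 23)
            (Seq (remove_in 24)
            (Seq replace_out
            (Seq (add_in 10 13)
            (Seq (setreg 10 (reg 24)) (setreg 11 (reg 25))))))
            (Seq (push_cmd 2 3 4 1 10 11)
            (Seq (add_in 10 20)
            (Seq (setreg 26 (reg 20))
            (Seq refresh_loop
                 (setreg 12 (Const 0)))))))))"

definition swap_out :: cmd where
  "swap_out =
     Seq (setreg 29 (Read 4 (reg 24)))
    (Seq (Write 2 (slot_exp (reg 11) (Read 4 (reg 10))) (reg 24))
    (Seq (Write 2 (slot_exp (reg 25) (reg 29)) (reg 10))
    (Seq (Write 4 (reg 24) (Read 4 (reg 10)))
    (Seq (Write 4 (reg 10) (reg 29))
    (Seq (Write 1 (reg 24) (reg 11))
         (Write 1 (reg 10) (reg 25)))))))"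

text \<open>If the first bag is empty, the second key is selected unseen; \<open>delete_step\<close>
  reads the counter of the selected bag afterwards.\<close>

definition find_violation :: cmd where
  "find_violation =
     Seq (setreg 11 (Read 1 (reg 10)))
    (Seq (setreg 20 (Read 3 (reg 11)))
    (Seq (setreg 13 (Sub (reg 20) (Const 1)))
    (Seq (setreg 28 (slot_exp (reg 11) (Add (slack_exp (reg 13)) (Const 1))))
         (If (Read 7 (reg 28)) Skip (setreg 28 (Add (reg 28) (Const 1)))))))"

text \<open>Register 20 keeps the old degree \<open>d\<close> for the refresh loop: a descent from
  \<open>d\<close> to \<open>d - 1\<close> crosses the refresh time \<open>d\<close>, because the
  interval in \<open>fresh\<close> is open below and closed above. Register 13 holds the number
  \<open>d - 1\<close> of remaining positions.\<close>

definition delete_step :: cmd where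
  "delete_step =
     Seq find_violation
         (If (Read 7 (reg 28))
            (Seq (Seq (setreg 24 (Read 6 (slot_exp (reg 28) (Const 0)))) (setreg 25 (Read 1 (reg 24))))
            (Seq (remove_in 24)
            (Seq swap_out
                 (add_in 24 20))))
            (Seq (remove_cmd 2 3 4 1 10)
            (Seq (Seq (setreg 22 (Read 4 (reg 10))) (setreg 26 (reg 13)))
            (Seq (If (Less (reg 22) (reg 13)) (Seq (setreg 24 out_arc_exp) (refresh_arc 24 26)) Skip)
            (Seq step_loop
            (Seq refresh_loop
                 (setreg 12 (Const 0))))))))"

definition base_cmd :: cmd where
  "base_cmd = If (Less (Read 0 (Const 2)) (Read 0 (Const 3)))
     (setreg 15 (Mul (Add (Mul (Read 0 (Const 2)) n_exp) (Read 0 (Const 3))) b_exp))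
     (setreg 15 (Mul (Add (Mul (Read 0 (Const 3)) n_exp) (Read 0 (Const 2))) b_exp))"

text \<open>Leaving from the endpoint of smaller out-degree makes the new arc legal at once, because
  \<open>slack_bound b j\<close> exceeds \<open>j\<close>.\<close>

definition insert_start :: cmd where
  "insert_start = Seq (setreg 10 (Add (reg 15) (reg 14)))
    (Seq (If (Less (Read 3 (Read 0 (Const 3))) (Read 3 (Read 0 (Const 2))))
             (setreg 11 (Read 0 (Const 3))) (setreg 11 (Read 0 (Const 2))))
         (setreg 12 (Const 1)))"

definition delete_start :: cmd where
  "delete_start = Seq (setreg 10 (Add (reg 15) (reg 14)))
    (Seq (setreg 12 (Const 1)) (remove_in 10))"

definition for_copies :: "cmd \<Rightarrow> cmd" where
  "for_copies c = Seq (Seq base_cmd (setreg 14 (Const 0)))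
     (While (Less (reg 14) b_exp) (Seq c (setreg 14 (Add (reg 14) (Const 1)))))"

definition insert_cmd :: cmd where
  "insert_cmd = for_copies (Seq insert_start (While (reg 12) insert_step))"

definition delete_cmd :: cmd where
  "delete_cmd = for_copies (Seq delete_start (While (reg 12) delete_step))"

section \<open>Arcs and the state invariant\<close>

text \<open>With \<open>M = 4 * (n * b)\<close> the bound reads \<open>n * M * M < W\<close>: a head
  and an estimate form one of \<open>n * M\<close> keys, and each key owns \<open>M\<close>
  cells.\<close>

locale ram =
  fixes n b W :: nat
  assumes n: "n > 0" and b: "b \<ge> 2" and W_large: "n * (4 * (n * b)) * (4 * (n * b)) < W"
begin

text \<open>Out-degrees stay below \<open>n * b\<close>, so their slack bounds stay below
  \<open>2 * n * b\<close>, and the search for violations looks two values further. The stride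
  exceeds all of these, and every bag size as well.\<close>

definition M :: nat where "M = 4 * (n * b)"
text \<open>An arc is represented by its index \<open>(lo * n + hi) * b + i\<close> in the output table.\<close>
definition lo :: "nat \<Rightarrow> nat" where "lo a = a div b div n"
definition hi :: "nat \<Rightarrow> nat" where "hi a = a div b mod n"
definition ids :: "nat set" where "ids = {a. lo a < hi a \<and> hi a < n}"
definition hd_of :: "memory \<Rightarrow> nat \<Rightarrow> nat" where "hd_of s a = lo a + hi a - s 1 a"
definition est :: "memory \<Rightarrow> nat \<Rightarrow> nat" where "est s a = s 5 a mod M"

definition params :: "memory \<Rightarrow> bool" where
  "params s \<longleftrightarrow> s 0 0 = n \<and> s 0 1 = b"

definition tails_ok :: "memory \<Rightarrow> nat set \<Rightarrow> bool" where
  "tails_ok s H \<longleftrightarrow> H \<subseteq> ids \<and> (\<forall>a\<in>H. s 1 a = lo a \<or> s 1 a = hi a)"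

definition out_ok :: "memory \<Rightarrow> nat set \<Rightarrow> bool" where
  "out_ok s H \<longleftrightarrow> tails_ok s H \<and> bags M n (s 2) (s 3) (s 4) (s 1) H"

definition in_ok :: "memory \<Rightarrow> nat set \<Rightarrow> bool" where
  "in_ok s A \<longleftrightarrow> bags M (n * M) (s 6) (s 7) (s 8) (s 5) A \<and> (\<forall>a\<in>A. s 5 a div M = hd_of s a)"

definition good :: "memory \<Rightarrow> nat set \<Rightarrow> bool" where
  "good s A \<longleftrightarrow> (\<forall>a\<in>A. est s a \<le> slack_bound b (s 3 (hd_of s a)) \<and>
     fresh b (s 4 a) (est s a) (s 3 (s 1 a)))"

lemma b0: "b > 0" using b by simp

lemma M_bounds: "M \<ge> 8" "M > 0" "n * b < M" "2 * (n * b) + 2 < M" "4 * b \<le> M" "2 * n < M"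
proof -
  have "1 * 2 \<le> n * b" using n b by (intro mult_mono) auto
  then show "M \<ge> 8" "M > 0" "n * b < M" "2 * (n * b) + 2 < M" unfolding M_def by linarith+
  have "1 * b \<le> n * b" using n by (intro mult_mono) auto
  then show "4 * b \<le> M" by (simp add: M_def)
  have "n * 2 \<le> n * b" using b by (intro mult_mono) auto
  then show "2 * n < M" using n by (simp add: M_def)
qed

lemma W_bounds: "n * M * M < W" "n * M < W" "M < W" "1 < W" "8 < W" "M * M < W" "M * 8 < W"
proof -
  show 1: "n * M * M < W" using W_large by (simp add: M_def)
  have "n * M * 1 \<le> n * M * M" using M_bounds by (intro mult_mono) auto
  then show 2: "n * M < W" using 1 by linarith
  have "1 * M \<le> n * M" using n by (intro mult_mono) auto
  then show 3: "M < W" using 2 by linarith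
  then show "1 < W" using M_bounds by simp
  show "8 < W" using 3 M_bounds by simp
  have "1 * (M * M) \<le> n * (M * M)" using n by (intro mult_mono) auto
  then have "M * M \<le> n * M * M" by (simp only: mult_1 mult.assoc)
  then show 4: "M * M < W" using 1 by linarith
  have "M * 8 \<le> M * M" using M_bounds by (intro mult_mono) auto
  then show "M * 8 < W" using 4 by linarith
qed

lemma slot_less: "k < m \<Longrightarrow> i < M \<Longrightarrow> k * M + i < m * M"
proof -
  assume "k < m" "i < M"
  then have "k * M + i < Suc k * M" by simp
  also have "\<dots> \<le> m * M" using \<open>k < m\<close> by (intro mult_right_mono) auto
  finally show ?thesis .
qed

lemma in_slot_less_W: "k < n * M \<Longrightarrow> i < M \<Longrightarrow> k * M + i < W"
  using slot_less[of k "n * M" i] W_bounds(1) by linarith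

lemma out_slot_less_W: "k < n \<Longrightarrow> i < M \<Longrightarrow> k * M + i < W"
  using slot_less[of k n i] W_bounds(2) by linarith

lemma slot_div_mod: "i < M \<Longrightarrow> (k * M + i) div M = k" "i < M \<Longrightarrow> (k * M + i) mod M = i"
  by simp_all

lemma ids_bounds: "a \<in> ids \<Longrightarrow> lo a < n" "a \<in> ids \<Longrightarrow> hi a < n" "a \<in> ids \<Longrightarrow> lo a < hi a"
  by (auto simp: ids_def)

lemma id_eq: "a = (lo a * n + hi a) * b + a mod b"
  unfolding lo_def hi_def by simp

lemma finite_ids: "finite ids"
proof (rule finite_subset)
  show "ids \<subseteq> {..<n * n * b}"
  proof
    fix a assume a: "a \<in> ids"
    have "a div b div n < n" using ids_bounds(1)[OF a] by (simp add: lo_def)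
    then have "a div b < n * n" by (simp add: less_mult_imp_div_less div_less_iff_less_mult n)
    then show "a \<in> {..<n * n * b}" using b0 by (simp add: div_less_iff_less_mult)
  qed
qed simp

text \<open>An arc at \<open>u\<close> is determined by its other endpoint,
  \<open>lo a + hi a - u\<close>, and its copy number.\<close>

lemma card_incident_le:
  assumes "u < n"
  shows "card {a \<in> ids. lo a = u \<or> hi a = u} \<le> (n - 1) * b"
proof -
  let ?A = "{a \<in> ids. lo a = u \<or> hi a = u}"
  have "inj_on (\<lambda>a. (lo a + hi a - u, a mod b)) ?A"
  proof (rule inj_onI)
    fix x y assume x: "x \<in> ?A" and y: "y \<in> ?A"
      and eq: "(lo x + hi x - u, x mod b) = (lo y + hi y - u, y mod b)"
    have "lo x = lo y \<and> hi x = hi y"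
      using x y eq ids_bounds(3)[of x] ids_bounds(3)[of y] by auto
    then show "x = y" using eq id_eq[of x] id_eq[of y] by simp
  qed
  moreover have "(\<lambda>a. (lo a + hi a - u, a mod b)) ` ?A \<subseteq> ({..<n} - {u}) \<times> {..<b}"
    using b0 by (auto simp: ids_def)
  ultimately have "card ?A \<le> card (({..<n} - {u}) \<times> {..<b})" by (intro card_inj_on_le) auto
  also have "\<dots> = (n - 1) * b" using assms by (simp add: card_cartesian_product)
  finally show ?thesis .
qed

text \<open>The margin of two, due to \<open>b \<ge> 2\<close>, leaves room for a degree about to be
  incremented and for the extra entry of an arc being deleted.\<close>

lemma pred_n_b: "Suc ((n - 1) * b) < n * b"
  using n b by (cases n) auto

lemma tailsD:
  assumes "tails_ok s H" "a \<in> H"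
  shows "a \<in> ids" "s 1 a < n" "hd_of s a < n" "s 1 a \<noteq> hd_of s a"
    "lo a + hi a = s 1 a + hd_of s a" "hd_of s a = lo a \<or> hd_of s a = hi a"
proof -
  have a: "lo a < hi a" "hi a < n" "s 1 a = lo a \<or> s 1 a = hi a"
    using assms unfolding tails_ok_def ids_def by auto
  then show "a \<in> ids" "s 1 a < n" "hd_of s a < n" "s 1 a \<noteq> hd_of s a"
    "lo a + hi a = s 1 a + hd_of s a" "hd_of s a = lo a \<or> hd_of s a = hi a"
    unfolding ids_def hd_of_def by auto
qed

lemma out_degree_le:
  assumes "out_ok s H" "u < n" shows "s 3 u \<le> (n - 1) * b"
proof -
  have "s 3 u = card {a \<in> H. s 1 a = u}"
    using assms unfolding out_ok_def by (blast intro: bags_cnt)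
  also have "\<dots> \<le> card {a \<in> ids. lo a = u \<or> hi a = u}"
    using assms unfolding out_ok_def tails_ok_def
    by (intro card_mono) (auto intro: finite_subset[OF _ finite_ids])
  finally show ?thesis using card_incident_le[OF assms(2)] by linarith
qed

lemma out_degree_less: "out_ok s H \<Longrightarrow> u < n \<Longrightarrow> Suc (s 3 u) < n * b"
  using out_degree_le pred_n_b by (meson Suc_le_mono le_less_trans)

lemma in_bag_le:
  assumes "in_ok s A" "tails_ok s A" "k < n * M" shows "s 7 k \<le> (n - 1) * b"
proof -
  have k: "k div M < n" using assms(3) by (simp add: less_mult_imp_div_less)
  have "s 7 k = card {a \<in> A. s 5 a = k}"
    using assms unfolding in_ok_def by (blast intro: bags_cnt)
  also have "\<dots> \<le> card {a \<in> ids. lo a = k div M \<or> hi a = k div M}"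
    using assms(1) tailsD(1,6)[OF assms(2)] unfolding in_ok_def
    by (intro card_mono) (fastforce intro: finite_subset[OF _ finite_ids])+
  finally show ?thesis using card_incident_le[OF k] by linarith
qed

lemma in_bag_less: "in_ok s A \<Longrightarrow> tails_ok s A \<Longrightarrow> k < n * M \<Longrightarrow> Suc (s 7 k) < M"
  using in_bag_le[of s A k] pred_n_b M_bounds(3) by linarith

lemma hd_of_upd [simp]: "a \<noteq> 1 \<Longrightarrow> hd_of (s(a := f)) x = hd_of s x"
  by (simp add: hd_of_def)

lemma tails_ok_cong: "s' 1 = s 1 \<Longrightarrow> tails_ok s' H = tails_ok s H"
  by (simp add: tails_ok_def)

lemma out_ok_cong: "s' 1 = s 1 \<Longrightarrow> s' 2 = s 2 \<Longrightarrow> s' 3 = s 3 \<Longrightarrow> s' 4 = s 4 \<Longrightarrow> out_ok s' H = out_ok s H"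
  by (simp add: tails_ok_def out_ok_def)

lemma in_ok_cong: "s' 1 = s 1 \<Longrightarrow> s' 5 = s 5 \<Longrightarrow> s' 6 = s 6 \<Longrightarrow> s' 7 = s 7 \<Longrightarrow> s' 8 = s 8 \<Longrightarrow> in_ok s' H = in_ok s H"
  by (simp add: in_ok_def hd_of_def)

lemma ev_stride [simp]: "s 0 0 = n \<Longrightarrow> s 0 (Suc 0) = b \<Longrightarrow> ev stride_exp s = M"
  by (simp add: stride_exp_def M_def)

lemma fits_stride [simp]: "s 0 0 = n \<Longrightarrow> s 0 (Suc 0) = b \<Longrightarrow> fits W stride_exp s"
proof -
  assume p: "s 0 0 = n" "s 0 (Suc 0) = b"
  have "4 < W" "1 < W" "4 * (n * b) < W" using W_bounds by (simp_all add: M_def)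
  moreover from this have "n * b < W" by linarith
  ultimately show ?thesis using p by (simp add: stride_exp_def)
qed

lemma ev_slot [simp]: "s 0 0 = n \<Longrightarrow> s 0 (Suc 0) = b \<Longrightarrow> ev (slot_exp k i) s = ev k s * M + ev i s"
  by (simp add: slot_exp_def)

lemma fits_slot: "s 0 0 = n \<Longrightarrow> s 0 (Suc 0) = b \<Longrightarrow> ev k s < n * M \<Longrightarrow> ev i s < M \<Longrightarrow> fits W k s \<Longrightarrow> fits W i s
  \<Longrightarrow> fits W (slot_exp k i) s"
  using in_slot_less_W[of "ev k s" "ev i s"] by (auto simp: slot_exp_def)

lemma ev_head [simp]: "s 0 0 = n \<Longrightarrow> s 0 (Suc 0) = b \<Longrightarrow> ev (head_exp r) s = hd_of s (s r 0)"
  by (simp add: head_exp_def hd_of_def lo_def hi_def)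

lemma fits_head: "s 0 0 = n \<Longrightarrow> s 0 (Suc 0) = b \<Longrightarrow> s r 0 \<in> ids \<Longrightarrow> fits W (head_exp r) s"
proof -
  assume p: "s 0 0 = n" "s 0 (Suc 0) = b" and r: "s r 0 \<in> ids"
  have "lo (s r 0) + hi (s r 0) < W" "1 < W"
    using W_bounds M_bounds ids_bounds[OF r] by linarith+
  then show ?thesis using p by (simp add: head_exp_def lo_def hi_def)
qed

lemma ev_slack [simp]: "s 0 (Suc 0) = b \<Longrightarrow> ev (slack_exp e) s = slack_bound b (ev e s)"
  by (auto simp: slack_exp_def slack_bound_def)

lemma fits_slack: "s 0 (Suc 0) = b \<Longrightarrow> fits W e s \<Longrightarrow> slack_bound b (ev e s) < W \<Longrightarrow> fits W (slack_exp e) s"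
  using W_bounds by (auto simp: slack_exp_def slack_bound_def)

lemma less_M_cases: "k < n \<Longrightarrow> k < n * M"
  using M_bounds(2) by (cases M) auto

lemma timed_remove_in:
  assumes P: "params s" and I: "in_ok s A" and x: "s r 0 \<in> A" and r: "r \<ge> 10" "r \<noteq> 30" "r \<noteq> 31"
  shows "timed W (remove_in r) s (max_cost (remove_in r)) (\<lambda>s'. in_ok s' (A - {s r 0}) \<and>
     (\<forall>a. a \<notin> {6,7,8,30,31} \<longrightarrow> s' a = s a))"
proof (rule timed_run[OF W_bounds(4)])
  have p: "s 0 0 = n" "s 0 (Suc 0) = b" using P by (auto simp: params_def)
  define x where "x = s r 0"
  have B: "bags M (n * M) (s 6) (s 7) (s 8) (s 5) A" using I by (simp add: in_ok_def)
  note xB = bagsD[OF B x[folded x_def]]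
  have rr: "r \<noteq> 0" "r \<noteq> 1" "r \<noteq> 5" "r \<noteq> 6" "r \<noteq> 7" "r \<noteq> 8" using r(1) by auto
  have c: "s 7 (s 5 x) - Suc 0 < M" using xB by simp
  have "runs_ok W (remove_in r) s"
    unfolding remove_in_def remove_cmd_def
    using p xB c r rr W_bounds by (simp add: fits_slot x_def[symmetric])
  moreover have "run (remove_in r) s = s(30 := (s 30)(0 := s 5 x), 7 := (s 7)(s 5 x := s 7 (s 5 x) - 1),
     31 := (s 31)(0 := s 6 (s 5 x * M + (s 7 (s 5 x) - 1))),
     6 := (s 6)(s 5 x * M + s 8 x := s 6 (s 5 x * M + (s 7 (s 5 x) - 1))),
     8 := (s 8)(s 6 (s 5 x * M + (s 7 (s 5 x) - 1)) := s 8 x))"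
    unfolding remove_in_def remove_cmd_def
    using p r rr by (simp add: x_def[symmetric])
  moreover have "in_ok (run (remove_in r) s) (A - {x})"
    unfolding calculation(2) in_ok_def
    using bags_remove(1)[OF B x[folded x_def]] I by (simp add: in_ok_def)
  ultimately show "runs_ok W (remove_in r) s \<and> in_ok (run (remove_in r) s) (A - {s r 0}) \<and>
     (\<forall>a. a \<notin> {6,7,8,30,31} \<longrightarrow> run (remove_in r) s a = s a)"
    by (simp add: x_def)
qed

lemma timed_add_in:
  assumes P: "params s" and I: "in_ok s A" and T: "tails_ok s (insert (s r 0) A)" and x: "s r 0 \<notin> A"
    and r: "r \<ge> 10" "r \<noteq> 32" and e: "s e 0 < M"
  shows "timed W (add_in r e) s (max_cost (add_in r e)) (\<lambda>s'. in_ok s' (insert (s r 0) A) \<and>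
     s' 5 = (s 5)(s r 0 := hd_of s (s r 0) * M + s e 0) \<and>
     (\<forall>a. a \<notin> {5,6,7,8,32} \<longrightarrow> s' a = s a))"
proof (rule timed_run[OF W_bounds(4)])
  have p: "s 0 0 = n" "s 0 (Suc 0) = b" using P by (auto simp: params_def)
  define x k where "x = s r 0" and "k = hd_of s x * M + s e 0"
  have B: "bags M (n * M) (s 6) (s 7) (s 8) (s 5) A" using I by (simp add: in_ok_def)
  have rr: "r \<noteq> 0" "r \<noteq> 1" "r \<noteq> 5" "r \<noteq> 6" "r \<noteq> 7" "r \<noteq> 8" using r(1) by auto
  have h: "hd_of s x < n" and xi: "x \<in> ids" using tailsD[OF T] by (auto simp: x_def)
  have k: "k < n * M" unfolding k_def by (rule slot_less[OF h e])
  have TA: "tails_ok s A" using T by (auto simp: tails_ok_def)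
  have c: "Suc (s 7 k) < M" by (rule in_bag_less[OF I TA k])
  have "runs_ok W (add_in r e) s"
    unfolding add_in_def push_cmd_def
    using p c k r rr W_bounds h xi e less_M_cases[OF h]
    by (simp add: fits_slot fits_head x_def[symmetric] k_def[symmetric])
  moreover have "run (add_in r e) s = s(32 := (s 32)(0 := k), 6 := (s 6)(k * M + s 7 k := x),
     8 := (s 8)(x := s 7 k), 5 := (s 5)(x := k), 7 := (s 7)(k := Suc (s 7 k)))"
    unfolding add_in_def push_cmd_def
    using p r rr by (simp add: x_def[symmetric] k_def[symmetric])
  moreover have "in_ok (run (add_in r e) s) (insert x A)"
    unfolding calculation(2) in_ok_def
    using bags_push[OF B x[folded x_def] k c] I e by (auto simp: in_ok_def k_def fun_upd_twist)
  ultimately show "runs_ok W (add_in r e) s \<and> in_ok (run (add_in r e) s) (insert (s r 0) A) \<and>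
     run (add_in r e) s 5 = (s 5)(s r 0 := hd_of s (s r 0) * M + s e 0) \<and>
     (\<forall>a. a \<notin> {5,6,7,8,32} \<longrightarrow> run (add_in r e) s a = s a)"
    by (simp add: x_def k_def)
qed

lemma timed_refresh_arc:
  assumes P: "params s" and I: "in_ok s A" and T: "tails_ok s A" and x: "s r 0 \<in> A"
    and r: "r \<ge> 10" "r \<notin> {30,31,32}" and e: "s e 0 < M" "e \<ge> 10" "e \<notin> {30,31,32}"
  shows "timed W (refresh_arc r e) s (max_cost (refresh_arc r e)) (\<lambda>s'. in_ok s' A \<and>
     s' 5 = (s 5)(s r 0 := hd_of s (s r 0) * M + s e 0) \<and>
     (\<forall>a. a \<notin> {5,6,7,8,30,31,32} \<longrightarrow> s' a = s a))"
    (is "timed _ _ _ _ ?Q")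
proof -
  have "timed W (refresh_arc r e) s (max_cost (remove_in r) + max_cost (add_in r e)) ?Q"
    unfolding refresh_arc_def
  proof (rule timed_Seq[OF timed_remove_in[OF P I x]])
    fix s1 assume 1: "in_ok s1 (A - {s r 0}) \<and> (\<forall>a. a \<notin> {6,7,8,30,31} \<longrightarrow> s1 a = s a)"
    have eq: "s1 r = s r" "s1 e = s e" "s1 0 = s 0" "s1 1 = s 1" "s1 5 = s 5" using 1 r e by auto
    have ins: "insert (s r 0) (A - {s r 0}) = A" using x by auto
    show "timed W (add_in r e) s1 (max_cost (add_in r e)) ?Q"
    proof (rule timed_weaken[OF timed_add_in[of s1 "A - {s r 0}" r e]])
      show "params s1" using P eq by (simp add: params_def)
      show "tails_ok s1 (insert (s1 r 0) (A - {s r 0}))" unfolding eq ins using T eq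
        by (simp add: tails_ok_def)
    qed (use 1 eq r e ins in \<open>auto simp: hd_of_def eq(4)\<close>)
  qed (use r in auto)
  then show ?thesis by (simp add: refresh_arc_def)
qed

section \<open>Loops\<close>

lemma timed_step_loop:
  assumes P: "params s" and y: "s 20 0 = y" "y < n * b" and lg: "n \<le> 2 ^ lg"
  shows "timed W step_loop s (max_cost (setreg 21 (Const 1)) + Suc lg *
      (max_cost (setreg 21 (Add (reg 21) (reg 21))) +
       cost (Less (Mul (Mul (Const 8) b_exp) (reg 21)) (Add (reg 20) (Const 1))) + 1))
     (\<lambda>s'. s' 21 0 = refresh_step b y \<and> (\<forall>a. a \<noteq> 21 \<longrightarrow> s' a = s a))"
    (is "timed _ _ _ _ ?Q")
  unfolding step_loop_def
proof (rule timed_Seq)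
  have p: "s 0 0 = n" "s 0 (Suc 0) = b" using P by (auto simp: params_def)
  define Inv where "Inv = (\<lambda>s' m. \<exists>k. s' 21 0 = 2 ^ k \<and> (\<forall>j<k. 8 * b * 2 ^ j \<le> y) \<and> k \<le> lg \<and> m = lg - k \<and>
      (\<forall>a. a \<noteq> 21 \<longrightarrow> s' a = s a))"
  show "timed W (setreg 21 (Const 1)) s (max_cost (setreg 21 (Const 1))) (\<lambda>s'. Inv s' lg)"
    by (rule timed_run) (use W_bounds in \<open>auto simp: Inv_def intro!: exI[of _ 0]\<close>)
  fix s1 assume I: "Inv s1 lg"
  show "timed W (While (Less (Mul (Mul (Const 8) b_exp) (reg 21)) (Add (reg 20) (Const 1)))
          (setreg 21 (Add (reg 21) (reg 21)))) s1 (Suc lg *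
      (max_cost (setreg 21 (Add (reg 21) (reg 21))) +
       cost (Less (Mul (Mul (Const 8) b_exp) (reg 21)) (Add (reg 20) (Const 1))) + 1))
     ?Q"
  proof (rule timed_weaken[OF timed_While[where I = Inv, OF W_bounds(4) I] order_refl])
    fix s2 m assume "Inv s2 m"
    then obtain k where k: "s2 21 0 = 2 ^ k" "\<And>j. j < k \<Longrightarrow> 8 * b * 2 ^ j \<le> y" "k \<le> lg" "m = lg - k"
      "\<And>a. a \<noteq> 21 \<Longrightarrow> s2 a = s a" unfolding Inv_def by blast
    have e: "s2 0 = s 0" "s2 20 = s 20" using k(5) by auto
    \<comment> \<open>After the first round, the previous test succeeded at half the present value,
      which keeps the product below \<open>2 * M\<close>.\<close>
    have small: "8 * b * 2 ^ k < W"
    proof (cases k)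
      case 0
      then have "8 * b * 2 ^ k \<le> 2 * M" using M_bounds(5) by simp
      then show ?thesis using W_bounds(7) by linarith
    next
      case (Suc j)
      then have "8 * b * 2 ^ k \<le> 2 * y" using k(2)[of j] by simp
      then show ?thesis using y(2) M_bounds W_bounds(3) by linarith
    qed
    have "1 * (2::nat) ^ k \<le> b * 2 ^ k" using b by (intro mult_mono) auto
    then have s2k: "2 ^ k + 2 ^ k < W" using small by linarith
    have yW: "Suc y < W" using y(2) M_bounds W_bounds(3) by linarith
    have "1 * 1 \<le> b * 2 ^ k" using b by (intro mult_mono) auto
    then have b8: "8 * b < W" using M_bounds(5) W_bounds(7) by linarith
    have fit: "fits W (Less (Mul (Mul (Const 8) b_exp) (reg 21)) (Add (reg 20) (Const 1))) s2"
      using small yW W_bounds b8 by (simp add: k(1) e p y)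
    show "fits W (Less (Mul (Mul (Const 8) b_exp) (reg 21)) (Add (reg 20) (Const 1))) s2 \<and>
      (ev (Less (Mul (Mul (Const 8) b_exp) (reg 21)) (Add (reg 20) (Const 1))) s2 \<noteq> 0 \<longrightarrow>
       0 < m \<and> timed W (setreg 21 (Add (reg 21) (reg 21))) s2 (max_cost (setreg 21 (Add (reg 21) (reg 21))))
         (\<lambda>s'. \<exists>m'<m. Inv s' m'))"
    proof (intro conjI impI fit)
      assume "ev (Less (Mul (Mul (Const 8) b_exp) (reg 21)) (Add (reg 20) (Const 1))) s2 \<noteq> 0"
      then have le: "8 * b * 2 ^ k \<le> y" by (simp add: k(1) e p y split: if_splits)
      have "y < 8 * b * 2 ^ lg"
      proof -
        have "n * b \<le> 2 ^ lg * b" using lg by (intro mult_right_mono) auto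
        moreover have "8 * b * 2 ^ lg = 8 * (2 ^ lg * b)" by simp
        ultimately show ?thesis using y(2) by linarith
      qed
      with le have "8 * b * 2 ^ k < 8 * b * 2 ^ lg" by linarith
      then have klg: "k < lg" using b0 by (simp add: power_strict_increasing_iff)
      then show "0 < m" using k(4) by simp
      have "Inv (s2(21 := (s2 21)(0 := 2 ^ k + 2 ^ k))) (lg - Suc k)"
        unfolding Inv_def using k klg le
        by (intro exI[of _ "Suc k"]) (auto simp: less_Suc_eq)
      then show "timed W (setreg 21 (Add (reg 21) (reg 21))) s2 (max_cost (setreg 21 (Add (reg 21) (reg 21))))
         (\<lambda>s'. \<exists>m'<m. Inv s' m')"
        using s2k W_bounds klg k(1,4)
        by (intro timed_run) (auto intro!: exI[of _ "lg - Suc k"])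
    qed
  next
    fix s2 assume "ev (Less (Mul (Mul (Const 8) b_exp) (reg 21)) (Add (reg 20) (Const 1))) s2 = 0 \<and> (\<exists>m. Inv s2 m)"
    then obtain m where ev0: "ev (Less (Mul (Mul (Const 8) b_exp) (reg 21)) (Add (reg 20) (Const 1))) s2 = 0"
      and "Inv s2 m" by blast
    then obtain k where k: "s2 21 0 = 2 ^ k" "\<And>j. j < k \<Longrightarrow> 8 * b * 2 ^ j \<le> y"
      "\<And>a. a \<noteq> 21 \<Longrightarrow> s2 a = s a" unfolding Inv_def by blast
    have e: "s2 0 = s 0" "s2 20 = s 20" using k(3) by auto
    have "y < 8 * b * 2 ^ k" using ev0 by (simp add: k(1) e p y split: if_splits)
    then have "refresh_level b y = k" using k(2) by (rule refresh_level_eqI)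
    then show "s2 21 0 = refresh_step b y \<and> (\<forall>a. a \<noteq> 21 \<longrightarrow> s2 a = s a)"
      using k by (simp add: refresh_step_def)
  qed
qed

lemma mod_eq_within_step:
  fixes p q l :: nat
  assumes "p \<le> q" "q < p + l" "q mod l = p mod l" shows "q = p"
proof -
  have "l dvd q - p" using assms(1,3) by (simp add: mod_eq_dvd_iff_nat)
  moreover have "q - p < l" using assms(1,2) by linarith
  ultimately have "q - p = 0" using nat_dvd_not_less by blast
  with assms(1) show ?thesis by simp
qed

text \<open>One residue class is enough: only the arcs in it will receive the larger estimate, so
  only for them must the invariant be checked again. By \<open>less_refresh_step\<close> the class
  has at most \<open>8 * b\<close> positions, whatever the degree.\<close>

lemma timed_scan_loop:
  assumes P: "params s" and O: "out_ok s A" and x: "s 11 0 = x" "x < n" and d: "s 13 0 = s 3 x"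
    and y: "s 20 0 = Suc (s 3 x)" and l: "s 21 0 = refresh_step b (Suc (s 3 x))"
  defines "l \<equiv> refresh_step b (Suc (s 3 x))"
  shows "timed W scan_loop s (max_cost (setreg 23 (Const 0)) + (max_cost (setreg 22 (Mod (reg 20) (reg 21))) +
      Suc (8 * b) * (max_cost scan_body + cost scan_cond + 1)))
    (\<lambda>s'. (\<forall>a. a \<notin> {22,23,24,25} \<longrightarrow> s' a = s a) \<and>
       (s' 23 0 = 1 \<and> s' 22 0 < s 3 x \<and> s' 24 0 = s 2 (x * M + s' 22 0) \<and> s' 25 0 = hd_of s (s' 24 0) \<and>
          slack_bound b (s 3 (s' 25 0)) < Suc (s 3 x) \<or>
        s' 23 0 = 0 \<and> (\<forall>p < s 3 x. p mod l = Suc (s 3 x) mod l \<longrightarrow>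
          Suc (s 3 x) \<le> slack_bound b (s 3 (hd_of s (s 2 (x * M + p)))))))"
    (is "timed _ _ _ _ ?Q")
  unfolding scan_loop_def
proof (rule timed_Seq, rule_tac [2] timed_Seq)
  have p: "s 0 0 = n" "s 0 (Suc 0) = b" using P by (auto simp: params_def)
  define D where "D = s 3 x"
  have Dnb: "Suc D < n * b" using out_degree_less[OF O x(2)] by (simp add: D_def)
  have DM: "Suc D < M" using Dnb M_bounds by linarith
  have l0: "l > 0" by (simp add: l_def)
  have ly: "Suc D < 8 * b * l" unfolding l_def D_def by (rule less_refresh_step[OF b0])
  have lM: "l \<le> M"
  proof (cases "l = 1")
    case False
    then have "4 * b * l \<le> Suc D" unfolding l_def D_def by (rule refresh_step_le)
    moreover have "1 * l \<le> 4 * b * l" using b by (intro mult_mono) auto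
    ultimately show ?thesis using DM by linarith
  qed (use M_bounds in simp)
  have B: "bags M n (s 2) (s 3) (s 4) (s 1) A" and T: "tails_ok s A" using O by (auto simp: out_ok_def)
  have arc: "s 2 (x * M + q) \<in> A" if "q < D" for q
    using bags_slot(1)[OF B x(2)] that by (simp add: D_def)
  define Ok where "Ok = (\<lambda>q. Suc D \<le> slack_bound b (s 3 (hd_of s (s 2 (x * M + q)))))"
  define Inv where "Inv = (\<lambda>s' m. (\<forall>a. a \<notin> {22,23,24,25} \<longrightarrow> s' a = s a) \<and>
      (s' 23 0 = 1 \<and> s' 22 0 < D \<and> s' 24 0 = s 2 (x * M + s' 22 0) \<and> s' 25 0 = hd_of s (s' 24 0) \<and>
          slack_bound b (s 3 (s' 25 0)) < Suc D \<or>
       s' 23 0 = 0 \<and> s' 22 0 mod l = Suc D mod l \<and> D \<le> s' 22 0 + m * l \<and>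
          (\<forall>q < s' 22 0. q < D \<longrightarrow> q mod l = Suc D mod l \<longrightarrow> Ok q)))"
  show "timed W (setreg 23 (Const 0)) s (max_cost (setreg 23 (Const 0)))
      (\<lambda>s'. (\<forall>a. a \<noteq> 23 \<longrightarrow> s' a = s a) \<and> s' 23 0 = 0)"
    by (rule timed_run) (use W_bounds in auto)
  show "timed W (setreg 22 (Mod (reg 20) (reg 21))) s1 (max_cost (setreg 22 (Mod (reg 20) (reg 21)))) (\<lambda>s'. Inv s' (8 * b))"
    if s1: "(\<forall>a. a \<noteq> 23 \<longrightarrow> s1 a = s a) \<and> s1 23 0 = 0" for s1
  proof (rule timed_run)
    have e: "s 20 0 = Suc D" "s 21 0 = l" using y l by (auto simp: D_def l_def)
    \<comment> \<open>The starting position is the least in its class, so nothing is skipped before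
      the loop.\<close>
    have "q mod l \<noteq> Suc D mod l" if "q < Suc D mod l" for q
      using that l0 by (metis less_irrefl mod_less mod_less_divisor less_trans)
    then show "runs_ok W (setreg 22 (Mod (reg 20) (reg 21))) s1 \<and> Inv (run (setreg 22 (Mod (reg 20) (reg 21))) s1) (8 * b)"
      using s1 ly W_bounds unfolding Inv_def by (auto simp: e)
  qed (use W_bounds in simp)
  fix s1 assume I: "Inv s1 (8 * b)"
  show "timed W (While scan_cond scan_body) s1 (Suc (8 * b) * (max_cost scan_body + cost scan_cond + 1)) ?Q"
  proof (rule timed_weaken[OF timed_While[where I = Inv, OF W_bounds(4) I] order_refl])
    fix s2 m assume I2: "Inv s2 m"
    then have fr: "\<And>a. a \<notin> {22,23,24,25} \<Longrightarrow> s2 a = s a" unfolding Inv_def by blast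
    have e: "s2 0 = s 0" "s2 11 = s 11" "s2 13 = s 13" "s2 2 = s 2" "s2 3 = s 3" "s2 1 = s 1"
      "s2 20 = s 20" "s2 21 = s 21" using fr by auto
    have fit: "fits W scan_cond s2"
      using I2 W_bounds unfolding scan_cond_def Inv_def by (auto simp: e)
    show "fits W scan_cond s2 \<and> (ev scan_cond s2 \<noteq> 0 \<longrightarrow>
       0 < m \<and> timed W scan_body s2 (max_cost scan_body) (\<lambda>s'. \<exists>m'<m. Inv s' m'))"
    proof (intro conjI impI fit)
      assume "ev scan_cond s2 \<noteq> 0"
      then have pD: "s2 22 0 < D" and nf: "s2 23 0 = 0"
        by (auto simp: scan_cond_def e d D_def split: if_splits)
      define q where "q = s2 22 0"
      have I3: "q mod l = Suc D mod l" "D \<le> q + m * l" "\<And>q'. q' < q \<Longrightarrow> q' mod l = Suc D mod l \<Longrightarrow> Ok q'"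
        using I2 nf pD unfolding Inv_def q_def by auto
      have qD: "q < D" using pD by (simp add: q_def)
      show m: "0 < m" using I3(2) qD by (cases m) auto
      define a where "a = s 2 (x * M + q)"
      have aA: "a \<in> A" unfolding a_def by (rule arc[OF qD])
      have aid: "a \<in> ids" "hd_of s a < n" using tailsD[OF T aA] by auto
      have sl: "slack_bound b (s 3 (hd_of s a)) < W"
        using slack_bound_le[of b "s 3 (hd_of s a)"] out_degree_less[OF O aid(2)] M_bounds(4) W_bounds(3) by linarith
      have hdeq: "hd_of s2 = hd_of s" using e(6) by (simp add: hd_of_def fun_eq_iff)
      have ql: "q + l < W"
        using qD DM lM W_bounds(7) by linarith
      have ok: "runs_ok W scan_body s2"
        unfolding scan_body_def out_arc_exp_def
        using qD DM aid sl ql x W_bounds less_M_cases[OF x(2)]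
        by (simp add: fits_slot fits_head fits_slack e p q_def[symmetric] a_def[symmetric] hdeq l l_def[symmetric])
      have "Inv (run scan_body s2) (m - 1)"
      proof (cases "slack_bound b (s 3 (hd_of s a)) < Suc D")
        case True
        then have "run scan_body s2 = s2(24 := (s2 24)(0 := a), 25 := (s2 25)(0 := hd_of s a), 23 := (s2 23)(0 := 1))"
          unfolding scan_body_def out_arc_exp_def
          using x y by (simp add: e p q_def[symmetric] a_def[symmetric] hdeq D_def)
        then show ?thesis using True fr qD unfolding Inv_def by (simp add: q_def[symmetric] a_def[symmetric])
      next
        case False
        then have r: "run scan_body s2 = s2(24 := (s2 24)(0 := a), 25 := (s2 25)(0 := hd_of s a), 22 := (s2 22)(0 := q + l))"
          unfolding scan_body_def out_arc_exp_def
          using x y l by (simp add: e p q_def[symmetric] a_def[symmetric] hdeq D_def l_def)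
        have "Ok q'" if "q' < q + l" "q' mod l = Suc D mod l" for q'
        proof (cases "q' < q")
          case True then show ?thesis using I3(3) that by blast
        next
          case F: False
          then have "q' = q" using that I3(1) by (intro mod_eq_within_step[of q q' l]) auto
          then show ?thesis using False by (simp add: Ok_def a_def)
        qed
        moreover have "D \<le> q + l + (m - 1) * l" using I3(2) m by (cases m) auto
        ultimately show ?thesis using fr I3(1) nf unfolding Inv_def r by auto
      qed
      then show "timed W scan_body s2 (max_cost scan_body) (\<lambda>s'. \<exists>m'<m. Inv s' m')"
        using ok m W_bounds by (intro timed_run) (auto intro!: exI[of _ "m - 1"])
    qed
  next
    fix s2 assume "ev scan_cond s2 = 0 \<and> (\<exists>m. Inv s2 m)"
    then obtain m where ev0: "ev scan_cond s2 = 0" and I2: "Inv s2 m" by blast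
    then have fr: "\<And>a. a \<notin> {22,23,24,25} \<Longrightarrow> s2 a = s a" unfolding Inv_def by blast
    have e: "s2 13 = s 13" using fr by auto
    have "s2 23 0 = 0 \<Longrightarrow> D \<le> s2 22 0"
      using ev0 by (simp add: scan_cond_def e d D_def split: if_splits)
    then show "(\<forall>a. a \<notin> {22,23,24,25} \<longrightarrow> s2 a = s a) \<and>
       (s2 23 0 = 1 \<and> s2 22 0 < s 3 x \<and> s2 24 0 = s 2 (x * M + s2 22 0) \<and> s2 25 0 = hd_of s (s2 24 0) \<and>
          slack_bound b (s 3 (s2 25 0)) < Suc (s 3 x) \<or>
        s2 23 0 = 0 \<and> (\<forall>p < s 3 x. p mod l = Suc (s 3 x) mod l \<longrightarrow>
          Suc (s 3 x) \<le> slack_bound b (s 3 (hd_of s (s 2 (x * M + p))))))"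
      using I2 unfolding Inv_def D_def Ok_def by force
  qed
qed

text \<open>The limit \<open>D\<close> is kept apart from the out-degree. In an insertion the new
  arc already occupies position \<open>D\<close> with its proper estimate, and the loop stops before
  it; in a deletion the two agree. Tails, heads and positions do not change, so the outcome can be
  described by the initial memory.\<close>

lemma timed_refresh_loop:
  assumes P: "params s" and O: "out_ok s A" and I: "in_ok s A" and x: "s 11 0 = x" "x < n"
    and D: "s 13 0 = D" "D \<le> s 3 x" and l: "s 21 0 = l" "l > 0" "l \<le> M" "D \<le> 8 * b * l" and e: "s 26 0 < M"
  shows "timed W refresh_loop s (max_cost (setreg 22 (Mod (reg 20) (reg 21))) +
      Suc (8 * b) * (max_cost refresh_body + cost (Less (reg 22) (reg 13)) + 1))
    (\<lambda>s'. (\<forall>a. a \<notin> {5,6,7,8,22,24,30,31,32} \<longrightarrow> s' a = s a) \<and> in_ok s' A \<and>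
      (\<forall>a\<in>A. s' 5 a = (if s 1 a = x \<and> s 4 a < D \<and> s 4 a mod l = s 20 0 mod l
         then hd_of s a * M + s 26 0 else s 5 a)))"
    (is "timed _ _ _ _ ?Q")
  unfolding refresh_loop_def
proof (rule timed_Seq)
  have p: "s 0 0 = n" "s 0 (Suc 0) = b" using P by (auto simp: params_def)
  define y where "y = s 20 0"
  have DM: "D < M" using D out_degree_less[OF O x(2)] M_bounds by linarith
  have B: "bags M n (s 2) (s 3) (s 4) (s 1) A" and T: "tails_ok s A" using O by (auto simp: out_ok_def)
  have arc: "s 2 (x * M + q) \<in> A" "s 1 (s 2 (x * M + q)) = x" "s 4 (s 2 (x * M + q)) = q" if "q < D" for q
    using bags_slot[OF B x(2)] that D by auto
  define Inv where "Inv = (\<lambda>s' m. (\<forall>a. a \<notin> {5,6,7,8,22,24,30,31,32} \<longrightarrow> s' a = s a) \<and> in_ok s' A \<and>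
      s' 22 0 mod l = y mod l \<and> D \<le> s' 22 0 + m * l \<and>
      (\<forall>a\<in>A. s' 5 a = (if s 1 a = x \<and> s 4 a < s' 22 0 \<and> s 4 a < D \<and> s 4 a mod l = y mod l
         then hd_of s a * M + s 26 0 else s 5 a)))"
  show "timed W (setreg 22 (Mod (reg 20) (reg 21))) s (max_cost (setreg 22 (Mod (reg 20) (reg 21)))) (\<lambda>s'. Inv s' (8 * b))"
  proof (rule timed_run)
    define s1 where "s1 = s(22 := (s 22)(0 := y mod l))"
    have "q mod l \<noteq> y mod l" if "q < y mod l" for q
      using that l by (metis less_irrefl mod_less mod_less_divisor less_trans)
    moreover have "in_ok s1 A" using I by (simp add: s1_def in_ok_def)
    ultimately have "Inv s1 (8 * b)" using l unfolding Inv_def by (auto simp: s1_def)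
    then show "runs_ok W (setreg 22 (Mod (reg 20) (reg 21))) s \<and> Inv (run (setreg 22 (Mod (reg 20) (reg 21))) s) (8 * b)"
      using W_bounds by (simp add: s1_def y_def l)
  qed (use W_bounds in simp)
  fix s1 assume I1: "Inv s1 (8 * b)"
  show "timed W (While (Less (reg 22) (reg 13)) refresh_body) s1
      (Suc (8 * b) * (max_cost refresh_body + cost (Less (reg 22) (reg 13)) + 1))
    ?Q"
  proof (rule timed_weaken[OF timed_While[where I = Inv, OF W_bounds(4) I1] order_refl])
    fix s2 m assume I2: "Inv s2 m"
    then have fr: "\<And>a. a \<notin> {5,6,7,8,22,24,30,31,32} \<Longrightarrow> s2 a = s a" and in2: "in_ok s2 A" unfolding Inv_def by blast+
    have e2: "s2 0 = s 0" "s2 11 = s 11" "s2 13 = s 13" "s2 2 = s 2" "s2 3 = s 3" "s2 1 = s 1" "s2 4 = s 4"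
      "s2 20 = s 20" "s2 21 = s 21" "s2 26 = s 26" using fr by auto
    show "fits W (Less (reg 22) (reg 13)) s2 \<and> (ev (Less (reg 22) (reg 13)) s2 \<noteq> 0 \<longrightarrow>
       0 < m \<and> timed W refresh_body s2 (max_cost refresh_body) (\<lambda>s'. \<exists>m'<m. Inv s' m'))"
    proof (intro conjI impI)
      show "fits W (Less (reg 22) (reg 13)) s2" using W_bounds by simp
      assume "ev (Less (reg 22) (reg 13)) s2 \<noteq> 0"
      then have pD: "s2 22 0 < D" by (auto simp: e2 D split: if_splits)
      define q where "q = s2 22 0"
      have qD: "q < D" using pD by (simp add: q_def)
      have I3: "q mod l = y mod l" "D \<le> q + m * l"
        "\<And>a. a \<in> A \<Longrightarrow> s2 5 a = (if s 1 a = x \<and> s 4 a < q \<and> s 4 a < D \<and> s 4 a mod l = y mod l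
         then hd_of s a * M + s 26 0 else s 5 a)"
        using I2 unfolding Inv_def q_def by auto
      show m: "0 < m" using I3(2) qD by (cases m) auto
      define c where "c = s 2 (x * M + q)"
      note cA = arc[OF qD, folded c_def]
      define s3 where "s3 = s2(24 := (s2 24)(0 := c))"
      have hdeq: "hd_of s3 = hd_of s" using e2(6) by (simp add: hd_of_def fun_eq_iff s3_def)
      have "timed W refresh_body s2 (max_cost (setreg 24 out_arc_exp) +
          (max_cost (refresh_arc 24 26) + max_cost (setreg 22 (Add (reg 22) (reg 21))))) (\<lambda>s'. Inv s' (m - 1))"
        unfolding refresh_body_def
      proof (rule timed_Seq, rule_tac [2] timed_Seq)
        show "timed W (setreg 24 out_arc_exp) s2 (max_cost (setreg 24 out_arc_exp)) (\<lambda>s'. s' = s3)"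
          using qD DM x W_bounds less_M_cases[OF x(2)] unfolding out_arc_exp_def s3_def
          by (intro timed_run) (simp_all add: fits_slot e2 p q_def[symmetric] c_def[symmetric])
        fix s4 assume "s4 = s3"
        moreover have "timed W (refresh_arc 24 26) s3 (max_cost (refresh_arc 24 26)) (\<lambda>s'. in_ok s' A \<and>
            s' 5 = (s3 5)(s3 24 0 := hd_of s3 (s3 24 0) * M + s3 26 0) \<and>
            (\<forall>a. a \<notin> {5,6,7,8,30,31,32} \<longrightarrow> s' a = s3 a))"
        proof (rule timed_refresh_arc)
          show "params s3" using P by (simp add: params_def s3_def e2)
          show "in_ok s3 A" using in2 by (simp add: s3_def in_ok_def)
          show "tails_ok s3 A" using T e2(6) by (simp add: s3_def tails_ok_def)
          show "s3 24 0 \<in> A" using cA by (simp add: s3_def)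
          show "s3 26 0 < M" using e by (simp add: s3_def e2)
        qed auto
        ultimately show "timed W (refresh_arc 24 26) s4 (max_cost (refresh_arc 24 26)) (\<lambda>s'. in_ok s' A \<and>
            s' 5 = (s2 5)(c := hd_of s c * M + s 26 0) \<and> (\<forall>a. a \<notin> {5,6,7,8,24,30,31,32} \<longrightarrow> s' a = s2 a))"
          by (auto elim!: timed_weaken simp: s3_def e2 hdeq[unfolded s3_def])
      next
        fix s4 assume s4: "in_ok s4 A \<and>
            s4 5 = (s2 5)(c := hd_of s c * M + s 26 0) \<and> (\<forall>a. a \<notin> {5,6,7,8,24,30,31,32} \<longrightarrow> s4 a = s2 a)"
        have e4: "s4 22 = s2 22" "s4 21 = s 21" using s4 e2 by auto
        define s5 where "s5 = s4(22 := (s4 22)(0 := q + l))"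
        have r: "run (setreg 22 (Add (reg 22) (reg 21))) s4 = s5"
          by (simp add: s5_def e4 q_def l)
        have "q + l < W" using qD DM l W_bounds(7) by linarith
        then have ok: "runs_ok W (setreg 22 (Add (reg 22) (reg 21))) s4"
          using W_bounds by (simp add: e4 q_def l)
        have "Inv s5 (m - 1)"
          unfolding Inv_def
        proof (intro conjI ballI)
          show "\<forall>a. a \<notin> {5, 6, 7, 8, 22, 24, 30, 31, 32} \<longrightarrow> s5 a = s a" using s4 fr by (simp add: s5_def)
          show "in_ok s5 A" using s4 in_ok_cong[of s5 s4 A] by (simp add: s5_def)
          show "s5 22 0 mod l = y mod l" using I3(1) by (simp add: s5_def)
          show "D \<le> s5 22 0 + (m - 1) * l" using I3(2) m by (cases m) (auto simp: s5_def)
          fix a assume a: "a \<in> A"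
          show "s5 5 a = (if s 1 a = x \<and> s 4 a < s5 22 0 \<and> s 4 a < D \<and> s 4 a mod l = y mod l
             then hd_of s a * M + s 26 0 else s 5 a)"
          proof (cases "a = c")
            case True
            then show ?thesis using s4 cA qD I3(1) l by (simp add: s5_def)
          next
            case False
            \<comment> \<open>By \<open>mod_eq_within_step\<close>, advancing from \<open>q\<close>
              to \<open>q + l\<close> brings no arc but \<open>c\<close> into the refreshed
              range.\<close>
            have "\<not> (s 1 a = x \<and> q \<le> s 4 a \<and> s 4 a < q + l \<and> s 4 a mod l = y mod l)"
            proof
              assume h: "s 1 a = x \<and> q \<le> s 4 a \<and> s 4 a < q + l \<and> s 4 a mod l = y mod l"
              then have "s 4 a = q" using I3(1) by (intro mod_eq_within_step[of q _ l]) auto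
              then have "a = c" using bags_inj[OF B a cA(1)] h cA by simp
              with False show False by simp
            qed
            then show ?thesis using s4 False I3(3)[OF a] by (auto simp: s5_def)
          qed
        qed
        then show "timed W (setreg 22 (Add (reg 22) (reg 21))) s4 (max_cost (setreg 22 (Add (reg 22) (reg 21)))) (\<lambda>s'. Inv s' (m - 1))"
          using ok r W_bounds by (intro timed_run) auto
      qed
      then show "timed W refresh_body s2 (max_cost refresh_body) (\<lambda>s'. \<exists>m'<m. Inv s' m')"
        by (rule timed_weaken) (use m in \<open>auto simp: refresh_body_def intro!: exI[of _ "m - 1"]\<close>)
    qed
  next
    fix s2 assume "ev (Less (reg 22) (reg 13)) s2 = 0 \<and> (\<exists>m. Inv s2 m)"
    then obtain m where ev0: "ev (Less (reg 22) (reg 13)) s2 = 0" and I2: "Inv s2 m" by blast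
    have "s2 13 = s 13" using I2 unfolding Inv_def by auto
    then have "D \<le> s2 22 0" using ev0 by (simp add: D split: if_splits)
    then show "(\<forall>a. a \<notin> {5,6,7,8,22,24,30,31,32} \<longrightarrow> s2 a = s a) \<and> in_ok s2 A \<and>
      (\<forall>a\<in>A. s2 5 a = (if s 1 a = x \<and> s 4 a < D \<and> s 4 a mod l = s 20 0 mod l
         then hd_of s a * M + s 26 0 else s 5 a))"
      using I2 unfolding Inv_def y_def by auto
  qed
qed

end

section \<open>One step of an insertion\<close>

definition step_time :: "nat \<Rightarrow> nat" where
  "step_time lg = max_cost (setreg 21 (Const 1)) + Suc lg *
      (max_cost (setreg 21 (Add (reg 21) (reg 21))) +
       cost (Less (Mul (Mul (Const 8) b_exp) (reg 21)) (Add (reg 20) (Const 1))) + 1)"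

definition scan_time :: "nat \<Rightarrow> nat" where
  "scan_time b = max_cost (setreg 23 (Const 0)) + (max_cost (setreg 22 (Mod (reg 20) (reg 21))) +
      Suc (8 * b) * (max_cost scan_body + cost scan_cond + 1))"

definition refresh_time :: "nat \<Rightarrow> nat" where
  "refresh_time b = max_cost (setreg 22 (Mod (reg 20) (reg 21))) +
      Suc (8 * b) * (max_cost refresh_body + cost (Less (reg 22) (reg 13)) + 1)"

definition prepare_scan :: cmd where
  "prepare_scan = Seq (setreg 13 (Read 3 (reg 11))) (setreg 20 (Add (reg 13) (Const 1)))"

definition hand_over :: cmd where
  "hand_over = Seq (setreg 10 (reg 24)) (setreg 11 (reg 25))"

definition passed_time :: "nat" where
  "passed_time = max_cost (remove_in 24) + (max_cost replace_out + (max_cost (add_in 10 13) + max_cost hand_over))"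

definition settled_time :: "nat \<Rightarrow> nat" where
  "settled_time b = max_cost (push_cmd 2 3 4 1 10 11) + (max_cost (add_in 10 20) +
     (max_cost (setreg 26 (reg 20)) + (refresh_time b + max_cost (setreg 12 (Const 0)))))"

definition insert_step_time :: "nat \<Rightarrow> nat \<Rightarrow> nat" where
  "insert_step_time b lg = max_cost prepare_scan + (step_time lg + (scan_time b +
     (cost (reg 23) + 1 + (passed_time + settled_time b))))"

context ram begin

definition core :: "memory \<Rightarrow> nat set \<Rightarrow> bool" where
  "core s A \<longleftrightarrow> params s \<and> out_ok s A \<and> in_ok s A \<and> good s A"

text \<open>The arc in register 10 waits to be inserted with the vertex in register 11 as its tail.\<close>
definition pending :: "memory \<Rightarrow> nat set \<Rightarrow> bool" where
  "pending s A \<longleftrightarrow> s 10 0 \<in> ids - A \<and> (s 11 0 = lo (s 10 0) \<or> s 11 0 = hi (s 10 0)) \<and>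
     Suc (s 3 (s 11 0)) \<le> slack_bound b (s 3 (lo (s 10 0) + hi (s 10 0) - s 11 0))"

lemma good_cong: "s' 1 = s 1 \<Longrightarrow> s' 3 = s 3 \<Longrightarrow> s' 4 = s 4 \<Longrightarrow> s' 5 = s 5 \<Longrightarrow> good s' A = good s A"
  by (simp add: good_def est_def hd_of_def)

lemma in_ok_cong_tails:
  "(\<And>a. a \<in> A \<Longrightarrow> s' 1 a = s 1 a) \<Longrightarrow> s' 5 = s 5 \<Longrightarrow> s' 6 = s 6 \<Longrightarrow> s' 7 = s 7 \<Longrightarrow> s' 8 = s 8 \<Longrightarrow> in_ok s' A = in_ok s A"
  by (simp add: in_ok_def hd_of_def)

lemma refresh_step_le_M: "y < M \<Longrightarrow> refresh_step b y \<le> M"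
proof (cases "refresh_step b y = 1")
  case False
  assume "y < M"
  have "4 * b * refresh_step b y \<le> y" by (rule refresh_step_le[OF False])
  moreover have "1 * refresh_step b y \<le> 4 * b * refresh_step b y" using b by (intro mult_mono) auto
  ultimately show ?thesis using \<open>y < M\<close> by linarith
qed (use M_bounds in simp)

text \<open>Degrees stay the same, so only \<open>c\<close> needs an estimate, and the exact
  \<open>D\<close> will do. The evicted arc, once reversed, points to a vertex of degree
  \<open>D\<close> and leaves one of smaller degree, hence is again legal to insert. The potential
  falls by \<open>violation_gap\<close>.\<close>

lemma timed_pass_on:
  assumes P: "params s" and O: "out_ok s A" and I: "in_ok s A" and G: "good s A" and Q: "pending s A"
    and D: "D = s 3 (s 11 0)" "s 13 0 = D"
    and p: "s 22 0 < D" and a: "s 24 0 = s 2 (s 11 0 * M + s 22 0)" and z: "s 25 0 = hd_of s (s 24 0)"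
    and viol: "slack_bound b (s 3 (s 25 0)) < Suc D"
  shows "timed W (Seq (remove_in 24) (Seq replace_out (Seq (add_in 10 13) hand_over))) s passed_time
     (\<lambda>s'. \<exists>A'. core s' A' \<and> pending s' A' \<and> insert (s' 10 0) A' = insert (s 10 0) A \<and> s' 3 = s 3 \<and>
        chain_potential b (s' 3 (s' 11 0)) < chain_potential b D \<and> (\<forall>r\<in>{0,12,14,15}. s' r = s r))"
    (is "timed _ _ _ _ ?Q")
  unfolding passed_time_def
proof (rule timed_Seq, rule_tac [2] timed_Seq, rule_tac [3] timed_Seq)
  have pr: "s 0 0 = n" "s 0 (Suc 0) = b" using P by (auto simp: params_def)
  define c x q v where "c = s 10 0" and "x = s 11 0" and "q = s 22 0" and "v = s 24 0"
  have T: "tails_ok s A" and B: "bags M n (s 2) (s 3) (s 4) (s 1) A" using O by (auto simp: out_ok_def)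
  have c: "c \<in> ids" "c \<notin> A" "x = lo c \<or> x = hi c" "Suc (s 3 x) \<le> slack_bound b (s 3 (lo c + hi c - x))"
    using Q by (auto simp: pending_def c_def x_def)
  have xn: "x < n" using c ids_bounds[of c] by auto
  have qD: "q < s 3 x" using p D by (simp add: q_def x_def)
  have v: "v \<in> A" "s 1 v = x" "s 4 v = q"
    using bags_slot[OF B xn qD] a by (auto simp: v_def x_def q_def)
  have DM: "D < M" using out_degree_less[OF O xn] M_bounds D by (simp add: x_def)
  have qM: "q < M" using qD DM D by (simp add: x_def)
  have vc: "v \<noteq> c" using v c by auto
  define A' where "A' = insert c (A - {v})"
  show "timed W (remove_in 24) s (max_cost (remove_in 24)) (\<lambda>s'. in_ok s' (A - {v}) \<and>
     (\<forall>a. a \<notin> {6,7,8,30,31} \<longrightarrow> s' a = s a))"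
    unfolding v_def by (rule timed_remove_in[OF P I]) (use v in \<open>auto simp: v_def\<close>)
  show "timed W replace_out s1 (max_cost replace_out) (\<lambda>s'. in_ok s' (A - {v}) \<and> out_ok s' A' \<and>
      s' 1 = (s 1)(c := x) \<and> s' 4 = (s 4)(c := q) \<and>
     (\<forall>a. a \<notin> {1,2,4,6,7,8,30,31} \<longrightarrow> s' a = s a))"
    if s1: "in_ok s1 (A - {v}) \<and> (\<forall>a. a \<notin> {6,7,8,30,31} \<longrightarrow> s1 a = s a)" for s1
  proof (rule timed_run)
    have e: "s1 0 = s 0" "s1 1 = s 1" "s1 2 = s 2" "s1 3 = s 3" "s1 4 = s 4" "s1 10 = s 10" "s1 11 = s 11" "s1 22 = s 22"
      using s1 by auto
    define s2 where "s2 = s1(2 := (s 2)(x * M + q := c), 4 := (s 4)(c := q), 1 := (s 1)(c := x))"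
    have r: "run replace_out s1 = s2"
      unfolding replace_out_def s2_def using e(2)
      by (simp add: e pr c_def[symmetric] x_def[symmetric] q_def[symmetric])
    have ok: "runs_ok W replace_out s1"
      unfolding replace_out_def using W_bounds less_M_cases[OF xn] qM
      by (simp add: e pr fits_slot c_def[symmetric] x_def[symmetric] q_def[symmetric])
    have "in_ok s2 (A - {v}) = in_ok s1 (A - {v})"
      using c(2) e(2) by (intro in_ok_cong_tails) (auto simp: s2_def)
    moreover have "bags M n (s2 2) (s2 3) (s2 4) (s2 1) A'"
      using bags_replace[OF B v(1) c(2), of x q] v e(4) by (simp add: s2_def A'_def)
    moreover have "tails_ok s2 A'"
      using T c unfolding tails_ok_def A'_def s2_def by auto
    moreover have "s2 1 = (s 1)(c := x)" "s2 4 = (s 4)(c := q)" by (simp_all add: s2_def)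
    moreover have "\<forall>a. a \<notin> {1,2,4,6,7,8,30,31} \<longrightarrow> s2 a = s a" using s1 by (simp add: s2_def)
    ultimately show "runs_ok W replace_out s1 \<and> in_ok (run replace_out s1) (A - {v}) \<and> out_ok (run replace_out s1) A' \<and>
      run replace_out s1 1 = (s 1)(c := x) \<and> run replace_out s1 4 = (s 4)(c := q) \<and>
     (\<forall>a. a \<notin> {1,2,4,6,7,8,30,31} \<longrightarrow> run replace_out s1 a = s a)"
      using ok s1 unfolding r out_ok_def by blast
  qed (use W_bounds in simp)
  show "timed W (add_in 10 13) s2 (max_cost (add_in 10 13)) (\<lambda>s'. in_ok s' A' \<and> out_ok s' A' \<and>
      s' 1 = (s 1)(c := x) \<and> s' 4 = (s 4)(c := q) \<and> s' 5 = (s 5)(c := (lo c + hi c - x) * M + D) \<and>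
     (\<forall>a. a \<notin> {1,2,4,5,6,7,8,30,31,32} \<longrightarrow> s' a = s a))"
    if s2: "in_ok s2 (A - {v}) \<and> out_ok s2 A' \<and> s2 1 = (s 1)(c := x) \<and> s2 4 = (s 4)(c := q) \<and>
     (\<forall>a. a \<notin> {1,2,4,6,7,8,30,31} \<longrightarrow> s2 a = s a)" for s2
  proof -
    have e: "s2 0 = s 0" "s2 10 = s 10" "s2 13 = s 13" "s2 5 = s 5" using s2 by auto
    have "timed W (add_in 10 13) s2 (max_cost (add_in 10 13)) (\<lambda>s'. in_ok s' (insert (s2 10 0) (A - {v})) \<and>
        s' 5 = (s2 5)(s2 10 0 := hd_of s2 (s2 10 0) * M + s2 13 0) \<and> (\<forall>a. a \<notin> {5,6,7,8,32} \<longrightarrow> s' a = s2 a))"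
    proof (rule timed_add_in)
      show "params s2" using P by (simp add: params_def e)
      show "tails_ok s2 (insert (s2 10 0) (A - {v}))"
        using s2 by (simp add: out_ok_def A'_def e c_def)
    qed (use s2 c DM D in \<open>auto simp: e c_def\<close>)
    then show ?thesis
    proof (rule timed_weaken)
      fix s3 assume s3: "in_ok s3 (insert (s2 10 0) (A - {v})) \<and>
        s3 5 = (s2 5)(s2 10 0 := hd_of s2 (s2 10 0) * M + s2 13 0) \<and> (\<forall>a. a \<notin> {5,6,7,8,32} \<longrightarrow> s3 a = s2 a)"
      have "out_ok s3 A' = out_ok s2 A'" using s3 by (intro out_ok_cong) auto
      moreover have "hd_of s2 c = lo c + hi c - x" using s2 by (simp add: hd_of_def)
      moreover have "s3 1 = s2 1" "s3 4 = s2 4" using s3 by auto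
      ultimately show "in_ok s3 A' \<and> out_ok s3 A' \<and>
        s3 1 = (s 1)(c := x) \<and> s3 4 = (s 4)(c := q) \<and> s3 5 = (s 5)(c := (lo c + hi c - x) * M + D) \<and>
        (\<forall>a. a \<notin> {1,2,4,5,6,7,8,30,31,32} \<longrightarrow> s3 a = s a)"
        using s3 s2 D(2) by (simp add: e A'_def c_def[symmetric])
    qed simp
  qed
  fix s3 assume s3: "in_ok s3 A' \<and> out_ok s3 A' \<and>
      s3 1 = (s 1)(c := x) \<and> s3 4 = (s 4)(c := q) \<and> s3 5 = (s 5)(c := (lo c + hi c - x) * M + D) \<and>
     (\<forall>a. a \<notin> {1,2,4,5,6,7,8,30,31,32} \<longrightarrow> s3 a = s a)"
  define s4 where "s4 = s3(10 := (s3 10)(0 := v), 11 := (s3 11)(0 := hd_of s v))"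
  have e: "s3 24 = s 24" "s3 25 = s 25" "s3 3 = s 3" "s3 0 = s 0" using s3 by auto
  have r: "run hand_over s3 = s4" by (simp add: hand_over_def s4_def e v_def z)
  have ok: "runs_ok W hand_over s3" using W_bounds by (simp add: hand_over_def)
  have s4eq: "s4 1 = (s 1)(c := x)" "s4 3 = s 3" "s4 4 = (s 4)(c := q)"
    "s4 5 = (s 5)(c := (lo c + hi c - x) * M + D)" "s4 10 0 = v" "s4 11 0 = hd_of s v"
    using s3 by (simp_all add: s4_def e)
  have "out_ok s4 A' = out_ok s3 A'" by (rule out_ok_cong) (simp_all add: s4_def)
  moreover have "in_ok s4 A' = in_ok s3 A'" by (rule in_ok_cong) (simp_all add: s4_def)
  moreover have "params s4" using P by (simp add: params_def s4_def e)
  moreover have "good s4 A'"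
    unfolding good_def
  proof
    fix y assume y: "y \<in> A'"
    show "est s4 y \<le> slack_bound b (s4 3 (hd_of s4 y)) \<and> fresh b (s4 4 y) (est s4 y) (s4 3 (s4 1 y))"
    proof (cases "y = c")
      case True
      have "est s4 y = D" using DM by (simp add: est_def s4eq True)
      then show ?thesis using c(4) D s4eq(1) by (simp add: True s4eq hd_of_def x_def)
    next
      case False
      then have "y \<in> A" using y by (auto simp: A'_def)
      then show ?thesis using G False s4eq(1) unfolding good_def by (simp add: s4eq est_def hd_of_def)
    qed
  qed
  moreover have gap: "Suc (s 3 (hd_of s v)) \<le> D" "s 3 (hd_of s v) \<le> 4 * b * (D - s 3 (hd_of s v))"
    using violation_gap[OF b0 viol] z by (auto simp: v_def)
  moreover have "chain_potential b (s 3 (hd_of s v)) < chain_potential b D"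
    by (rule chain_potential_less[OF b0 gap])
  moreover have "pending s4 A'"
  proof -
    note tv = tailsD[OF T v(1)]
    have "lo v + hi v - hd_of s v = x" using tv v by simp
    moreover have "D \<le> slack_bound b D" using slack_bound_gt[of D b] by simp
    ultimately show ?thesis
      unfolding pending_def s4eq using tv gap D vc by (auto simp: A'_def x_def)
  qed
  moreover have "insert v A' = insert c A" using v by (auto simp: A'_def)
  moreover have "\<forall>r\<in>{0,12,14,15}. s4 r = s r" using s3 by (simp add: s4_def)
  ultimately have "core s4 A' \<and> pending s4 A' \<and> insert (s4 10 0) A' = insert (s 10 0) A \<and> s4 3 = s 3 \<and>
      chain_potential b (s4 3 (s4 11 0)) < chain_potential b D \<and> (\<forall>r\<in>{0,12,14,15}. s4 r = s r)"
    using s3 by (simp add: core_def s4eq c_def)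
  then show "timed W hand_over s3 (max_cost hand_over) ?Q"
    using W_bounds ok r by (intro timed_run) auto
qed

text \<open>Arcs leaving the tail that are due at \<open>Suc D\<close> take this estimate, which
  \<open>clear\<close> permits; the others keep a legal estimate and remain fresh by
  \<open>fresh_incr\<close>. Arcs into that vertex only gain slack from its larger degree.\<close>

lemma timed_settle:
  assumes P: "params s" and O: "out_ok s A" and I: "in_ok s A" and G: "good s A" and Q: "pending s A"
    and D: "D = s 3 (s 11 0)" "s 13 0 = D" "s 20 0 = Suc D" and l: "s 21 0 = refresh_step b (Suc D)"
    and clear: "\<And>p. p < D \<Longrightarrow> p mod refresh_step b (Suc D) = Suc D mod refresh_step b (Suc D) \<Longrightarrow>
          Suc D \<le> slack_bound b (s 3 (hd_of s (s 2 (s 11 0 * M + p))))"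
  shows "timed W (Seq (push_cmd 2 3 4 1 10 11) (Seq (add_in 10 20) (Seq (setreg 26 (reg 20))
            (Seq refresh_loop (setreg 12 (Const 0)))))) s (settled_time b)
     (\<lambda>s'. core s' (insert (s 10 0) A) \<and> s' 12 0 = 0 \<and> s' 3 = (s 3)(s 11 0 := Suc (s 3 (s 11 0))) \<and>
        (\<forall>r\<in>{0,14,15}. s' r = s r))"
    (is "timed _ _ _ _ ?Q")
  unfolding settled_time_def
proof (rule timed_Seq, rule_tac [2] timed_Seq, rule_tac [3] timed_Seq, rule_tac [4] timed_Seq)
  have pr: "s 0 0 = n" "s 0 (Suc 0) = b" using P by (auto simp: params_def)
  define c x where "c = s 10 0" and "x = s 11 0"
  have T: "tails_ok s A" and B: "bags M n (s 2) (s 3) (s 4) (s 1) A" using O by (auto simp: out_ok_def)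
  have c: "c \<in> ids" "c \<notin> A" "x = lo c \<or> x = hi c" "Suc (s 3 x) \<le> slack_bound b (s 3 (lo c + hi c - x))"
    using Q by (auto simp: pending_def c_def x_def)
  have xn: "x < n" using c ids_bounds[of c] by auto
  have Dx: "D = s 3 x" using D by (simp add: x_def)
  have DM: "Suc D < M" using out_degree_less[OF O xn] M_bounds by (simp add: Dx)
  define L where "L = refresh_step b (Suc D)"
  define A' where "A' = insert c A"
  define z where "z = lo c + hi c - x"
  have zx: "z \<noteq> x" using c(3) ids_bounds(3)[OF c(1)] by (auto simp: z_def)
  define sp where "sp = s(2 := (s 2)(x * M + D := c), 4 := (s 4)(c := D), 1 := (s 1)(c := x), 3 := (s 3)(x := Suc D))"
  have Tp: "tails_ok sp A'" using T c unfolding tails_ok_def A'_def sp_def by auto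
  have Op: "out_ok sp A'"
    using bags_push[OF B c(2) xn] DM Tp unfolding out_ok_def by (simp add: sp_def A'_def Dx[symmetric])
  show "timed W (push_cmd 2 3 4 1 10 11) s (max_cost (push_cmd 2 3 4 1 10 11)) (\<lambda>s'. s' = sp)"
  proof (rule timed_run)
    have "run (push_cmd 2 3 4 1 10 11) s = sp"
      by (simp add: push_cmd_def sp_def pr c_def[symmetric] x_def[symmetric] Dx[symmetric])
    moreover have "runs_ok W (push_cmd 2 3 4 1 10 11) s"
      unfolding push_cmd_def using W_bounds less_M_cases[OF xn] DM
      by (simp add: pr fits_slot c_def[symmetric] x_def[symmetric] Dx[symmetric])
    ultimately show "runs_ok W (push_cmd 2 3 4 1 10 11) s \<and> run (push_cmd 2 3 4 1 10 11) s = sp" by simp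
  qed (use W_bounds in simp)
  show "timed W (add_in 10 20) s1 (max_cost (add_in 10 20)) (\<lambda>s'. in_ok s' A' \<and> s' 5 = (s 5)(c := z * M + Suc D) \<and>
     (\<forall>a. a \<notin> {5,6,7,8,32} \<longrightarrow> s' a = sp a))" if "s1 = sp" for s1
    unfolding that
  proof (rule timed_weaken[OF timed_add_in[of sp A]])
    have "in_ok sp A = in_ok s A" by (rule in_ok_cong_tails) (use c(2) in \<open>auto simp: sp_def\<close>)
    with I show "in_ok sp A" by simp
    show "tails_ok sp (insert (sp 10 0) A)" using Tp by (simp add: sp_def A'_def c_def)
  qed (use P c DM D in \<open>auto simp: sp_def params_def c_def A'_def hd_of_def z_def x_def\<close>)
  show "timed W (setreg 26 (reg 20)) s1 (max_cost (setreg 26 (reg 20)))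
     (\<lambda>s'. in_ok s' A' \<and> s' 5 = (s 5)(c := z * M + Suc D) \<and> s' 26 0 = Suc D \<and>
     (\<forall>a. a \<notin> {5,6,7,8,32,26} \<longrightarrow> s' a = sp a))"
    if s1: "in_ok s1 A' \<and> s1 5 = (s 5)(c := z * M + Suc D) \<and> (\<forall>a. a \<notin> {5,6,7,8,32} \<longrightarrow> s1 a = sp a)" for s1
  proof (rule timed_run)
    have "in_ok (s1(26 := (s1 26)(0 := Suc D))) A' = in_ok s1 A'" by (rule in_ok_cong) auto
    then show "runs_ok W (setreg 26 (reg 20)) s1 \<and> in_ok (run (setreg 26 (reg 20)) s1) A' \<and>
      run (setreg 26 (reg 20)) s1 5 = (s 5)(c := z * M + Suc D) \<and> run (setreg 26 (reg 20)) s1 26 0 = Suc D \<and>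
     (\<forall>a. a \<notin> {5,6,7,8,32,26} \<longrightarrow> run (setreg 26 (reg 20)) s1 a = sp a)"
      using s1 W_bounds D by (simp add: sp_def)
  qed (use W_bounds in simp)
  show "timed W refresh_loop s1 (refresh_time b)
     (\<lambda>s'. (\<forall>a. a \<notin> {5,6,7,8,22,24,26,30,31,32} \<longrightarrow> s' a = sp a) \<and> in_ok s' A' \<and>
        (\<forall>a\<in>A'. s' 5 a = (if sp 1 a = x \<and> sp 4 a < D \<and> sp 4 a mod L = Suc D mod L
         then hd_of sp a * M + Suc D else ((s 5)(c := z * M + Suc D)) a)))"
    if s1: "in_ok s1 A' \<and> s1 5 = (s 5)(c := z * M + Suc D) \<and> s1 26 0 = Suc D \<and>
     (\<forall>a. a \<notin> {5,6,7,8,32,26} \<longrightarrow> s1 a = sp a)" for s1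
  proof -
    have e: "s1 0 = sp 0" "s1 1 = sp 1" "s1 2 = sp 2" "s1 3 = sp 3" "s1 4 = sp 4" "s1 11 = sp 11" "s1 13 = sp 13"
      "s1 20 = sp 20" "s1 21 = sp 21" using s1 by auto
    have hde: "hd_of s1 = hd_of sp" using e(2) by (simp add: hd_of_def fun_eq_iff)
    show ?thesis
      unfolding refresh_time_def
    proof (rule timed_weaken[OF timed_refresh_loop[of s1 A' x D L]])
      show "params s1" using P e(1) by (simp add: params_def sp_def)
      show "out_ok s1 A'" using Op out_ok_cong[of s1 sp A'] e by simp
      show "in_ok s1 A'" using s1 by simp
      show "L \<le> M" unfolding L_def by (rule refresh_step_le_M[OF DM])
      show "D \<le> 8 * b * L" using less_refresh_step[OF b0, of "Suc D"] by (simp add: L_def)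
      fix s2 assume s2: "(\<forall>a. a \<notin> {5,6,7,8,22,24,30,31,32} \<longrightarrow> s2 a = s1 a) \<and> in_ok s2 A' \<and>
        (\<forall>a\<in>A'. s2 5 a = (if s1 1 a = x \<and> s1 4 a < D \<and> s1 4 a mod L = s1 20 0 mod L
         then hd_of s1 a * M + s1 26 0 else s1 5 a))"
      have s20: "sp 20 0 = Suc D" using D by (simp add: sp_def)
      show "(\<forall>a. a \<notin> {5,6,7,8,22,24,26,30,31,32} \<longrightarrow> s2 a = sp a) \<and> in_ok s2 A' \<and>
        (\<forall>a\<in>A'. s2 5 a = (if sp 1 a = x \<and> sp 4 a < D \<and> sp 4 a mod L = Suc D mod L
         then hd_of sp a * M + Suc D else ((s 5)(c := z * M + Suc D)) a))"
      proof (intro conjI)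
        show "\<forall>a\<in>A'. s2 5 a = (if sp 1 a = x \<and> sp 4 a < D \<and> sp 4 a mod L = Suc D mod L
         then hd_of sp a * M + Suc D else ((s 5)(c := z * M + Suc D)) a)"
        proof
          fix a assume "a \<in> A'"
          with s2 have "s2 5 a = (if s1 1 a = x \<and> s1 4 a < D \<and> s1 4 a mod L = s1 20 0 mod L
             then hd_of s1 a * M + s1 26 0 else s1 5 a)" by blast
          moreover have "s1 26 0 = Suc D" "s1 5 = (s 5)(c := z * M + Suc D)" using s1 by blast+
          ultimately show "s2 5 a = (if sp 1 a = x \<and> sp 4 a < D \<and> sp 4 a mod L = Suc D mod L
             then hd_of sp a * M + Suc D else ((s 5)(c := z * M + Suc D)) a)"
            by (simp only: e s20 hde)
        qed
        show "\<forall>a. a \<notin> {5,6,7,8,22,24,26,30,31,32} \<longrightarrow> s2 a = sp a" using s2 s1 by simp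
        show "in_ok s2 A'" using s2 by blast
      qed
    next
      show "s1 11 0 = x" "s1 13 0 = D" "s1 21 0 = L" "D \<le> s1 3 x"
        unfolding e using D(2) l by (simp_all add: sp_def x_def L_def)
      show "s1 26 0 < M" using s1 DM by simp
    qed (use xn in \<open>simp_all add: L_def\<close>)
  qed
  fix s1 assume s1: "(\<forall>a. a \<notin> {5,6,7,8,22,24,26,30,31,32} \<longrightarrow> s1 a = sp a) \<and> in_ok s1 A' \<and>
        (\<forall>a\<in>A'. s1 5 a = (if sp 1 a = x \<and> sp 4 a < D \<and> sp 4 a mod L = Suc D mod L
         then hd_of sp a * M + Suc D else ((s 5)(c := z * M + Suc D)) a))"
  define s2 where "s2 = s1(12 := (s1 12)(0 := 0))"
  have e: "s2 0 = s 0" "s2 1 = (s 1)(c := x)" "s2 2 = sp 2" "s2 3 = (s 3)(x := Suc D)" "s2 4 = (s 4)(c := D)"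
    using s1 by (simp_all add: s2_def sp_def)
  have e5: "s2 5 a = (if a \<noteq> c \<and> s 1 a = x \<and> s 4 a < D \<and> s 4 a mod L = Suc D mod L
         then hd_of s a * M + Suc D else ((s 5)(c := z * M + Suc D)) a)" if "a \<in> A'" for a
    using s1 that by (simp add: s2_def sp_def hd_of_def)
  have "out_ok s2 A' = out_ok sp A'" using s1 by (intro out_ok_cong) (auto simp: s2_def)
  moreover have "in_ok s2 A' = in_ok s1 A'" by (rule in_ok_cong) (auto simp: s2_def)
  moreover have "params s2" using P by (simp add: params_def e)
  moreover have "good s2 A'"
    unfolding good_def
  proof
    fix a assume a: "a \<in> A'"
    show "est s2 a \<le> slack_bound b (s2 3 (hd_of s2 a)) \<and> fresh b (s2 4 a) (est s2 a) (s2 3 (s2 1 a))"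
    proof (cases "a = c")
      case True
      have "est s2 a = Suc D" using DM e5[OF a] by (simp add: est_def True)
      moreover have "hd_of s2 a = z" using e(2) by (simp add: hd_of_def True z_def)
      ultimately show ?thesis using c(4) zx e(2) by (simp add: True e Dx z_def)
    next
      case False
      then have aA: "a \<in> A" using a by (simp add: A'_def)
      have h: "hd_of s2 a = hd_of s a" using False e(2) by (simp add: hd_of_def)
      have G': "est s a \<le> slack_bound b (s 3 (hd_of s a))" "fresh b (s 4 a) (est s a) (s 3 (s 1 a))"
        using G aA by (auto simp: good_def)
      have "s 3 (hd_of s a) \<le> s2 3 (hd_of s a)" by (simp add: e Dx)
      then have up: "slack_bound b (s 3 (hd_of s a)) \<le> slack_bound b (s2 3 (hd_of s a))"
        by (rule slack_bound_mono)
      show ?thesis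
      proof (cases "s 1 a = x")
        case True
        then have pos: "s 4 a < D" and arr: "s 2 (x * M + s 4 a) = a" using bagsD[OF B aA] by (auto simp: Dx)
        show ?thesis
        proof (cases "s 4 a mod L = Suc D mod L")
          case res: True
          then have "est s2 a = Suc D" using e5[OF a] False True pos DM by (simp add: est_def)
          moreover have "Suc D \<le> slack_bound b (s 3 (hd_of s a))"
            using clear[OF pos res[unfolded L_def]] arr by (simp add: x_def)
          ultimately show ?thesis using up True False e(2) by (simp add: h e)
        next
          case nres: False
          then have es: "est s2 a = est s a" using e5[OF a] False by (simp add: est_def)
          have "fresh b (s 4 a) (est s a) (Suc D)"
            using G'(2) True nres by (intro fresh_incr) (auto simp: Dx L_def)
          then show ?thesis using es G'(1) up True False e(2) by (simp add: h e)
        qed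
      next
        case nx: False
        then have "est s2 a = est s a" using e5[OF a] False by (simp add: est_def)
        then show ?thesis using G' up nx False e(2) by (simp add: h e)
      qed
    qed
  qed
  ultimately have "core s2 A'" using s1 Op by (simp add: core_def)
  then have "core s2 (insert (s 10 0) A) \<and> s2 12 0 = 0 \<and> s2 3 = (s 3)(s 11 0 := Suc (s 3 (s 11 0))) \<and>
      (\<forall>r\<in>{0,14,15}. s2 r = s r)"
    using s1 D(1) by (simp add: A'_def c_def e(4) x_def) (simp add: s2_def sp_def)
  then show "timed W (setreg 12 (Const 0)) s1 (max_cost (setreg 12 (Const 0))) ?Q"
    using W_bounds by (intro timed_run) (simp_all add: s2_def)
qed

lemma timed_insert_step:
  assumes C: "core s A" and Q: "pending s A" and lg: "n \<le> 2 ^ lg"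
  shows "timed W insert_step s (insert_step_time b lg) (\<lambda>s'.
     (\<exists>A'. core s' A' \<and> pending s' A' \<and> insert (s' 10 0) A' = insert (s 10 0) A \<and> s' 3 = s 3 \<and>
        chain_potential b (s' 3 (s' 11 0)) < chain_potential b (s 3 (s 11 0)) \<and> (\<forall>r\<in>{0,12,14,15}. s' r = s r)) \<or>
     core s' (insert (s 10 0) A) \<and> s' 12 0 = 0 \<and> s' 3 = (s 3)(s 11 0 := Suc (s 3 (s 11 0))) \<and>
        (\<forall>r\<in>{0,14,15}. s' r = s r))"
    (is "timed _ _ _ _ ?Q")
  unfolding insert_step_def insert_step_time_def prepare_scan_def[symmetric] hand_over_def[symmetric]
proof (rule timed_Seq, rule_tac [2] timed_Seq, rule_tac [3] timed_Seq)
  have P: "params s" and O: "out_ok s A" and I: "in_ok s A" and G: "good s A" using C by (auto simp: core_def)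
  define x D where "x = s 11 0" and "D = s 3 x"
  have xn: "x < n" using Q ids_bounds[of "s 10 0"] by (auto simp: pending_def x_def)
  have DM: "Suc D < n * b" using out_degree_less[OF O xn] by (simp add: D_def)
  have DW: "Suc D < W" using DM M_bounds W_bounds by linarith
  define s1 where "s1 = s(13 := (s 13)(0 := D), 20 := (s 20)(0 := Suc D))"
  show "timed W prepare_scan s (max_cost prepare_scan) (\<lambda>s'. s' = s1)"
    using W_bounds DW unfolding prepare_scan_def
    by (intro timed_run) (simp_all add: s1_def x_def[symmetric] D_def[symmetric])
  show "timed W step_loop s' (step_time lg) (\<lambda>s'. s' 21 0 = refresh_step b (Suc D) \<and> (\<forall>a. a \<noteq> 21 \<longrightarrow> s' a = s1 a))"
    if "s' = s1" for s'
    unfolding step_time_def that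
    by (rule timed_step_loop[OF _ _ _ lg]) (use P DM in \<open>auto simp: s1_def params_def\<close>)
  define scanned where "scanned = (\<lambda>s'. (\<forall>a. a \<notin> {13,20,21,22,23,24,25} \<longrightarrow> s' a = s a) \<and>
     s' 13 0 = D \<and> s' 20 0 = Suc D \<and> s' 21 0 = refresh_step b (Suc D) \<and>
     (s' 23 0 = 1 \<and> s' 22 0 < D \<and> s' 24 0 = s 2 (x * M + s' 22 0) \<and> s' 25 0 = hd_of s (s' 24 0) \<and>
          slack_bound b (s 3 (s' 25 0)) < Suc D \<or>
        s' 23 0 = 0 \<and> (\<forall>p < D. p mod refresh_step b (Suc D) = Suc D mod refresh_step b (Suc D) \<longrightarrow>
          Suc D \<le> slack_bound b (s 3 (hd_of s (s 2 (x * M + p)))))))"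
  show "timed W scan_loop s2 (scan_time b) scanned"
    if s2: "s2 21 0 = refresh_step b (Suc D) \<and> (\<forall>a. a \<noteq> 21 \<longrightarrow> s2 a = s1 a)" for s2
  proof -
    have e: "s2 0 = s 0" "s2 1 = s 1" "s2 2 = s 2" "s2 3 = s 3" "s2 4 = s 4" "s2 11 = s 11" using s2 by (auto simp: s1_def)
    have e': "s2 13 0 = D" "s2 20 0 = Suc D" "s2 21 0 = refresh_step b (Suc D)" using s2 by (auto simp: s1_def)
    have hde: "hd_of s2 = hd_of s" using e(2) by (simp add: hd_of_def fun_eq_iff)
    have 1: "params s2" using P by (simp add: params_def e)
    have 2: "out_ok s2 A" using O out_ok_cong[of s2 s A] e by simp
    show ?thesis
      unfolding scan_time_def
    proof (rule timed_weaken[OF timed_scan_loop[OF 1 2 _ xn]])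
      fix s3 assume "(\<forall>a. a \<notin> {22,23,24,25} \<longrightarrow> s3 a = s2 a) \<and>
       (s3 23 0 = 1 \<and> s3 22 0 < s2 3 x \<and> s3 24 0 = s2 2 (x * M + s3 22 0) \<and> s3 25 0 = hd_of s2 (s3 24 0) \<and>
          slack_bound b (s2 3 (s3 25 0)) < Suc (s2 3 x) \<or>
        s3 23 0 = 0 \<and> (\<forall>p < s2 3 x. p mod refresh_step b (Suc (s2 3 x)) = Suc (s2 3 x) mod refresh_step b (Suc (s2 3 x)) \<longrightarrow>
          Suc (s2 3 x) \<le> slack_bound b (s2 3 (hd_of s2 (s2 2 (x * M + p))))))"
      then show "scanned s3" using e' s2 unfolding scanned_def e hde D_def[symmetric] by (simp add: s1_def)
    qed (use e' in \<open>simp_all add: e x_def D_def\<close>)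
  qed
  fix s3 assume s3: "scanned s3"
  have e: "s3 0 = s 0" "s3 1 = s 1" "s3 2 = s 2" "s3 3 = s 3" "s3 4 = s 4" "s3 5 = s 5" "s3 6 = s 6" "s3 7 = s 7" "s3 8 = s 8"
    "s3 10 = s 10" "s3 11 = s 11" "s3 12 = s 12" "s3 14 = s 14" "s3 15 = s 15" using s3 by (auto simp: scanned_def)
  have e': "s3 13 0 = D" "s3 20 0 = Suc D" "s3 21 0 = refresh_step b (Suc D)" using s3 by (auto simp: scanned_def)
  have hde: "hd_of s3 = hd_of s" using e(2) by (simp add: hd_of_def fun_eq_iff)
  have P3: "params s3" using P by (simp add: params_def e)
  have O3: "out_ok s3 A" using O out_ok_cong[of s3 s A] e by simp
  have I3: "in_ok s3 A" using I in_ok_cong[of s3 s A] e by simp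
  have G3: "good s3 A" using G good_cong[of s3 s A] e by simp
  have Q3: "pending s3 A" using Q unfolding pending_def e by simp
  have D3: "D = s3 3 (s3 11 0)" by (simp add: e D_def x_def)
  show "timed W (If (reg 23) (Seq (remove_in 24) (Seq replace_out (Seq (add_in 10 13) hand_over)))
          (Seq (push_cmd 2 3 4 1 10 11) (Seq (add_in 10 20) (Seq (setreg 26 (reg 20))
            (Seq refresh_loop (setreg 12 (Const 0))))))) s3 (cost (reg 23) + 1 + (passed_time + settled_time b))
     ?Q"
  proof (rule timed_If[OF W_bounds(4)])
    assume "ev (reg 23) s3 \<noteq> 0"
    then have v: "s3 22 0 < D" "s3 24 0 = s3 2 (s3 11 0 * M + s3 22 0)" "s3 25 0 = hd_of s3 (s3 24 0)"
      "slack_bound b (s3 3 (s3 25 0)) < Suc D" using s3 unfolding scanned_def e hde by (auto simp: x_def)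
    show "timed W (Seq (remove_in 24) (Seq replace_out (Seq (add_in 10 13) hand_over))) s3 (passed_time + settled_time b) ?Q"
      by (rule timed_weaken[OF timed_pass_on[OF P3 O3 I3 G3 Q3 D3 e'(1) v]])
        (auto simp: e D_def x_def)
  next
    assume "ev (reg 23) s3 = 0"
    then have v: "Suc D \<le> slack_bound b (s3 3 (hd_of s3 (s3 2 (s3 11 0 * M + p))))"
      if "p < D" "p mod refresh_step b (Suc D) = Suc D mod refresh_step b (Suc D)" for p
      using s3 that unfolding scanned_def e hde by (auto simp: x_def)
    show "timed W (Seq (push_cmd 2 3 4 1 10 11) (Seq (add_in 10 20) (Seq (setreg 26 (reg 20))
            (Seq refresh_loop (setreg 12 (Const 0)))))) s3 (passed_time + settled_time b)
     ?Q"
      by (rule timed_weaken[OF timed_settle[OF P3 O3 I3 G3 Q3 D3 e' v]]) (auto simp: e)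
  qed (use W_bounds in simp)
qed

end

section \<open>One step of a deletion\<close>

definition pick_violator :: cmd where
  "pick_violator = Seq (setreg 24 (Read 6 (slot_exp (reg 28) (Const 0)))) (setreg 25 (Read 1 (reg 24)))"

definition prepare_move :: cmd where
  "prepare_move = Seq (setreg 22 (Read 4 (reg 10))) (setreg 26 (reg 13))"

definition moved_time :: nat where
  "moved_time = max_cost pick_violator + (max_cost (remove_in 24) + (max_cost swap_out + max_cost (add_in 24 20)))"

definition dropped_time :: "nat \<Rightarrow> nat \<Rightarrow> nat" where
  "dropped_time b lg = max_cost (remove_cmd 2 3 4 1 10) + (max_cost prepare_move +
     (cost (Less (reg 22) (reg 13)) + 1 + (max_cost (setreg 24 out_arc_exp) + max_cost (refresh_arc 24 26)) +
     (step_time lg + (refresh_time b + max_cost (setreg 12 (Const 0))))))"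

definition delete_step_time :: "nat \<Rightarrow> nat \<Rightarrow> nat" where
  "delete_step_time b lg = max_cost find_violation + (cost (Read 7 (reg 28)) + 1 + (moved_time + dropped_time b lg))"

context ram begin

text \<open>The arc \<open>c\<close>, which is to be deleted, still occupies a slot among the arcs leaving \<open>s 1 c\<close>;
  that vertex need not be an endpoint of \<open>c\<close>.\<close>
definition hole :: "memory \<Rightarrow> nat set \<Rightarrow> nat \<Rightarrow> bool" where
  "hole s A c \<longleftrightarrow> s 10 0 = c \<and> c \<in> ids - A \<and> params s \<and> tails_ok s A \<and>
     bags M n (s 2) (s 3) (s 4) (s 1) (insert c A) \<and> in_ok s A \<and> good s A"

text \<open>Since the hole may sit at a vertex that is not an endpoint of \<open>c\<close>, it can
  add one to the number of incident arcs.\<close>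

lemma hole_degree_less:
  assumes "hole s A c" "u < n" shows "s 3 u < n * b"
proof -
  have fin: "finite A" using assms finite_subset[OF _ finite_ids] unfolding hole_def tails_ok_def by blast
  have "s 3 u = card {a \<in> insert c A. s 1 a = u}"
    using assms unfolding hole_def by (blast intro: bags_cnt)
  also have "\<dots> \<le> card (insert c {a \<in> A. s 1 a = u})"
    using fin by (intro card_mono) auto
  also have "\<dots> \<le> Suc (card {a \<in> A. s 1 a = u})" by (rule card_insert_le_m1) auto
  also have "card {a \<in> A. s 1 a = u} \<le> card {a \<in> ids. lo a = u \<or> hi a = u}"
    using assms(1) finite_ids unfolding hole_def tails_ok_def by (intro card_mono) auto
  finally show ?thesis using card_incident_le[OF assms(2)] pred_n_b by linarith
qed

lemma slack_pred_less_M: "d < n * b \<Longrightarrow> slack_bound b (d - 1) + 2 < M"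
  using slack_bound_le[of b "d - 1"] M_bounds(4) by linarith

lemma timed_find_violation:
  assumes H: "hole s A c"
  defines "u \<equiv> s 1 c" defines "d \<equiv> s 3 u" defines "t \<equiv> slack_bound b (d - 1)"
  shows "timed W find_violation s (max_cost find_violation)
     (\<lambda>s'. (\<forall>a. a \<notin> {11,13,20,28} \<longrightarrow> s' a = s a) \<and> s' 11 0 = u \<and> s' 20 0 = d \<and> s' 13 0 = d - 1 \<and>
        (\<exists>e. (e = t + 1 \<or> e = t + 2) \<and> s' 28 0 = u * M + e) \<and>
        (s 7 (s' 28 0) = 0 \<longrightarrow> s 7 (u * M + (t + 1)) = 0 \<and> s 7 (u * M + (t + 2)) = 0))"
proof (rule timed_run)
  have pr: "s 0 0 = n" "s 0 (Suc 0) = b" "s 10 0 = c" using H by (auto simp: params_def hole_def)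
  have u: "u < n" using H bagsD(1)[of M n "s 2" "s 3" "s 4" "s 1" "insert c A" c] by (auto simp: hole_def u_def)
  have d: "d < n * b" unfolding d_def by (rule hole_degree_less[OF H u])
  have tM: "t + 2 < M" unfolding t_def by (rule slack_pred_less_M[OF d])
  have uc: "s (Suc 0) c = u" "slack_bound b (d - Suc 0) = t" by (simp_all add: u_def t_def)
  have "u * M + (t + 2) < W" "u * M + (t + 1) < W" "t < W" "t + 1 < W"
    using out_slot_less_W[OF u tM] W_bounds tM by linarith+
  note bd = this
  have ok: "runs_ok W find_violation s"
    unfolding find_violation_def using W_bounds bd tM less_M_cases[OF u]
    by (auto simp: pr uc d_def[symmetric] fits_slack fits_slot)
  have "s(11 := (s 11)(0 := u), 20 := (s 20)(0 := d), 13 := (s 13)(0 := d - 1), 28 := (s 28)(0 := u * M + (t + 1))) = run find_violation s \<and> s 7 (u * M + (t + 1)) \<noteq> 0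
   \<or> s(11 := (s 11)(0 := u), 20 := (s 20)(0 := d), 13 := (s 13)(0 := d - 1), 28 := (s 28)(0 := u * M + (t + 2))) = run find_violation s \<and> s 7 (u * M + (t + 1)) = 0"
    unfolding find_violation_def
    by (simp add: pr uc d_def[symmetric])
  then show "runs_ok W find_violation s \<and> (\<forall>a. a \<notin> {11,13,20,28} \<longrightarrow> run find_violation s a = s a) \<and>
      run find_violation s 11 0 = u \<and> run find_violation s 20 0 = d \<and> run find_violation s 13 0 = d - 1 \<and>
        (\<exists>e. (e = t + 1 \<or> e = t + 2) \<and> run find_violation s 28 0 = u * M + e) \<and>
        (s 7 (run find_violation s 28 0) = 0 \<longrightarrow> s 7 (u * M + (t + 1)) = 0 \<and> s 7 (u * M + (t + 2)) = 0)"
  proof (elim disjE conjE)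
    assume "s(11 := (s 11)(0 := u), 20 := (s 20)(0 := d), 13 := (s 13)(0 := d - 1), 28 := (s 28)(0 := u * M + (t + 1))) = run find_violation s"
      "s 7 (u * M + (t + 1)) \<noteq> 0"
    then show ?thesis using ok by (auto simp flip: \<open>_ = run find_violation s\<close>)
  next
    assume "s(11 := (s 11)(0 := u), 20 := (s 20)(0 := d), 13 := (s 13)(0 := d - 1), 28 := (s 28)(0 := u * M + (t + 2))) = run find_violation s"
      "s 7 (u * M + (t + 1)) = 0"
    then show ?thesis using ok by (auto simp flip: \<open>_ = run find_violation s\<close>)
  qed
qed (use W_bounds in simp)

text \<open>The violating arc \<open>v\<close>, reversed, fills the slot of the hole, and the hole
  goes to the old tail of \<open>v\<close>. That tail is known to have larger degree only through an
  estimate, so progress rests on \<open>stale_violation_gap\<close>. The new estimate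
  \<open>d\<close> of \<open>v\<close> is exact, and legal because the new head has degree above
  \<open>d\<close>.\<close>

lemma timed_move_hole:
  assumes H: "hole s A c" and u: "s 11 0 = s 1 c" and d: "s 20 0 = d" "d = s 3 (s 1 c)"
    and key: "s 28 0 = s 1 c * M + e" and e: "slack_bound b (d - 1) < e" "e < M" and ne: "s 7 (s 28 0) \<noteq> 0"
  shows "timed W (Seq pick_violator (Seq (remove_in 24) (Seq swap_out (add_in 24 20)))) s moved_time
     (\<lambda>s'. hole s' A c \<and> s' 3 = s 3 \<and> chain_potential b (s 3 (s 1 c)) < chain_potential b (s' 3 (s' 1 c)) \<and>
        (\<forall>r\<in>{0,12,14,15}. s' r = s r))"
    (is "timed _ _ _ _ ?Q")
  unfolding moved_time_def
proof (rule timed_Seq, rule_tac [2] timed_Seq, rule_tac [3] timed_Seq)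
  have pr: "s 0 0 = n" "s 0 (Suc 0) = b" "s 10 0 = c" using H by (auto simp: params_def hole_def)
  have T: "tails_ok s A" and B: "bags M n (s 2) (s 3) (s 4) (s 1) (insert c A)" and I: "in_ok s A" and G: "good s A"
    and c: "c \<in> ids" "c \<notin> A" using H by (auto simp: hole_def)
  have BI: "bags M (n * M) (s 6) (s 7) (s 8) (s 5) A" using I by (simp add: in_ok_def)
  define x where "x = s 1 c"
  have cB: "x < n" "s 4 c < d" "s 2 (x * M + s 4 c) = c" "d < M" "s 4 c < M"
    using bagsD[OF B, of c] d by (auto simp: x_def)
  have kn: "s 28 0 < n * M" using slot_less[OF cB(1) e(2)] key by (simp add: x_def)
  define v where "v = s 6 (s 28 0 * M)"
  have v: "v \<in> A" "s 5 v = s 28 0" using bags_slot[OF BI kn, of 0] ne by (auto simp: v_def)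
  have hv: "hd_of s v = x" and ev: "est s v = e"
    using I v e(2) key by (auto simp: in_ok_def est_def x_def)
  define w where "w = s 1 v"
  have vc: "v \<noteq> c" using v c by auto
  have vB: "w < n" "s 4 v < s 3 w" "s 2 (w * M + s 4 v) = v" "s 3 w < M" "s 4 v < M"
    using bagsD[OF B, of v] v by (auto simp: w_def)
  have d0: "d > 0" using cB by simp
  have "e \<le> slack_bound b d" "fresh b (s 4 v) e (s 3 w)"
    using G v(1) hv ev d by (auto simp: good_def w_def x_def)
  note gap = stale_violation_gap[OF b d0 e(1) this]
  have hw: "lo v + hi v = w + x" using tailsD(5)[OF T v(1)] hv by (simp add: w_def)
  define s1 where "s1 = s(24 := (s 24)(0 := v), 25 := (s 25)(0 := w))"
  show "timed W pick_violator s (max_cost pick_violator) (\<lambda>s'. s' = s1)"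
  proof (rule timed_run)
    have "run pick_violator s = s1" by (simp add: pick_violator_def s1_def pr v_def w_def)
    moreover have "runs_ok W pick_violator s"
      unfolding pick_violator_def using W_bounds kn M_bounds by (simp add: fits_slot pr)
    ultimately show "runs_ok W pick_violator s \<and> run pick_violator s = s1" by simp
  qed (use W_bounds in simp)
  show "timed W (remove_in 24) s' (max_cost (remove_in 24)) (\<lambda>s'. in_ok s' (A - {v}) \<and>
     (\<forall>a. a \<notin> {6,7,8,30,31} \<longrightarrow> s' a = s1 a))" if "s' = s1" for s'
  proof -
    have "in_ok s1 A = in_ok s A" by (rule in_ok_cong) (auto simp: s1_def)
    then show ?thesis using timed_remove_in[of s1 A 24] H I v unfolding that
      by (simp add: s1_def hole_def params_def)
  qed
  show "timed W swap_out s2 (max_cost swap_out) (\<lambda>s'. in_ok s' (A - {v}) \<and> tails_ok s' A \<and>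
      bags M n (s' 2) (s' 3) (s' 4) (s' 1) (insert c A) \<and>
      s' 1 = (s 1)(c := w, v := x) \<and> s' 4 = (s 4)(c := s 4 v, v := s 4 c) \<and>
     (\<forall>a. a \<notin> {1,2,4,6,7,8,29,30,31} \<longrightarrow> s' a = s1 a))"
    if s2: "in_ok s2 (A - {v}) \<and> (\<forall>a. a \<notin> {6,7,8,30,31} \<longrightarrow> s2 a = s1 a)" for s2
  proof (rule timed_run)
    have e2: "s2 0 = s 0" "s2 1 = s 1" "s2 2 = s 2" "s2 3 = s 3" "s2 4 = s 4" "s2 10 = s 10" "s2 11 = s 11"
      and e2': "s2 24 0 = v" "s2 25 0 = w" using s2 by (auto simp: s1_def)
    have uc: "s 11 0 = x" using u by (simp add: x_def)
    define s3 where "s3 = s2(29 := (s2 29)(0 := s 4 v), 2 := (s 2)(x * M + s 4 c := v, w * M + s 4 v := c),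
       4 := (s 4)(v := s 4 c, c := s 4 v), 1 := (s 1)(v := x, c := w))"
    have r: "run swap_out s2 = s3"
      unfolding swap_out_def s3_def using e2(2) vc
      by (simp add: e2 e2' pr uc)
    have ok: "runs_ok W swap_out s2"
      unfolding swap_out_def using W_bounds less_M_cases[OF cB(1)] less_M_cases[OF vB(1)] vB cB
      by (simp add: e2 e2' pr uc fits_slot)
    have "in_ok s3 (A - {v}) = in_ok s2 (A - {v})"
      using c(2) e2(2) by (intro in_ok_cong_tails) (auto simp: s3_def)
    moreover have "tails_ok s3 A"
      using T c hw hv tailsD(6)[OF T v(1)] unfolding tails_ok_def s3_def by auto
    moreover have e3: "s3 1 = (s 1)(c := w, v := x)" "s3 4 = (s 4)(c := s 4 v, v := s 4 c)"
      using vc by (simp_all add: s3_def fun_upd_twist)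
    moreover have "bags M n (s3 2) (s3 3) (s3 4) (s3 1) (insert c A)"
      unfolding e3 using bags_swap[OF B _ _ refl refl refl refl, of c v] v by (simp add: s3_def e2 x_def w_def)
    moreover have "\<forall>a. a \<notin> {1,2,4,6,7,8,29,30,31} \<longrightarrow> s3 a = s1 a" using s2 by (simp add: s3_def)
    ultimately show "runs_ok W swap_out s2 \<and> in_ok (run swap_out s2) (A - {v}) \<and> tails_ok (run swap_out s2) A \<and>
      bags M n (run swap_out s2 2) (run swap_out s2 3) (run swap_out s2 4) (run swap_out s2 1) (insert c A) \<and>
      run swap_out s2 1 = (s 1)(c := w, v := x) \<and> run swap_out s2 4 = (s 4)(c := s 4 v, v := s 4 c) \<and>
     (\<forall>a. a \<notin> {1,2,4,6,7,8,29,30,31} \<longrightarrow> run swap_out s2 a = s1 a)"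
      using ok s2 unfolding r by blast
  qed (use W_bounds in simp)
  fix s3 assume s3: "in_ok s3 (A - {v}) \<and> tails_ok s3 A \<and>
      bags M n (s3 2) (s3 3) (s3 4) (s3 1) (insert c A) \<and>
      s3 1 = (s 1)(c := w, v := x) \<and> s3 4 = (s 4)(c := s 4 v, v := s 4 c) \<and>
     (\<forall>a. a \<notin> {1,2,4,6,7,8,29,30,31} \<longrightarrow> s3 a = s1 a)"
  have e3: "s3 0 = s 0" "s3 3 = s 3" "s3 5 = s 5" "s3 10 = s 10" "s3 24 0 = v" "s3 20 = s 20" using s3 by (auto simp: s1_def)
  have insv: "insert v (A - {v}) = A" using v by auto
  have "timed W (add_in 24 20) s3 (max_cost (add_in 24 20)) (\<lambda>s'. in_ok s' (insert (s3 24 0) (A - {v})) \<and>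
        s' 5 = (s3 5)(s3 24 0 := hd_of s3 (s3 24 0) * M + s3 20 0) \<and> (\<forall>a. a \<notin> {5,6,7,8,32} \<longrightarrow> s' a = s3 a))"
  proof (rule timed_add_in)
    show "params s3" using pr by (simp add: params_def e3)
    show "tails_ok s3 (insert (s3 24 0) (A - {v}))" using s3 by (simp only: e3 insv)
    show "s3 20 0 < M" using d cB by (simp add: e3)
    show "s3 24 0 \<notin> A - {v}" unfolding e3 by simp
    show "in_ok s3 (A - {v})" using s3 by blast
  qed simp_all
  then show "timed W (add_in 24 20) s3 (max_cost (add_in 24 20)) ?Q"
  proof (rule timed_weaken)
    fix s4 assume s4: "in_ok s4 (insert (s3 24 0) (A - {v})) \<and>
        s4 5 = (s3 5)(s3 24 0 := hd_of s3 (s3 24 0) * M + s3 20 0) \<and> (\<forall>a. a \<notin> {5,6,7,8,32} \<longrightarrow> s4 a = s3 a)"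
    have f4: "s4 a = s3 a" if "a \<notin> {5,6,7,8,32}" for a using s4 that by blast
    have e4: "s4 0 = s 0" "s4 1 = (s 1)(c := w, v := x)" "s4 2 = s3 2" "s4 3 = s 3" "s4 4 = (s 4)(c := s 4 v, v := s 4 c)"
      "s4 10 0 = c"
      using f4[of 0] f4[of 1] f4[of 2] f4[of 3] f4[of 4] f4[of 10] s3 e3 pr by simp_all
    have hd3: "hd_of s3 v = w" using s3 hw by (simp add: hd_of_def)
    have e5: "s4 5 = (s 5)(v := w * M + d)" using s4 d by (simp add: e3 hd3)
    have "in_ok s4 A" using s4 insv by (simp add: e3)
    moreover have "tails_ok s4 A = tails_ok s3 A" using s4 by (intro tails_ok_cong) auto
    moreover have "bags M n (s4 2) (s4 3) (s4 4) (s4 1) (insert c A)"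
    proof -
      have "bags M n (s3 2) (s3 3) (s3 4) (s3 1) (insert c A)" "s3 1 = (s 1)(c := w, v := x)"
        "s3 4 = (s 4)(c := s 4 v, v := s 4 c)" using s3 by blast+
      then show ?thesis by (simp only: e4 e3)
    qed
    moreover have "good s4 A"
      unfolding good_def
    proof
      fix y assume y: "y \<in> A"
      then have yc: "y \<noteq> c" using c by auto
      show "est s4 y \<le> slack_bound b (s4 3 (hd_of s4 y)) \<and> fresh b (s4 4 y) (est s4 y) (s4 3 (s4 1 y))"
      proof (cases "y = v")
        case True
        have "hd_of s4 v = w" using e4(2) hw by (simp add: hd_of_def)
        moreover have "est s4 v = d" using cB by (simp add: est_def e5)
        moreover have "d \<le> slack_bound b (s 3 w)" using gap(1) slack_bound_gt[of "s 3 w" b] by linarith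
        ultimately show ?thesis using d e4(2) vc True by (simp add: e4 x_def)
      next
        case False
        then show ?thesis using G y yc e4(2) unfolding good_def by (simp add: e4 e5 est_def hd_of_def)
      qed
    qed
    moreover have "chain_potential b d < chain_potential b (s 3 w)" by (rule chain_potential_less[OF b0 gap])
    moreover have "params s4" using H by (simp add: hole_def params_def e4)
    moreover have "s4 1 c = w" using e4(2) vc by simp
    moreover have "\<forall>r\<in>{0,12,14,15}. s4 r = s r" using s4 s3 by (simp add: s1_def)
    ultimately show "hole s4 A c \<and> s4 3 = s 3 \<and>
     chain_potential b (s 3 (s 1 c)) < chain_potential b (s4 3 (s4 1 c)) \<and> (\<forall>r\<in>{0,12,14,15}. s4 r = s r)"
      using s3 c d by (simp add: hole_def e4)
  qed simp
qed


text \<open>Among the arcs leaving \<open>u\<close>, those due at \<open>d\<close> and the one moved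
  into the slot of the hole are reset to \<open>d - 1\<close>. By \<open>fresh_estimate_ge\<close>
  this raises no estimate, so legality is inherited from before. Arcs into \<open>u\<close> are
  legal for the smaller degree by \<open>calm\<close>.\<close>

lemma timed_drop_hole:
  assumes H: "hole s A c" and u: "s 11 0 = u" "u = s 1 c" and d: "s 20 0 = d" "d = s 3 u" "s 13 0 = d - 1"
    and calm: "\<And>a. a \<in> A \<Longrightarrow> hd_of s a = u \<Longrightarrow> est s a \<le> slack_bound b (d - 1)" and lg: "n \<le> 2 ^ lg"
  shows "timed W (Seq (remove_cmd 2 3 4 1 10) (Seq prepare_move
            (Seq (If (Less (reg 22) (reg 13)) (Seq (setreg 24 out_arc_exp) (refresh_arc 24 26)) Skip)
            (Seq step_loop (Seq refresh_loop (setreg 12 (Const 0))))))) s (dropped_time b lg)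
     (\<lambda>s'. core s' A \<and> s' 12 0 = 0 \<and> s' 3 = (s 3)(u := s 3 u - 1) \<and> (\<forall>r\<in>{0,14,15}. s' r = s r))"
    (is "timed _ _ _ _ ?Q")
  unfolding dropped_time_def
proof (rule timed_Seq, rule_tac [2] timed_Seq, rule_tac [3] timed_Seq, rule_tac [4] timed_Seq, rule_tac [5] timed_Seq)
  have pr: "s 0 0 = n" "s 0 (Suc 0) = b" "s 10 0 = c" using H by (auto simp: params_def hole_def)
  have T: "tails_ok s A" and B: "bags M n (s 2) (s 3) (s 4) (s 1) (insert c A)" and I: "in_ok s A" and G: "good s A"
    and c: "c \<in> ids" "c \<notin> A" using H by (auto simp: hole_def)
  have cB: "u < n" "s 4 c < d" "s 2 (u * M + s 4 c) = c" "d < M" "s 4 c < M"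
    using bagsD[OF B, of c] d u by auto
  have dnb: "d < n * b" unfolding d(2) by (rule hole_degree_less[OF H cB(1)])
  have d0: "d > 0" using cB(2) by simp
  define q where "q = s 4 c"
  define v where "v = s 2 (u * M + (d - 1))"
  define sp where "sp = s(30 := (s 30)(0 := u), 3 := (s 3)(u := d - 1), 31 := (s 31)(0 := v),
     2 := (s 2)(u * M + q := v), 4 := (s 4)(v := q))"
  have insc: "insert c A - {c} = A" using c by auto
  note rem = bags_remove[OF B insertI1, unfolded u(2)[symmetric] d(2)[symmetric] q_def[symmetric] v_def[symmetric] insc]
  have Bp: "bags M n (sp 2) (sp 3) (sp 4) (sp 1) A" using rem(1) by (simp add: sp_def)
  have v: "v \<in> insert c A" "s 1 v = u" "s 4 v = d - 1" by (rule rem)+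
  have Tp: "tails_ok sp A" using T by (simp add: tails_ok_def sp_def)
  have Op: "out_ok sp A" using Bp Tp by (simp add: out_ok_def)
  have "in_ok sp A = in_ok s A" by (rule in_ok_cong) (simp_all add: sp_def)
  then have Ip: "in_ok sp A" using I by simp
  have dm: "d - 1 < M" using cB by simp
  show "timed W (remove_cmd 2 3 4 1 10) s (max_cost (remove_cmd 2 3 4 1 10)) (\<lambda>s'. s' = sp)"
  proof (rule timed_run)
    have su: "s (Suc 0) c = u" "s 2 (u * M + (d - Suc 0)) = v" using u by (simp_all add: v_def)
    have "run (remove_cmd 2 3 4 1 10) s = sp"
      by (simp add: remove_cmd_def sp_def pr su d(2)[symmetric] q_def[symmetric])
    moreover have "runs_ok W (remove_cmd 2 3 4 1 10) s"
      unfolding remove_cmd_def using W_bounds less_M_cases[OF cB(1)] cB dm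
      by (simp add: pr su fits_slot d(2)[symmetric] q_def[symmetric])
    ultimately show "runs_ok W (remove_cmd 2 3 4 1 10) s \<and> run (remove_cmd 2 3 4 1 10) s = sp" by simp
  qed (use W_bounds in simp)
  define sq where "sq = sp(22 := (s 22)(0 := q), 26 := (s 26)(0 := d - 1))"
  have spq: "sp 4 c = q" by (simp add: sp_def q_def)
  show "timed W prepare_move s' (max_cost prepare_move) (\<lambda>s'. s' = sq)" if "s' = sp" for s'
    unfolding that
  proof (rule timed_run)
    have "sp 10 0 = c" "sp 13 0 = d - 1" "sp 22 = s 22" "sp 26 = s 26" using pr d by (simp_all add: sp_def)
    then show "runs_ok W prepare_move sp \<and> run prepare_move sp = sq"
      using W_bounds spq by (simp add: prepare_move_def sq_def)
  qed (use W_bounds in simp)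
  have sqe: "sq 1 = s 1" "sq 3 = (s 3)(u := d - 1)" "sq 5 = s 5" "sq 2 = sp 2" "sq 4 = (s 4)(v := q)" "sq 0 = s 0"
    "sq 11 0 = u" "sq 13 0 = d - 1" "sq 20 0 = d" "sq 22 0 = q" "sq 26 0 = d - 1"
    using u d by (simp_all add: sq_def sp_def)
  have hdq: "hd_of sq = hd_of s" using sqe(1) by (simp add: hd_of_def fun_eq_iff)
  have Pq: "params sq" using pr by (simp add: params_def sqe)
  have "out_ok sq A = out_ok sp A" by (rule out_ok_cong) (simp_all add: sq_def)
  then have Oq: "out_ok sq A" using Op by simp
  have "in_ok sq A = in_ok sp A" by (rule in_ok_cong) (simp_all add: sq_def)
  then have Iq: "in_ok sq A" using Ip by simp
  have Tq: "tails_ok sq A" using Oq by (simp add: out_ok_def)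
  \<comment> \<open>If the hole is in the last slot, then \<open>v\<close> is \<open>c\<close>
    itself and nothing moves; the test \<open>q < d - 1\<close> tells the cases apart.\<close>
  have moved: "v \<in> A" if "q < d - 1"
    using v that by (cases "v = c") (auto simp: q_def)
  define k5 where "k5 = (if q < d - 1 then (s 5)(v := hd_of s v * M + (d - 1)) else s 5)"
  define mid where "mid = (\<lambda>s'. in_ok s' A \<and> s' 5 = k5 \<and> (\<forall>a. a \<notin> {5,6,7,8,24,30,31,32} \<longrightarrow> s' a = sq a))"
  show "timed W (If (Less (reg 22) (reg 13)) (Seq (setreg 24 out_arc_exp) (refresh_arc 24 26)) Skip) s'
     (cost (Less (reg 22) (reg 13)) + 1 + (max_cost (setreg 24 out_arc_exp) + max_cost (refresh_arc 24 26))) mid"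
    if "s' = sq" for s'
    unfolding that
  proof (rule timed_If[OF W_bounds(4)])
    assume "ev (Less (reg 22) (reg 13)) sq \<noteq> 0"
    then have lt: "q < d - 1" by (simp add: sqe split: if_splits)
    define sr where "sr = sq(24 := (sq 24)(0 := v))"
    have s2v: "sq 2 (u * M + q) = v" by (simp add: sqe sp_def)
    show "timed W (Seq (setreg 24 out_arc_exp) (refresh_arc 24 26)) sq
        (max_cost (setreg 24 out_arc_exp) + max_cost (refresh_arc 24 26)) mid"
    proof (rule timed_Seq)
      show "timed W (setreg 24 out_arc_exp) sq (max_cost (setreg 24 out_arc_exp)) (\<lambda>s'. s' = sr)"
        using lt dm W_bounds less_M_cases[OF cB(1)] s2v pr unfolding out_arc_exp_def sr_def
        by (intro timed_run) (simp_all add: fits_slot sqe)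
      fix s' assume "s' = sr"
      moreover have "timed W (refresh_arc 24 26) sr (max_cost (refresh_arc 24 26)) (\<lambda>s'. in_ok s' A \<and>
        s' 5 = (sr 5)(sr 24 0 := hd_of sr (sr 24 0) * M + sr 26 0) \<and> (\<forall>a. a \<notin> {5,6,7,8,30,31,32} \<longrightarrow> s' a = sr a))"
      proof (rule timed_refresh_arc)
        show "params sr" using Pq by (simp add: params_def sr_def)
        have "in_ok sr A = in_ok sq A" by (rule in_ok_cong) (simp_all add: sr_def)
        then show "in_ok sr A" using Iq by simp
        show "tails_ok sr A" using Tq by (simp add: tails_ok_def sr_def)
        show "sr 24 0 \<in> A" using moved[OF lt] by (simp add: sr_def)
        show "sr 26 0 < M" using dm by (simp add: sr_def sqe)
      qed simp_all
      ultimately show "timed W (refresh_arc 24 26) s' (max_cost (refresh_arc 24 26)) mid"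
        using lt by (auto elim!: timed_weaken simp: mid_def sr_def sqe k5_def hdq)
    qed
  next
    assume "ev (Less (reg 22) (reg 13)) sq = 0"
    then have lt: "\<not> q < d - 1" by (simp add: sqe split: if_splits)
    have "timed W Skip sq (max_cost Skip) mid"
      using W_bounds Iq lt by (intro timed_run) (simp_all add: mid_def k5_def sqe)
    then show "timed W Skip sq (max_cost (setreg 24 out_arc_exp) + max_cost (refresh_arc 24 26)) mid"
      by (rule timed_weaken) simp_all
  qed (use W_bounds in simp)
  define L where "L = refresh_step b d"
  show "timed W step_loop s' (step_time lg) (\<lambda>s'. s' 21 0 = L \<and> in_ok s' A \<and> s' 5 = k5 \<and>
      (\<forall>a. a \<notin> {5,6,7,8,21,24,30,31,32} \<longrightarrow> s' a = sq a))" if s': "mid s'" for s'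
    unfolding step_time_def
  proof (rule timed_weaken[OF timed_step_loop[of s' d lg]])
    have f: "s' a = sq a" if "a \<notin> {5,6,7,8,24,30,31,32}" for a using s' that by (simp add: mid_def)
    show "params s'" using Pq f[of 0] by (simp add: params_def)
    show "s' 20 0 = d" using f[of 20] by (simp add: sqe)
    fix s2 assume s2: "s2 21 0 = refresh_step b d \<and> (\<forall>a. a \<noteq> 21 \<longrightarrow> s2 a = s' a)"
    then have "in_ok s2 A = in_ok s' A" by (intro in_ok_cong) simp_all
    moreover have "s2 5 = s' 5" using s2 by simp
    ultimately show "s2 21 0 = L \<and> in_ok s2 A \<and> s2 5 = k5 \<and> (\<forall>a. a \<notin> {5,6,7,8,21,24,30,31,32} \<longrightarrow> s2 a = sq a)"
      using s2 s' f by (simp add: mid_def L_def)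
  qed (use dnb lg in simp_all)
  show "timed W refresh_loop s' (refresh_time b) (\<lambda>s'. in_ok s' A \<and>
      (\<forall>a. a \<notin> {5,6,7,8,21,22,24,30,31,32} \<longrightarrow> s' a = sq a) \<and>
      (\<forall>a\<in>A. s' 5 a = (if s 1 a = u \<and> sq 4 a < d - 1 \<and> sq 4 a mod L = d mod L
         then hd_of s a * M + (d - 1) else k5 a)))"
    if s': "s' 21 0 = L \<and> in_ok s' A \<and> s' 5 = k5 \<and> (\<forall>a. a \<notin> {5,6,7,8,21,24,30,31,32} \<longrightarrow> s' a = sq a)" for s'
  proof -
    have f: "s' a = sq a" if "a \<notin> {5,6,7,8,21,24,30,31,32}" for a using s' that by blast
    have e: "s' 0 = s 0" "s' 1 = s 1" "s' 3 = sq 3" "s' 4 = sq 4" "s' 11 0 = u" "s' 13 0 = d - 1" "s' 20 0 = d"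
       "s' 26 0 = d - 1"
      using f[of 0] f[of 1] f[of 3] f[of 4] f[of 11] f[of 13] f[of 20] f[of 26] sqe(1)
      by (simp_all add: sqe)
    have hde: "hd_of s' = hd_of s" using e(2) by (simp add: hd_of_def fun_eq_iff)
    show ?thesis
      unfolding refresh_time_def
    proof (rule timed_weaken[OF timed_refresh_loop[of s' A u "d - 1" L]])
      show "params s'" using pr by (simp add: params_def e)
      have "out_ok s' A = out_ok sq A" using f by (intro out_ok_cong) simp_all
      then show "out_ok s' A" using Oq by simp
      show "in_ok s' A" using s' by blast
      show "u < n" by (rule cB)
      show "d - 1 \<le> s' 3 u" by (simp add: e sqe)
      show "L \<le> M" unfolding L_def by (rule refresh_step_le_M[OF cB(4)])
      show "d - 1 \<le> 8 * b * L" using less_refresh_step[OF b0, of d] by (simp add: L_def)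
      show "s' 26 0 < M" using dm by (simp add: e)
      fix s2 assume s2: "(\<forall>a. a \<notin> {5,6,7,8,22,24,30,31,32} \<longrightarrow> s2 a = s' a) \<and> in_ok s2 A \<and>
        (\<forall>a\<in>A. s2 5 a = (if s' 1 a = u \<and> s' 4 a < d - 1 \<and> s' 4 a mod L = s' 20 0 mod L
         then hd_of s' a * M + s' 26 0 else s' 5 a))"
      have k: "s' 5 = k5" using s' by blast
      show "in_ok s2 A \<and> (\<forall>a. a \<notin> {5,6,7,8,21,22,24,30,31,32} \<longrightarrow> s2 a = sq a) \<and>
        (\<forall>a\<in>A. s2 5 a = (if s 1 a = u \<and> sq 4 a < d - 1 \<and> sq 4 a mod L = d mod L
         then hd_of s a * M + (d - 1) else k5 a))"
      proof (intro conjI)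
        show "in_ok s2 A" using s2 by blast
        show "\<forall>a. a \<notin> {5,6,7,8,21,22,24,30,31,32} \<longrightarrow> s2 a = sq a" using s2 f by simp
        show "\<forall>a\<in>A. s2 5 a = (if s 1 a = u \<and> sq 4 a < d - 1 \<and> sq 4 a mod L = d mod L
         then hd_of s a * M + (d - 1) else k5 a)"
          using s2[THEN conjunct2, THEN conjunct2] unfolding e hde k .
      qed
    next
      show "s' 11 0 = u" "s' 13 0 = d - 1" by (rule e)+
      show "s' 21 0 = L" using s' by blast
    qed (simp_all add: L_def)
  qed
  fix s1 assume s1: "in_ok s1 A \<and> (\<forall>a. a \<notin> {5,6,7,8,21,22,24,30,31,32} \<longrightarrow> s1 a = sq a) \<and>
      (\<forall>a\<in>A. s1 5 a = (if s 1 a = u \<and> sq 4 a < d - 1 \<and> sq 4 a mod L = d mod L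
         then hd_of s a * M + (d - 1) else k5 a))"
  define s2 where "s2 = s1(12 := (s1 12)(0 := 0))"
  have f: "s2 a = sq a" if "a \<notin> {5,6,7,8,12,21,22,24,30,31,32}" for a using s1 that by (simp add: s2_def)
  have e: "s2 0 = s 0" "s2 1 = s 1" "s2 3 = (s 3)(u := d - 1)" "s2 4 = (s 4)(v := q)"
    using f[of 0] f[of 1] f[of 3] f[of 4] sqe(1) by (simp_all add: sqe)
  have hde: "hd_of s2 = hd_of s" using e(2) by (simp add: hd_of_def fun_eq_iff)
  have e5: "s2 5 a = (if s 1 a = u \<and> sq 4 a < d - 1 \<and> sq 4 a mod L = d mod L
         then hd_of s a * M + (d - 1) else k5 a)" if "a \<in> A" for a
    using s1 that by (simp add: s2_def)
  have "out_ok s2 A = out_ok sq A" using f by (intro out_ok_cong) simp_all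
  then have O2: "out_ok s2 A" using Oq by simp
  have "in_ok s2 A = in_ok s1 A" by (rule in_ok_cong) (simp_all add: s2_def)
  then have I2: "in_ok s2 A" using s1 by blast
  have P2: "params s2" using pr by (simp add: params_def e)
  have G2: "good s2 A"
    unfolding good_def
  proof
    fix a assume a: "a \<in> A"
    have G': "est s a \<le> slack_bound b (s 3 (hd_of s a))" "fresh b (s 4 a) (est s a) (s 3 (s 1 a))"
      using G a by (auto simp: good_def)
    have tl: "s 1 a \<noteq> hd_of s a" using tailsD(4)[OF T a] .
    have pos1: "sq 4 a < s2 3 (s 1 a)"
      using bagsD(2)[OF Bp a] e(3) by (simp add: sq_def sp_def)
    show "est s2 a \<le> slack_bound b (s2 3 (hd_of s2 a)) \<and> fresh b (s2 4 a) (est s2 a) (s2 3 (s2 1 a))"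
    proof (cases "s 1 a = u")
      case tu: True
      have hu: "hd_of s a \<noteq> u" using tl tu by simp
      have p1: "sq 4 a < d - 1" using pos1 tu by (simp add: e)
      have sd: "Suc (d - 1) = d" using d0 by simp
      have fa: "fresh b (s 4 a) (est s a) d" using G'(2) unfolding tu d(2)[symmetric] .
      show ?thesis
      proof (cases "sq 4 a mod L = d mod L \<or> a = v")
        case True
        have ge: "d - 1 \<le> est s a"
        proof (cases "a = v")
          case av: True
          have "s 4 a = d - 1" using v(3) av by simp
          then show ?thesis by (intro fresh_estimate_ge[OF fa]) simp_all
        next
          case False
          then have "s 4 a mod L = d mod L" using True by (simp add: sqe)
          then have "d \<le> est s a"
            by (intro fresh_estimate_ge[OF fa]) (simp_all add: L_def)
          then show ?thesis by simp
        qed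
        have "est s2 a = d - 1"
        proof (cases "sq 4 a mod L = d mod L")
          case T1: True
          then have "s2 5 a = hd_of s a * M + (d - 1)" using e5[OF a] tu p1 by (simp only: simp_thms if_True)
          then show ?thesis unfolding est_def by (simp only: slot_div_mod(2)[OF dm])
        next
          case F1: False
          then have av: "a = v" using True by simp
          then have "q < d - 1" using p1 by (simp add: sqe)
          then have "k5 a = hd_of s a * M + (d - 1)" unfolding k5_def av by (simp only: if_True fun_upd_same)
          then have "s2 5 a = hd_of s a * M + (d - 1)" using e5[OF a] F1 by (simp only: simp_thms if_False)
          then show ?thesis unfolding est_def by (simp only: slot_div_mod(2)[OF dm])
        qed
        then show ?thesis using ge G'(1) tu hu e(2) by (simp add: e hde)
      next
        case False
        then have es: "est s2 a = est s a" using e5[OF a] by (simp add: est_def k5_def)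
        have p: "s2 4 a = s 4 a" using False by (simp add: e)
        have "fresh b (s 4 a) (est s a) (d - 1)"
        proof (rule fresh_decr)
          show "fresh b (s 4 a) (est s a) (Suc (d - 1))" unfolding sd by (rule fa)
          show "Suc (d - 1) mod refresh_step b (Suc (d - 1)) \<noteq> s 4 a mod refresh_step b (Suc (d - 1))"
            unfolding sd using False by (auto simp: L_def sqe)
        qed
        then show ?thesis using es p G'(1) tu hu e(2) by (simp add: e hde)
      qed
    next
      case tu: False
      then have av: "a \<noteq> v" using v by auto
      have es: "est s2 a = est s a" using e5[OF a] tu av by (simp add: est_def k5_def)
      have "est s a \<le> slack_bound b (s2 3 (hd_of s a))"
        using calm[OF a] G'(1) by (simp add: e)
      then show ?thesis using es G'(2) tu av e(2) by (simp add: e hde)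
    qed
  qed
  have "core s2 A \<and> s2 12 0 = 0 \<and> s2 3 = (s 3)(u := s 3 u - 1) \<and> (\<forall>r\<in>{0,14,15}. s2 r = s r)"
    using O2 I2 P2 G2 f by (simp add: core_def e d(2)[symmetric]) (simp add: s2_def sq_def sp_def)
  then show "timed W (setreg 12 (Const 0)) s1 (max_cost (setreg 12 (Const 0))) ?Q"
    using W_bounds by (intro timed_run) (simp_all add: s2_def)
qed

lemma timed_delete_step:
  assumes H: "hole s A c" and lg: "n \<le> 2 ^ lg"
  shows "timed W delete_step s (delete_step_time b lg) (\<lambda>s'.
     (hole s' A c \<and> s' 3 = s 3 \<and> chain_potential b (s 3 (s 1 c)) < chain_potential b (s' 3 (s' 1 c)) \<and>
        (\<forall>r\<in>{0,12,14,15}. s' r = s r)) \<or>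
     core s' A \<and> s' 12 0 = 0 \<and> s' 3 = (s 3)(s 1 c := s 3 (s 1 c) - 1) \<and> (\<forall>r\<in>{0,14,15}. s' r = s r))"
    (is "timed W _ _ _ ?Q")
  unfolding delete_step_def delete_step_time_def pick_violator_def[symmetric] prepare_move_def[symmetric]
proof (rule timed_Seq[OF timed_find_violation[OF H]])
  define u d t where "u = s 1 c" and "d = s 3 u" and "t = slack_bound b (d - 1)"
  fix s1 assume "(\<forall>a. a \<notin> {11,13,20,28} \<longrightarrow> s1 a = s a) \<and> s1 11 0 = s 1 c \<and> s1 20 0 = s 3 (s 1 c) \<and>
    s1 13 0 = s 3 (s 1 c) - 1 \<and>
        (\<exists>e. (e = slack_bound b (s 3 (s 1 c) - 1) + 1 \<or> e = slack_bound b (s 3 (s 1 c) - 1) + 2) \<and> s1 28 0 = s 1 c * M + e) \<and>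
        (s 7 (s1 28 0) = 0 \<longrightarrow> s 7 (s 1 c * M + (slack_bound b (s 3 (s 1 c) - 1) + 1)) = 0 \<and>
           s 7 (s 1 c * M + (slack_bound b (s 3 (s 1 c) - 1) + 2)) = 0)"
  then have f: "\<And>a. a \<notin> {11,13,20,28} \<Longrightarrow> s1 a = s a" and r: "s1 11 0 = u" "s1 20 0 = d" "s1 13 0 = d - 1"
    and k: "\<exists>e. (e = t + 1 \<or> e = t + 2) \<and> s1 28 0 = u * M + e"
    and z: "s 7 (s1 28 0) = 0 \<Longrightarrow> s 7 (u * M + (t + 1)) = 0 \<and> s 7 (u * M + (t + 2)) = 0"
    by (simp_all add: u_def d_def t_def)
  have e1: "s1 0 = s 0" "s1 1 = s 1" "s1 2 = s 2" "s1 3 = s 3" "s1 4 = s 4" "s1 5 = s 5" "s1 6 = s 6" "s1 7 = s 7"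
    "s1 8 = s 8" "s1 10 = s 10" "s1 12 = s 12" "s1 14 = s 14" "s1 15 = s 15" by (auto intro!: f)
  have hde: "hd_of s1 = hd_of s" using e1(2) by (simp add: hd_of_def fun_eq_iff)
  have H1: "hole s1 A c"
    using H in_ok_cong[of s1 s A] good_cong[of s1 s A] tails_ok_cong[of s1 s A] e1
    unfolding hole_def params_def by simp
  have B: "bags M n (s 2) (s 3) (s 4) (s 1) (insert c A)" and I: "in_ok s A" and G: "good s A" and T: "tails_ok s A"
    using H by (auto simp: hole_def)
  have un: "u < n" and d0: "d > 0" using bagsD[OF B, of c] by (auto simp: u_def d_def)
  have "d < n * b" unfolding d_def by (rule hole_degree_less[OF H un])
  then have tM: "t + 2 < M" unfolding t_def by (rule slack_pred_less_M)
  show "timed W (If (Read 7 (reg 28)) (Seq pick_violator (Seq (remove_in 24) (Seq swap_out (add_in 24 20))))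
     (Seq (remove_cmd 2 3 4 1 10) (Seq prepare_move
            (Seq (If (Less (reg 22) (reg 13)) (Seq (setreg 24 out_arc_exp) (refresh_arc 24 26)) Skip)
            (Seq step_loop (Seq refresh_loop (setreg 12 (Const 0)))))))) s1
     (cost (Read 7 (reg 28)) + 1 + (moved_time + dropped_time b lg)) ?Q"
  proof (rule timed_If[OF W_bounds(4)])
    assume "ev (Read 7 (reg 28)) s1 \<noteq> 0"
    then have ne: "s1 7 (s1 28 0) \<noteq> 0" by simp
    obtain e where e: "e = t + 1 \<or> e = t + 2" "s1 28 0 = u * M + e" using k by blast
    show "timed W (Seq pick_violator (Seq (remove_in 24) (Seq swap_out (add_in 24 20)))) s1 (moved_time + dropped_time b lg) ?Q"
    proof (rule timed_weaken[OF timed_move_hole[OF H1, of d e]])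
      show "s1 11 0 = s1 1 c" "d = s1 3 (s1 1 c)" "s1 28 0 = s1 1 c * M + e"
        unfolding e1 using r e by (simp_all add: u_def d_def)
      show "slack_bound b (d - 1) < e" "e < M" using e tM by (auto simp: t_def)
      fix s2 assume "hole s2 A c \<and> s2 3 = s1 3 \<and> chain_potential b (s1 3 (s1 1 c)) < chain_potential b (s2 3 (s2 1 c)) \<and>
        (\<forall>r\<in>{0,12,14,15}. s2 r = s1 r)"
      moreover from this have "\<forall>r\<in>{0,12,14,15}. s2 r = s r" by (simp add: e1)
      ultimately show "?Q s2" unfolding e1(2,4) by blast
    qed (use ne r in simp_all)
  next
    assume "ev (Read 7 (reg 28)) s1 = 0"
    then have z1: "s 7 (u * M + (t + 1)) = 0" "s 7 (u * M + (t + 2)) = 0" using z by (simp_all add: e1)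
    \<comment> \<open>By \<open>slack_bound_Suc\<close> an illegal estimate equals
      \<open>t + 1\<close> or \<open>t + 2\<close>, and its arc would lie in one of the two bags
      found empty.\<close>
    have calm: "est s a \<le> t" if a: "a \<in> A" "hd_of s a = u" for a
    proof (rule ccontr)
      assume "\<not> est s a \<le> t"
      moreover have "est s a \<le> slack_bound b d" using G a by (auto simp: good_def d_def)
      moreover have "slack_bound b d \<le> t + 2" using slack_bound_Suc[OF b0, of "d - 1"] d0 by (simp add: t_def)
      ultimately have es: "est s a = t + 1 \<or> est s a = t + 2" by linarith
      have "s 5 a = u * M + est s a"
        using I a by (auto simp: in_ok_def est_def) (metis div_mult_mod_eq)
      moreover have "s 8 a < s 7 (s 5 a)" using I a bagsD(2) unfolding in_ok_def by blast
      ultimately show False using es z1 by auto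
    qed
    have calm1: "est s1 a \<le> slack_bound b (d - 1)" if "a \<in> A" "hd_of s1 a = u" for a
      using calm[of a] that by (simp add: hde est_def e1 t_def)
    show "timed W (Seq (remove_cmd 2 3 4 1 10) (Seq prepare_move
            (Seq (If (Less (reg 22) (reg 13)) (Seq (setreg 24 out_arc_exp) (refresh_arc 24 26)) Skip)
            (Seq step_loop (Seq refresh_loop (setreg 12 (Const 0))))))) s1 (moved_time + dropped_time b lg) ?Q"
    proof (rule timed_weaken[OF timed_drop_hole[OF H1 r(1) _ r(2) _ r(3) calm1 lg]])
      show "u = s1 1 c" "d = s1 3 u" unfolding e1 by (simp_all add: u_def d_def)
      fix s2 assume "core s2 A \<and> s2 12 0 = 0 \<and> s2 3 = (s1 3)(u := s1 3 u - 1) \<and> (\<forall>r\<in>{0,14,15}. s2 r = s1 r)"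
      then show "?Q s2" unfolding u_def e1 by (auto simp: e1)
    qed simp_all
  qed (use W_bounds in simp)
qed

end

section \<open>Updates\<close>

text \<open>The potential bounds the number of reversals; one further round settles the arc, and one
  more pays for the last loop test.\<close>

definition insert_chain_time :: "nat \<Rightarrow> nat \<Rightarrow> nat \<Rightarrow> nat" where
  "insert_chain_time b lg d = Suc (Suc (chain_potential b d)) * (insert_step_time b lg + cost (reg 12) + 1)"

definition delete_chain_time :: "nat \<Rightarrow> nat \<Rightarrow> nat \<Rightarrow> nat" where
  "delete_chain_time b lg d = Suc (Suc (chain_potential b d)) * (delete_step_time b lg + cost (reg 12) + 1)"

definition for_time :: "nat \<Rightarrow> nat \<Rightarrow> nat" where
  "for_time b T = max_cost (Seq base_cmd (setreg 14 (Const 0))) +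
     Suc b * (T + max_cost (setreg 14 (Add (reg 14) (Const 1))) + cost (Less (reg 14) b_exp) + 1)"

context ram begin

text \<open>The degree table is constant until the chain ends, where a single entry grows by one.
  The variant can therefore be the potential of the current tail in a fixed table.\<close>

lemma timed_insert_chain:
  assumes C: "core s A" and Q: "pending s A" and go: "s 12 0 = 1" and lg: "n \<le> 2 ^ lg"
    and deg: "\<And>v. v < n \<Longrightarrow> s 3 v \<le> d"
  shows "timed W (While (reg 12) insert_step) s (insert_chain_time b lg d)
    (\<lambda>s'. core s' (insert (s 10 0) A) \<and> (\<forall>v<n. s' 3 v \<le> Suc d) \<and> (\<forall>r\<in>{0,14,15}. s' r = s r))"
proof -
  define Inv where "Inv = (\<lambda>s' m. (\<forall>r\<in>{0,14,15}. s' r = s r) \<and>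
     (s' 12 0 = 1 \<and> s' 3 = s 3 \<and> m = Suc (chain_potential b (s' 3 (s' 11 0))) \<and>
        (\<exists>A'. core s' A' \<and> pending s' A' \<and> insert (s' 10 0) A' = insert (s 10 0) A) \<or>
      s' 12 0 = 0 \<and> core s' (insert (s 10 0) A) \<and> (\<forall>v<n. s' 3 v \<le> Suc d)))"
  have tail_lt: "s' 11 0 < n" if "pending s' A'" for s' A'
    using that ids_bounds[of "s' 10 0"] unfolding pending_def by auto
  have "Inv s (Suc (chain_potential b (s 3 (s 11 0))))"
    using C Q go unfolding Inv_def by blast
  note tW = timed_While[where I = Inv and e = "reg 12" and c = insert_step and T = "insert_step_time b lg", OF W_bounds(4) this]
  show ?thesis
    unfolding insert_chain_time_def
  proof (rule timed_weaken[OF tW])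
    have "chain_potential b (s 3 (s 11 0)) \<le> chain_potential b d"
      by (rule chain_potential_mono[OF b0 deg[OF tail_lt[OF Q]]])
    then show "Suc (Suc (chain_potential b (s 3 (s 11 0)))) * (insert_step_time b lg + cost (reg 12) + 1)
      \<le> Suc (Suc (chain_potential b d)) * (insert_step_time b lg + cost (reg 12) + 1)"
      by (intro mult_right_mono) simp_all
    fix s' assume "ev (reg 12) s' = 0 \<and> (\<exists>m. Inv s' m)"
    then show "core s' (insert (s 10 0) A) \<and> (\<forall>v<n. s' 3 v \<le> Suc d) \<and> (\<forall>r\<in>{0,14,15}. s' r = s r)"
      unfolding Inv_def by auto
  next
    fix s1 m assume I: "Inv s1 m"
    show "fits W (reg 12) s1 \<and> (ev (reg 12) s1 \<noteq> 0 \<longrightarrow>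
       0 < m \<and> timed W insert_step s1 (insert_step_time b lg) (\<lambda>s'. \<exists>m'<m. Inv s' m'))"
    proof (intro conjI impI)
      show "fits W (reg 12) s1" using W_bounds by simp
      assume "ev (reg 12) s1 \<noteq> 0"
      with I obtain A' where A': "core s1 A'" "pending s1 A'" "insert (s1 10 0) A' = insert (s 10 0) A"
        and s1: "s1 12 0 = 1" "s1 3 = s 3" "m = Suc (chain_potential b (s1 3 (s1 11 0)))" "\<forall>r\<in>{0,14,15}. s1 r = s r"
        unfolding Inv_def by auto
      show "0 < m" using s1 by simp
      show "timed W insert_step s1 (insert_step_time b lg) (\<lambda>s'. \<exists>m'<m. Inv s' m')"
      proof (rule timed_weaken[OF timed_insert_step[OF A'(1,2) lg]])
        fix s2 assume "(\<exists>A''. core s2 A'' \<and> pending s2 A'' \<and> insert (s2 10 0) A'' = insert (s1 10 0) A' \<and> s2 3 = s1 3 \<and>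
            chain_potential b (s2 3 (s2 11 0)) < chain_potential b (s1 3 (s1 11 0)) \<and> (\<forall>r\<in>{0,12,14,15}. s2 r = s1 r)) \<or>
          core s2 (insert (s1 10 0) A') \<and> s2 12 0 = 0 \<and> s2 3 = (s1 3)(s1 11 0 := Suc (s1 3 (s1 11 0))) \<and>
            (\<forall>r\<in>{0,14,15}. s2 r = s1 r)"
        then show "\<exists>m'<m. Inv s2 m'"
        proof
          assume "\<exists>A''. core s2 A'' \<and> pending s2 A'' \<and> insert (s2 10 0) A'' = insert (s1 10 0) A' \<and> s2 3 = s1 3 \<and>
            chain_potential b (s2 3 (s2 11 0)) < chain_potential b (s1 3 (s1 11 0)) \<and> (\<forall>r\<in>{0,12,14,15}. s2 r = s1 r)"
          then obtain A'' where "core s2 A''" "pending s2 A''" "insert (s2 10 0) A'' = insert (s 10 0) A" "s2 3 = s 3"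
            "chain_potential b (s2 3 (s2 11 0)) < chain_potential b (s1 3 (s1 11 0))" "\<forall>r\<in>{0,12,14,15}. s2 r = s1 r"
            using A'(3) s1 by metis
          then show ?thesis using s1 unfolding Inv_def
            by (intro exI[of _ "Suc (chain_potential b (s2 3 (s2 11 0)))"]) auto
        next
          assume h: "core s2 (insert (s1 10 0) A') \<and> s2 12 0 = 0 \<and> s2 3 = (s1 3)(s1 11 0 := Suc (s1 3 (s1 11 0))) \<and>
            (\<forall>r\<in>{0,14,15}. s2 r = s1 r)"
          have "s2 3 v \<le> Suc d" if "v < n" for v
            using h s1 deg[OF that] deg[OF tail_lt[OF A'(2)]] by auto
          then have "Inv s2 0" using h s1 A'(3) unfolding Inv_def by auto
          then show ?thesis using s1 by auto
        qed
      qed simp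
    qed
  qed
qed

text \<open>Degrees rise along this chain, so the variant is the distance of the current potential
  from that of the common bound \<open>d\<close>.\<close>

lemma timed_delete_chain:
  assumes H: "hole s A c" and go: "s 12 0 = 1" and lg: "n \<le> 2 ^ lg"
    and deg: "\<And>v. v < n \<Longrightarrow> s 3 v \<le> d"
  shows "timed W (While (reg 12) delete_step) s (delete_chain_time b lg d)
    (\<lambda>s'. core s' A \<and> (\<forall>v<n. s' 3 v \<le> d) \<and> (\<forall>r\<in>{0,14,15}. s' r = s r))"
proof -
  define Inv where "Inv = (\<lambda>s' m. (\<forall>r\<in>{0,14,15}. s' r = s r) \<and>
     (s' 12 0 = 1 \<and> s' 3 = s 3 \<and> m = Suc (chain_potential b d) - chain_potential b (s' 3 (s' 1 c)) \<and> hole s' A c \<or>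
      s' 12 0 = 0 \<and> core s' A \<and> (\<forall>v<n. s' 3 v \<le> d)))"
  have tail_lt: "s' 1 c < n" if "hole s' A c" for s'
    using that bagsD(1)[of M n "s' 2" "s' 3" "s' 4" "s' 1" "insert c A" c] unfolding hole_def by auto
  have "Inv s (Suc (chain_potential b d) - chain_potential b (s 3 (s 1 c)))"
    using H go unfolding Inv_def by blast
  note tW = timed_While[where I = Inv and e = "reg 12" and c = delete_step and T = "delete_step_time b lg", OF W_bounds(4) this]
  show ?thesis
    unfolding delete_chain_time_def
  proof (rule timed_weaken[OF tW])
    show "Suc (Suc (chain_potential b d) - chain_potential b (s 3 (s 1 c))) * (delete_step_time b lg + cost (reg 12) + 1)
      \<le> Suc (Suc (chain_potential b d)) * (delete_step_time b lg + cost (reg 12) + 1)"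
      by (intro mult_right_mono) simp_all
    fix s' assume "ev (reg 12) s' = 0 \<and> (\<exists>m. Inv s' m)"
    then show "core s' A \<and> (\<forall>v<n. s' 3 v \<le> d) \<and> (\<forall>r\<in>{0,14,15}. s' r = s r)"
      unfolding Inv_def by auto
  next
    fix s1 m assume I: "Inv s1 m"
    show "fits W (reg 12) s1 \<and> (ev (reg 12) s1 \<noteq> 0 \<longrightarrow>
       0 < m \<and> timed W delete_step s1 (delete_step_time b lg) (\<lambda>s'. \<exists>m'<m. Inv s' m'))"
    proof (intro conjI impI)
      show "fits W (reg 12) s1" using W_bounds by simp
      assume "ev (reg 12) s1 \<noteq> 0"
      with I have H1: "hole s1 A c"
        and s1: "s1 12 0 = 1" "s1 3 = s 3" "m = Suc (chain_potential b d) - chain_potential b (s1 3 (s1 1 c))"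
          "\<forall>r\<in>{0,14,15}. s1 r = s r"
        unfolding Inv_def by auto
      have pd: "chain_potential b (s1 3 (s1 1 c)) \<le> chain_potential b d"
        unfolding s1(2) by (rule chain_potential_mono[OF b0 deg[OF tail_lt[OF H1]]])
      then show "0 < m" using s1 by simp
      show "timed W delete_step s1 (delete_step_time b lg) (\<lambda>s'. \<exists>m'<m. Inv s' m')"
      proof (rule timed_weaken[OF timed_delete_step[OF H1 lg]])
        fix s2 assume "(hole s2 A c \<and> s2 3 = s1 3 \<and> chain_potential b (s1 3 (s1 1 c)) < chain_potential b (s2 3 (s2 1 c)) \<and>
            (\<forall>r\<in>{0,12,14,15}. s2 r = s1 r)) \<or>
          core s2 A \<and> s2 12 0 = 0 \<and> s2 3 = (s1 3)(s1 1 c := s1 3 (s1 1 c) - 1) \<and> (\<forall>r\<in>{0,14,15}. s2 r = s1 r)"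
        then show "\<exists>m'<m. Inv s2 m'"
        proof
          assume h: "hole s2 A c \<and> s2 3 = s1 3 \<and> chain_potential b (s1 3 (s1 1 c)) < chain_potential b (s2 3 (s2 1 c)) \<and>
            (\<forall>r\<in>{0,12,14,15}. s2 r = s1 r)"
          then have "Inv s2 (Suc (chain_potential b d) - chain_potential b (s2 3 (s2 1 c)))"
            using s1 unfolding Inv_def by simp
          moreover have "Suc (chain_potential b d) - chain_potential b (s2 3 (s2 1 c)) < m"
            unfolding s1(3) using h pd by linarith
          ultimately show ?thesis by blast
        next
          assume h: "core s2 A \<and> s2 12 0 = 0 \<and> s2 3 = (s1 3)(s1 1 c := s1 3 (s1 1 c) - 1) \<and> (\<forall>r\<in>{0,14,15}. s2 r = s1 r)"
          have "s2 3 v \<le> d" if "v < n" for v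
            using h s1 deg[OF that] by (cases "v = s1 1 c") (auto intro: le_trans[OF diff_le_self])
          then have "Inv s2 0" using h s1 unfolding Inv_def by auto
          then show ?thesis using \<open>0 < m\<close> by auto
        qed
      qed simp
    qed
  qed
qed

section \<open>Processing the copies of an edge\<close>

definition base :: "nat \<Rightarrow> nat \<Rightarrow> nat" where
  "base u v = (min u v * n + max u v) * b"

lemma copy_ends:
  assumes "u \<noteq> v" "u < n" "v < n" "i < b"
  shows "lo (base u v + i) = min u v" "hi (base u v + i) = max u v" "(base u v + i) mod b = i" "base u v + i \<in> ids"
proof -
  have m: "max u v < n" "min u v < max u v" using assms by auto
  have "(base u v + i) div b = min u v * n + max u v" "(base u v + i) mod b = i"
    using assms(4) by (simp_all add: base_def)
  then show "lo (base u v + i) = min u v" "hi (base u v + i) = max u v" "(base u v + i) mod b = i"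
    using m by (simp_all add: lo_def hi_def)
  then show "base u v + i \<in> ids" using m by (simp add: ids_def)
qed

lemma base_less_W:
  assumes "u < n" "v < n"
  shows "min u v * n + max u v < W" "min u v * n < W" "base u v + b < W"
proof -
  have "Suc (min u v) * n \<le> n * n" using assms by (intro mult_right_mono) auto
  then have 1: "min u v * n + max u v < n * n" using assms by simp
  have nb: "n * n * b \<le> n * M" unfolding M_def by simp
  have "n * n * 1 \<le> n * n * b" using b by (intro mult_mono) auto
  then have 2: "n * n < W" using nb W_bounds(2) by linarith
  show "min u v * n + max u v < W" "min u v * n < W" using 1 2 by linarith+
  have "Suc (min u v * n + max u v) * b \<le> n * n * b" using 1 by (intro mult_right_mono) auto
  then have "(min u v * n + max u v) * b + b \<le> n * n * b" by simp
  then show "base u v + b < W" unfolding base_def using nb W_bounds(2) by linarith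
qed

lemma timed_base:
  assumes P: "params s" and uv: "s 0 2 = u" "s 0 3 = v" "u \<noteq> v" "u < n" "v < n"
  shows "timed W (Seq base_cmd (setreg 14 (Const 0))) s (max_cost (Seq base_cmd (setreg 14 (Const 0))))
     (\<lambda>s'. s' = s(15 := (s 15)(0 := base u v), 14 := (s 14)(0 := 0)))"
proof (rule timed_run)
  have p: "s 0 0 = n" "s 0 (Suc 0) = b" using P by (auto simp: params_def)
  show "runs_ok W (Seq base_cmd (setreg 14 (Const 0))) s \<and>
     run (Seq base_cmd (setreg 14 (Const 0))) s = s(15 := (s 15)(0 := base u v), 14 := (s 14)(0 := 0))"
  proof (cases "u < v")
    case True
    then show ?thesis using W_bounds base_less_W[OF uv(4,5)]
      by (simp add: base_cmd_def p uv base_def min_def max_def)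
  next
    case False
    then show ?thesis using W_bounds base_less_W[OF uv(4,5)] uv(3)
      by (simp add: base_cmd_def p uv base_def min_def max_def)
  qed
qed (use W_bounds in simp)

text \<open>\<open>K s i\<close> describes the memory after \<open>i\<close> copies.
  \<open>Kreg\<close> carries it over the write to the counter in register 14, which belongs to the
  loop and not to its body.\<close>

lemma timed_for_copies:
  fixes K :: "memory \<Rightarrow> nat \<Rightarrow> bool"
  assumes P: "params s" and uv: "s 0 2 = u" "s 0 3 = v" "u \<noteq> v" "u < n" "v < n"
    and K0: "\<And>s'. (\<forall>a. a \<noteq> 14 \<and> a \<noteq> 15 \<longrightarrow> s' a = s a) \<Longrightarrow> K s' 0"
    and Kstep: "\<And>s' i. i < b \<Longrightarrow> K s' i \<Longrightarrow> s' 0 = s 0 \<Longrightarrow> s' 14 0 = i \<Longrightarrow> s' 15 0 = base u v \<Longrightarrow>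
       timed W c s' T (\<lambda>s''. K s'' (Suc i) \<and> (\<forall>r\<in>{0,14,15}. s'' r = s' r))"
    and Kreg: "\<And>s' f i. K s' i \<Longrightarrow> K (s'(14 := f)) i"
  shows "timed W (for_copies c) s (for_time b T) (\<lambda>s'. K s' b)"
  unfolding for_copies_def for_time_def
proof (rule timed_Seq[OF timed_base[OF P uv]])
  have p: "s 0 0 = n" "s 0 (Suc 0) = b" using P by (auto simp: params_def)
  define Inv where "Inv = (\<lambda>s' m. \<exists>i. s' 14 0 = i \<and> i \<le> b \<and> m = b - i \<and> s' 15 0 = base u v \<and> s' 0 = s 0 \<and> K s' i)"
  fix s1 assume s1: "s1 = s(15 := (s 15)(0 := base u v), 14 := (s 14)(0 := 0))"
  have "K s1 0" by (rule K0) (simp add: s1)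
  then have I: "Inv s1 b" by (simp add: Inv_def s1)
  have bW: "Suc b < W" using M_bounds W_bounds b by linarith
  show "timed W (While (Less (reg 14) b_exp) (Seq c (setreg 14 (Add (reg 14) (Const 1))))) s1
     (Suc b * (T + max_cost (setreg 14 (Add (reg 14) (Const 1))) + cost (Less (reg 14) b_exp) + 1)) (\<lambda>s'. K s' b)"
  proof (rule timed_weaken[OF timed_While[where I = Inv, OF W_bounds(4) I] order_refl])
    fix s2 m assume "Inv s2 m"
    then obtain i where i: "s2 14 0 = i" "i \<le> b" "m = b - i" "s2 15 0 = base u v" "s2 0 = s 0" "K s2 i"
      unfolding Inv_def by blast
    show "fits W (Less (reg 14) b_exp) s2 \<and> (ev (Less (reg 14) b_exp) s2 \<noteq> 0 \<longrightarrow>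
       0 < m \<and> timed W (Seq c (setreg 14 (Add (reg 14) (Const 1)))) s2
         (T + max_cost (setreg 14 (Add (reg 14) (Const 1)))) (\<lambda>s'. \<exists>m'<m. Inv s' m'))"
    proof (intro conjI impI)
      show "fits W (Less (reg 14) b_exp) s2" using W_bounds by simp
      assume "ev (Less (reg 14) b_exp) s2 \<noteq> 0"
      then have ib: "i < b" by (simp add: i p split: if_splits)
      then show "0 < m" using i by simp
      show "timed W (Seq c (setreg 14 (Add (reg 14) (Const 1)))) s2
         (T + max_cost (setreg 14 (Add (reg 14) (Const 1)))) (\<lambda>s'. \<exists>m'<m. Inv s' m')"
      proof (rule timed_Seq[OF Kstep[OF ib i(6) i(5) i(1) i(4)]])
        fix s3 assume s3: "K s3 (Suc i) \<and> (\<forall>r\<in>{0,14,15}. s3 r = s2 r)"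
        have "Inv (s3(14 := (s3 14)(0 := Suc i))) (b - Suc i)"
          unfolding Inv_def using s3 i ib Kreg by (intro exI[of _ "Suc i"]) simp
        moreover have "b - Suc i < m" using i ib by simp
        moreover have "Suc i < W" using ib bW by linarith
        ultimately show "timed W (setreg 14 (Add (reg 14) (Const 1))) s3 (max_cost (setreg 14 (Add (reg 14) (Const 1))))
            (\<lambda>s'. \<exists>m'<m. Inv s' m')"
          using s3 i W_bounds by (intro timed_run) auto
      qed
    qed
  next
    fix s2 assume "ev (Less (reg 14) b_exp) s2 = 0 \<and> (\<exists>m. Inv s2 m)"
    then show "K s2 b" unfolding Inv_def by (auto simp: p split: if_splits)
  qed
qed

lemma core_cong: "(\<And>a. a < 10 \<Longrightarrow> s' a = s a) \<Longrightarrow> core s' A = core s A"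
  unfolding core_def
  using out_ok_cong[of s' s A] in_ok_cong[of s' s A] good_cong[of s' s A] by (simp add: params_def)

text \<open>Each copy raises one out-degree by one, hence the bound \<open>d + b\<close>. The
  density cannot replace this count: while some copies of the edge are missing, the orientation need
  not be balanced.\<close>

lemma timed_insert:
  assumes C: "core s A" and uv: "s 0 2 = u" "s 0 3 = v" "u \<noteq> v" "u < n" "v < n" and lg: "n \<le> 2 ^ lg"
    and new: "{base u v..<base u v + b} \<inter> A = {}" and deg: "\<And>w. w < n \<Longrightarrow> s 3 w \<le> d"
  shows "timed W insert_cmd s (for_time b (max_cost insert_start + insert_chain_time b lg (d + b)))
     (\<lambda>s'. core s' (A \<union> {base u v..<base u v + b}) \<and> (\<forall>w<n. s' 3 w \<le> d + b))"
proof -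
  have P: "params s" using C by (simp add: core_def)
  define K where "K = (\<lambda>s' i. core s' (A \<union> {base u v..<base u v + i}) \<and> (\<forall>w<n. s' 3 w \<le> d + i))"
  have "timed W insert_cmd s (for_time b (max_cost insert_start + insert_chain_time b lg (d + b))) (\<lambda>s'. K s' b)"
    unfolding insert_cmd_def
  proof (rule timed_for_copies[OF P uv])
    show "K s' 0" if "\<forall>a. a \<noteq> 14 \<and> a \<noteq> 15 \<longrightarrow> s' a = s a" for s'
      using that C core_cong[of s' s A] deg by (simp add: K_def)
    show "K (s'(14 := f)) i" if "K s' i" for s' f i
      using that core_cong[of "s'(14 := f)" s'] by (simp add: K_def)
    fix s' i assume i: "i < b" and K: "K s' i" and s': "s' 0 = s 0" "s' 14 0 = i" "s' 15 0 = base u v"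
    define A' x where "A' = A \<union> {base u v..<base u v + i}" and "x = (if s' 3 v < s' 3 u then v else u)"
    have C': "core s' A'" and deg': "\<And>w. w < n \<Longrightarrow> s' 3 w \<le> d + i" using K by (auto simp: K_def A'_def)
    define s1 where "s1 = s'(10 := (s' 10)(0 := base u v + i), 11 := (s' 11)(0 := x), 12 := (s' 12)(0 := 1))"
    note ends = copy_ends[OF uv(3-5) i]
    have bW: "base u v + i < W" using base_less_W(3)[OF uv(4,5)] i by linarith
    have st: "timed W insert_start s' (max_cost insert_start) (\<lambda>s'. s' = s1)"
      by (rule timed_run) (use W_bounds bW in \<open>simp_all add: insert_start_def s1_def s' uv x_def\<close>)
    show "timed W (Seq insert_start (While (reg 12) insert_step)) s' (max_cost insert_start + insert_chain_time b lg (d + b))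
       (\<lambda>s''. K s'' (Suc i) \<and> (\<forall>r\<in>{0,14,15}. s'' r = s' r))"
    proof (rule timed_Seq[OF st])
      fix s2 assume s2: "s2 = s1"
      have C1: "core s1 A'" using C' core_cong[of s1 s'] by (simp add: s1_def)
      have "base u v + i \<in> {base u v..<base u v + b}" using i by simp
      then have "base u v + i \<notin> A" using new by blast
      then have cA: "base u v + i \<notin> A'" by (simp add: A'_def)
      have sum: "lo (base u v + i) + hi (base u v + i) = u + v" unfolding ends by (simp add: min_def max_def)
      have xor: "x = lo (base u v + i) \<or> x = hi (base u v + i)" unfolding ends by (auto simp: x_def min_def max_def)
      have "s' 3 x \<le> s' 3 (u + v - x)" by (auto simp: x_def)
      then have "Suc (s' 3 x) \<le> slack_bound b (s' 3 (u + v - x))"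
        using slack_bound_gt[of "s' 3 (u + v - x)" b] by linarith
      then have Q1: "pending s1 A'" using ends(4) cA xor by (simp add: pending_def s1_def sum)
      have A'': "insert (base u v + i) A' = A \<union> {base u v..<base u v + Suc i}" by (auto simp: A'_def)
      have "timed W (While (reg 12) insert_step) s1 (insert_chain_time b lg (d + i))
         (\<lambda>s''. core s'' (insert (s1 10 0) A') \<and> (\<forall>w<n. s'' 3 w \<le> Suc (d + i)) \<and> (\<forall>r\<in>{0,14,15}. s'' r = s1 r))"
        by (rule timed_insert_chain[OF C1 Q1 _ lg]) (use deg' in \<open>simp_all add: s1_def\<close>)
      then show "timed W (While (reg 12) insert_step) s2 (insert_chain_time b lg (d + b))
         (\<lambda>s''. K s'' (Suc i) \<and> (\<forall>r\<in>{0,14,15}. s'' r = s' r))"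
        unfolding s2
      proof (rule timed_weaken)
        show "insert_chain_time b lg (d + i) \<le> insert_chain_time b lg (d + b)"
          unfolding insert_chain_time_def using i chain_potential_mono[OF b0, of "d + i" "d + b"]
          by (intro mult_right_mono) simp_all
      qed (simp add: K_def s1_def A'')
    qed
  qed
  then show ?thesis by (simp add: K_def)
qed

lemma timed_delete:
  assumes C: "core s A" and uv: "s 0 2 = u" "s 0 3 = v" "u \<noteq> v" "u < n" "v < n" and lg: "n \<le> 2 ^ lg"
    and old: "{base u v..<base u v + b} \<subseteq> A" and deg: "\<And>w. w < n \<Longrightarrow> s 3 w \<le> d"
  shows "timed W delete_cmd s (for_time b (max_cost delete_start + delete_chain_time b lg d))
     (\<lambda>s'. core s' (A - {base u v..<base u v + b}) \<and> (\<forall>w<n. s' 3 w \<le> d))"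
proof -
  have P: "params s" using C by (simp add: core_def)
  define K where "K = (\<lambda>s' i. core s' (A - {base u v..<base u v + i}) \<and> (\<forall>w<n. s' 3 w \<le> d))"
  have "timed W delete_cmd s (for_time b (max_cost delete_start + delete_chain_time b lg d)) (\<lambda>s'. K s' b)"
    unfolding delete_cmd_def
  proof (rule timed_for_copies[OF P uv])
    show "K s' 0" if "\<forall>a. a \<noteq> 14 \<and> a \<noteq> 15 \<longrightarrow> s' a = s a" for s'
      using that C core_cong[of s' s A] deg by (simp add: K_def)
    show "K (s'(14 := f)) i" if "K s' i" for s' f i
      using that core_cong[of "s'(14 := f)" s'] by (simp add: K_def)
    fix s' i assume i: "i < b" and K: "K s' i" and s': "s' 0 = s 0" "s' 14 0 = i" "s' 15 0 = base u v"
    define A' c where "A' = A - {base u v..<base u v + i}" and "c = base u v + i"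
    have C': "core s' A'" and deg': "\<And>w. w < n \<Longrightarrow> s' 3 w \<le> d" using K by (auto simp: K_def A'_def)
    define s1 where "s1 = s'(10 := (s' 10)(0 := c), 12 := (s' 12)(0 := 1))"
    note ends = copy_ends[OF uv(3-5) i, folded c_def]
    have cA: "c \<in> A'" using old i by (auto simp: A'_def c_def)
    have bW: "base u v + i < W" using base_less_W(3)[OF uv(4,5)] i by linarith
    have C1: "core s1 A'" using C' core_cong[of s1 s'] by (simp add: s1_def)
    have insc: "insert c (A' - {c}) = A'" using cA by auto
    define T1 where "T1 = max_cost (setreg 10 (Add (reg 15) (reg 14))) + (max_cost (setreg 12 (Const 1)) + max_cost (remove_in 10))"
    \<comment> \<open>Taking the arc out of the bags keyed by head, while it keeps its slot in the
      bags keyed by tail, creates the hole.\<close>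
    have st: "timed W delete_start s' T1 (\<lambda>s2. hole s2 (A' - {c}) c \<and> s2 12 0 = 1 \<and> s2 3 = s' 3 \<and> (\<forall>r\<in>{0,14,15}. s2 r = s' r))"
      unfolding delete_start_def T1_def
    proof (rule timed_Seq, rule_tac [2] timed_Seq)
      show "timed W (setreg 10 (Add (reg 15) (reg 14))) s' (max_cost (setreg 10 (Add (reg 15) (reg 14))))
          (\<lambda>t. t = s'(10 := (s' 10)(0 := c)))"
        by (rule timed_run) (use W_bounds bW in \<open>simp_all add: s' c_def\<close>)
      show "timed W (setreg 12 (Const 1)) t (max_cost (setreg 12 (Const 1))) (\<lambda>t. t = s1)"
        if "t = s'(10 := (s' 10)(0 := c))" for t
        unfolding that by (rule timed_run) (use W_bounds in \<open>simp_all add: s1_def\<close>)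
      fix t assume t: "t = s1"
      have in1: "in_ok s1 A'" and P1: "params s1" using C1 by (auto simp: core_def)
      have "timed W (remove_in 10) s1 (max_cost (remove_in 10)) (\<lambda>s2. in_ok s2 (A' - {s1 10 0}) \<and>
         (\<forall>a. a \<notin> {6,7,8,30,31} \<longrightarrow> s2 a = s1 a))"
        by (rule timed_remove_in[OF P1 in1]) (use cA in \<open>simp_all add: s1_def\<close>)
      then show "timed W (remove_in 10) t (max_cost (remove_in 10))
         (\<lambda>s2. hole s2 (A' - {c}) c \<and> s2 12 0 = 1 \<and> s2 3 = s' 3 \<and> (\<forall>r\<in>{0,14,15}. s2 r = s' r))"
        unfolding t
      proof (rule timed_weaken)
        fix s2 assume s2: "in_ok s2 (A' - {s1 10 0}) \<and> (\<forall>a. a \<notin> {6,7,8,30,31} \<longrightarrow> s2 a = s1 a)"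
        have f: "s2 a = s1 a" if "a \<notin> {6,7,8,30,31}" for a using s2 that by blast
        have "params s2" using P1 f[of 0] by (simp add: params_def)
        moreover have "tails_ok s2 (A' - {c})"
          using C1 f[of 1] unfolding core_def out_ok_def tails_ok_def by auto
        moreover have "bags M n (s2 2) (s2 3) (s2 4) (s2 1) (insert c (A' - {c}))"
          using C1 f[of 1] f[of 2] f[of 3] f[of 4] unfolding core_def out_ok_def insc by simp
        moreover have "good s2 (A' - {c})"
        proof -
          have "good s1 (A' - {c})" using C1 unfolding core_def good_def by blast
          then show ?thesis using good_cong[of s2 s1 "A' - {c}"] f[of 1] f[of 3] f[of 4] f[of 5] by simp
        qed
        moreover have "s2 10 0 = c" "s2 12 0 = 1" "s2 3 = s' 3" "\<forall>r\<in>{0,14,15}. s2 r = s' r"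
          using f by (simp_all add: s1_def)
        ultimately show "hole s2 (A' - {c}) c \<and> s2 12 0 = 1 \<and> s2 3 = s' 3 \<and> (\<forall>r\<in>{0,14,15}. s2 r = s' r)"
          using s2 ends(4) by (simp add: hole_def s1_def)
      qed simp
    qed
    have st': "timed W delete_start s' (max_cost delete_start)
        (\<lambda>s2. hole s2 (A' - {c}) c \<and> s2 12 0 = 1 \<and> s2 3 = s' 3 \<and> (\<forall>r\<in>{0,14,15}. s2 r = s' r))"
      by (rule timed_weaken[OF st]) (simp_all add: T1_def delete_start_def)
    show "timed W (Seq delete_start (While (reg 12) delete_step)) s' (max_cost delete_start + delete_chain_time b lg d)
       (\<lambda>s''. K s'' (Suc i) \<and> (\<forall>r\<in>{0,14,15}. s'' r = s' r))"
    proof (rule timed_Seq[OF st'])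
      fix s2 assume s2: "hole s2 (A' - {c}) c \<and> s2 12 0 = 1 \<and> s2 3 = s' 3 \<and> (\<forall>r\<in>{0,14,15}. s2 r = s' r)"
      have A'': "A' - {c} = A - {base u v..<base u v + Suc i}" by (auto simp: A'_def c_def)
      show "timed W (While (reg 12) delete_step) s2 (delete_chain_time b lg d)
         (\<lambda>s''. K s'' (Suc i) \<and> (\<forall>r\<in>{0,14,15}. s'' r = s' r))"
        by (rule timed_weaken[OF timed_delete_chain[of s2 "A' - {c}" c lg d]])
          (use s2 deg' lg in \<open>simp_all add: K_def A''\<close>)
    qed
  qed
  then show ?thesis by (simp add: K_def)
qed

end

section \<open>The maintained orientation\<close>

text \<open>An edge directed out of \<open>u\<close> has no majority of copies towards
  \<open>u\<close>, so at least half of its \<open>b\<close> copies leave \<open>u\<close>, however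
  ties are broken.\<close>

lemma induced_outdegree_le:
  assumes D: "orientation_of_power V E b D" and H: "induced_orientation V E D H"
    and E: "finite E" "\<And>e. e \<in> E \<Longrightarrow> card e = 2"
  shows "b * out_degree H u \<le> 2 * out_degree D u"
proof -
  have Da: "arcs D = E \<times> {..<b}" and De: "\<And>e i. e \<in> E \<Longrightarrow> i < b \<Longrightarrow> {tail D (e, i), head D (e, i)} = e"
    using D by (auto simp: orientation_of_power_def orientation_of_def)
  have Ha: "arcs H = E" and He: "\<And>e. e \<in> E \<Longrightarrow> {tail H e, head H e} = e"
    and Hm: "\<And>x y. {x, y} \<in> E \<Longrightarrow> copies D x y > copies D y x \<Longrightarrow> arc_to_ends H {x, y} = (x, y)"
    using H by (auto simp: induced_orientation_def orientation_of_def)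
  have cop: "copies D x y = card {i. i < b \<and> tail D ({x, y}, i) = x}" if xy: "{x, y} \<in> E" for x y
  proof -
    have ne: "x \<noteq> y" using E(2)[OF xy] by auto
    have "{a \<in> arcs D. arc_to_ends D a = (x, y)} = (\<lambda>i. ({x, y}, i)) ` {i. i < b \<and> tail D ({x, y}, i) = x}"
    proof (intro set_eqI iffI)
      fix a assume a: "a \<in> {a \<in> arcs D. arc_to_ends D a = (x, y)}"
      obtain e i where ei: "a = (e, i)" by (cases a)
      have "{tail D (e, i), head D (e, i)} = e" using a ei Da De by auto
      then have "e = {x, y}" using a ei by (auto simp: arc_to_ends_def)
      then show "a \<in> (\<lambda>i. ({x, y}, i)) ` {i. i < b \<and> tail D ({x, y}, i) = x}"
        using a ei Da by (auto simp: arc_to_ends_def)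
    next
      fix a assume "a \<in> (\<lambda>i. ({x, y}, i)) ` {i. i < b \<and> tail D ({x, y}, i) = x}"
      then obtain i where i: "a = ({x, y}, i)" "i < b" "tail D ({x, y}, i) = x" by auto
      then have "{x, head D ({x, y}, i)} = {x, y}" using De[OF xy i(2)] by simp
      then have "head D ({x, y}, i) = y" using ne by (auto simp: doubleton_eq_iff)
      then show "a \<in> {a \<in> arcs D. arc_to_ends D a = (x, y)}"
        using i xy Da by (auto simp: arc_to_ends_def)
    qed
    then show ?thesis by (simp add: copies_def card_image inj_on_def)
  qed
  define Hu where "Hu = {e \<in> E. tail H e = u}"
  define S where "S = (\<lambda>e. {i. i < b \<and> tail D (e, i) = u})"
  have finHu: "finite Hu" using E by (simp add: Hu_def)
  have finS: "finite (S e)" for e by (simp add: S_def)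
  have half: "b \<le> 2 * card (S e)" if e: "e \<in> Hu" for e
  proof -
    define w where "w = head H e"
    have eE: "e \<in> E" and euw: "e = {u, w}" using e He[of e] by (auto simp: Hu_def w_def)
    have ne: "u \<noteq> w" using E(2)[OF eE] euw by auto
    have uw: "{u, w} \<in> E" "{w, u} \<in> E" using eE euw by (auto simp: insert_commute)
    have "\<not> copies D w u > copies D u w"
    proof
      assume "copies D w u > copies D u w"
      from Hm[OF uw(2) this] have "tail H {w, u} = w" by (simp add: arc_to_ends_def)
      moreover have "{w, u} = e" using euw by auto
      ultimately show False using e ne by (simp add: Hu_def)
    qed
    then have le: "copies D w u \<le> copies D u w" by simp
    have c1: "copies D u w = card (S e)" using cop[OF uw(1)] by (simp add: S_def euw)
    have c2: "copies D w u = card {i. i < b \<and> tail D (e, i) = w}"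
      using cop[OF uw(2)] by (simp add: euw insert_commute)
    have "{..<b} \<subseteq> S e \<union> {i. i < b \<and> tail D (e, i) = w}"
      using De[OF eE] euw by (auto simp: S_def)
    then have "card {..<b} \<le> card (S e \<union> {i. i < b \<and> tail D (e, i) = w})"
      using finS by (intro card_mono) auto
    also have "\<dots> \<le> card (S e) + card {i. i < b \<and> tail D (e, i) = w}" by (rule card_Un_le)
    finally show ?thesis using le c1 c2 by simp
  qed
  have "b * card Hu = (\<Sum>e\<in>Hu. b)" by simp
  also have "\<dots> \<le> (\<Sum>e\<in>Hu. 2 * card (S e))" by (intro sum_mono half)
  also have "\<dots> = 2 * card (SIGMA e:Hu. S e)" using finHu finS by (simp add: card_SigmaI sum_distrib_left)
  also have "\<dots> \<le> 2 * card {a \<in> arcs D. tail D a = u}"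
    using E by (intro mult_left_mono card_mono) (auto simp: Da S_def Hu_def)
  finally show ?thesis by (simp add: out_degree_def out_arcs_def Ha Hu_def)
qed

text \<open>The sum lets one bound cover both kinds of update.\<close>

definition update_time :: "nat \<Rightarrow> nat \<Rightarrow> nat \<Rightarrow> nat" where
  "update_time b lg d = for_time b (max_cost insert_start + insert_chain_time b lg d) +
     for_time b (max_cost delete_start + delete_chain_time b lg d)"

definition simple_edges :: "nat \<Rightarrow> nat set set \<Rightarrow> bool" where
  "simple_edges n E \<longleftrightarrow> (\<forall>e\<in>E. \<exists>u v. e = {u, v} \<and> u < v \<and> v < n)"

lemma simple_edges_props:
  assumes "simple_edges n E"
  shows "finite E" "e \<in> E \<Longrightarrow> card e = 2" "e \<in> E \<Longrightarrow> e = {Min e, Max e} \<and> Min e < Max e \<and> Max e < n"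
proof -
  have "E \<subseteq> Pow {..<n}" using assms by (fastforce simp: simple_edges_def)
  then show "finite E" by (rule finite_subset) simp
  show "e \<in> E \<Longrightarrow> card e = 2" using assms by (fastforce simp: simple_edges_def)
  assume "e \<in> E"
  then obtain u v where "e = {u, v}" "u < v" "v < n" using assms by (auto simp: simple_edges_def)
  then show "e = {Min e, Max e} \<and> Min e < Max e \<and> Max e < n" by (simp add: min_def max_def)
qed

lemma simple_edges_update:
  assumes "simple_edges n E" "admissible n E u" shows "simple_edges n (apply_update u E)"
proof (cases u)
  case (Insert x y)
  have "\<exists>u v. {x, y} = {u, v} \<and> u < v \<and> v < n"
  proof (cases "x < y")
    case True then show ?thesis using assms(2) Insert by auto
  next
    case False
    then have "{x, y} = {y, x} \<and> y < x \<and> x < n" using assms(2) Insert by auto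
    then show ?thesis by blast
  qed
  then show ?thesis using assms(1) Insert by (simp add: simple_edges_def)
next
  case (Delete x y)
  then show ?thesis using assms(1) by (auto simp: simple_edges_def)
qed

context ram begin

definition ids_of :: "nat set set \<Rightarrow> nat set" where
  "ids_of E = {a \<in> ids. {lo a, hi a} \<in> E}"

lemma copies_of_edge:
  assumes "u \<noteq> v" "u < n" "v < n"
  shows "ids_of {{u, v}} = {base u v..<base u v + b}"
proof (intro set_eqI iffI)
  fix a assume "a \<in> ids_of {{u, v}}"
  then have a: "lo a < hi a" "{lo a, hi a} = {u, v}" by (auto simp: ids_of_def ids_def)
  then have "lo a = min u v" "hi a = max u v" by (auto simp: doubleton_eq_iff)
  then have "a = base u v + a mod b" using id_eq[of a] by (simp add: base_def)
  moreover have "a mod b < b" using b0 by simp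
  ultimately show "a \<in> {base u v..<base u v + b}" by (metis atLeastLessThan_iff le_add1 nat_add_left_cancel_less)
next
  fix a assume "a \<in> {base u v..<base u v + b}"
  then obtain i where i: "a = base u v + i" "i < b" using le_Suc_ex by fastforce
  show "a \<in> ids_of {{u, v}}"
    using copy_ends[OF assms i(2)] unfolding i(1) ids_of_def by (auto simp: min_def max_def)
qed

lemma core_initial: "core (initial_memory W n b) {}"
proof -
  have "n < W" "b < W" using M_bounds W_bounds n by linarith+
  then show ?thesis using M_bounds
    by (simp add: core_def params_def out_ok_def in_ok_def good_def tails_ok_def bags_def initial_memory_def store_def)
qed

lemma bounded_initial: "bounded_memory W (initial_memory W n b)"
  using W_bounds by (simp add: bounded_memory_def initial_memory_def store_def)

lemma update_step:
  assumes s: "bounded_memory W s" and C: "core s (ids_of E)" and E: "simple_edges n E"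
    and adm: "admissible n E u" and lg: "n \<le> 2 ^ lg" and deg: "\<And>w. w < n \<Longrightarrow> s 3 w \<le> d"
  shows "\<exists>t s'. exec_update W insert_cmd delete_cmd u s t s' \<and> t \<le> update_time b lg (d + b) \<and>
    bounded_memory W s' \<and> core s' (ids_of (apply_update u E))"
proof (cases u)
  case (Insert x y)
  define s1 where "s1 = store W 0 3 y (store W 0 2 x s)"
  have xy: "x \<noteq> y" "x < n" "y < n" "{x, y} \<notin> E" using adm Insert by auto
  have xyW: "x < W" "y < W" using xy M_bounds W_bounds by linarith+
  have C1: "core s1 (ids_of E)"
    using C by (simp add: s1_def core_def params_def out_ok_def in_ok_def good_def tails_ok_def est_def hd_of_def store_def)
  have b1: "bounded_memory W s1" using s W_bounds by (simp add: s1_def bounded_memory_def store_def)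
  have "{base x y..<base x y + b} \<inter> ids_of E = {}"
    using xy unfolding copies_of_edge[OF xy(1-3), symmetric] by (auto simp: ids_of_def)
  moreover have "ids_of (insert {x, y} E) = ids_of E \<union> {base x y..<base x y + b}"
    unfolding copies_of_edge[OF xy(1-3), symmetric] by (auto simp: ids_of_def)
  ultimately obtain t s' where "exec W insert_cmd s1 t s'"
    "t \<le> for_time b (max_cost insert_start + insert_chain_time b lg (d + b))" "bounded_memory W s'"
    "core s' (ids_of (insert {x, y} E))"
    using timed_insert[OF C1 _ _ xy(1-3) lg, of d] deg b1 xyW unfolding timed_def
    by (auto simp: s1_def store_def)
  then show ?thesis by (auto simp: Insert s1_def update_time_def intro!: exI[of _ t] exI[of _ s'])
next
  case (Delete x y)
  define s1 where "s1 = store W 0 3 y (store W 0 2 x s)"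
  have xyE: "{x, y} \<in> E" using adm Delete by auto
  then obtain p q where pq: "{x, y} = {p, q}" "p < q" "q < n" using E by (auto simp: simple_edges_def)
  then have xy: "x \<noteq> y" "x < n" "y < n" by (auto simp: doubleton_eq_iff)
  have xyW: "x < W" "y < W" using xy M_bounds W_bounds by linarith+
  have C1: "core s1 (ids_of E)"
    using C by (simp add: s1_def core_def params_def out_ok_def in_ok_def good_def tails_ok_def est_def hd_of_def store_def)
  have b1: "bounded_memory W s1" using s W_bounds by (simp add: s1_def bounded_memory_def store_def)
  have "{base x y..<base x y + b} \<subseteq> ids_of E"
    using xyE unfolding copies_of_edge[OF xy, symmetric] by (auto simp: ids_of_def)
  moreover have "ids_of (E - {{x, y}}) = ids_of E - {base x y..<base x y + b}"
    unfolding copies_of_edge[OF xy, symmetric] by (auto simp: ids_of_def)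
  \<comment> \<open>A deletion does not raise the degree bound \<open>d\<close>; the looser
    \<open>d + b\<close> fits the bound shared with insertions.\<close>
  moreover have "s1 3 w \<le> d + b" if "w < n" for w using deg[OF that] by (simp add: s1_def store_def)
  ultimately obtain t s' where "exec W delete_cmd s1 t s'"
    "t \<le> for_time b (max_cost delete_start + delete_chain_time b lg (d + b))" "bounded_memory W s'"
    "core s' (ids_of (E - {{x, y}}))"
    using timed_delete[OF C1 _ _ xy lg, of "d + b"] b1 xyW unfolding timed_def
    by (auto simp: s1_def store_def)
  then show ?thesis by (auto simp: Delete s1_def update_time_def intro!: exI[of _ t] exI[of _ s'])
qed

definition orientation :: "memory \<Rightarrow> nat set set \<Rightarrow> (nat, nat set \<times> nat) pre_digraph" where
  "orientation s E = \<lparr>verts = {..<n}, arcs = E \<times> {..<b},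
     tail = (\<lambda>(e, i). s 1 ((Min e * n + Max e) * b + i)),
     head = (\<lambda>(e, i). hd_of s ((Min e * n + Max e) * b + i))\<rparr>"

definition code :: "nat set \<times> nat \<Rightarrow> nat" where
  "code a = (Min (fst a) * n + Max (fst a)) * b + snd a"

lemma code_props:
  assumes E: "simple_edges n E"
  shows "inj_on code (E \<times> {..<b})" "code ` (E \<times> {..<b}) = ids_of E"
    "\<And>a. a \<in> E \<times> {..<b} \<Longrightarrow> fst a = {lo (code a), hi (code a)}"
proof -
  have code: "lo (code (e, i)) = Min e" "hi (code (e, i)) = Max e" "code (e, i) mod b = i" "code (e, i) \<in> ids"
    "e = {lo (code (e, i)), hi (code (e, i))}"
    if "e \<in> E" "i < b" for e i
  proof -
    note m = simple_edges_props(3)[OF E that(1)]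
    have "code (e, i) = base (Min e) (Max e) + i" using m by (simp add: code_def base_def min_def max_def)
    then show 1: "lo (code (e, i)) = Min e" "hi (code (e, i)) = Max e" "code (e, i) mod b = i" "code (e, i) \<in> ids"
      using copy_ends[of "Min e" "Max e" i] m that(2) by auto
    show "e = {lo (code (e, i)), hi (code (e, i))}" unfolding 1 using m by blast
  qed
  show "fst a = {lo (code a), hi (code a)}" if "a \<in> E \<times> {..<b}" for a
    using code(5)[of "fst a" "snd a"] that by auto
  show "inj_on code (E \<times> {..<b})"
  proof (rule inj_onI)
    fix a a' assume a: "a \<in> E \<times> {..<b}" "a' \<in> E \<times> {..<b}" and eq: "code a = code a'"
    obtain e i e' i' where s: "a = (e, i)" "a' = (e', i')" by (cases a, cases a')
    show "a = a'" using code(3,5)[of e i] code(3,5)[of e' i'] a eq by (auto simp: s)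
  qed
  show "code ` (E \<times> {..<b}) = ids_of E"
  proof (intro set_eqI iffI)
    fix x assume "x \<in> code ` (E \<times> {..<b})"
    then obtain e i where x: "x = code (e, i)" "e \<in> E" "i < b" by auto
    then show "x \<in> ids_of E" using code(4,5)[OF x(2,3)] by (simp add: ids_of_def)
  next
    fix x assume x: "x \<in> ids_of E"
    define e where "e = {lo x, hi x}"
    have lh: "lo x < hi x" and eE: "e \<in> E" using x by (auto simp: ids_of_def ids_def e_def)
    have "code (e, x mod b) = x" using lh id_eq[of x] by (simp add: code_def e_def min_def max_def)
    moreover have "x mod b < b" using b0 by simp
    ultimately show "x \<in> code ` (E \<times> {..<b})" using eE by (metis SigmaI image_eqI lessThan_iff)
  qed
qed

lemma orientation_props:
  assumes C: "core s (ids_of E)" and E: "simple_edges n E"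
  shows orientation_valid: "orientation_of_power {..<n} E b (orientation s E)"
    and orientation_stored: "stores_orientation n b s (orientation s E)"
    and orientation_out_degree: "v < n \<Longrightarrow> out_degree (orientation s E) v = s 3 v"
    and orientation_balanced: "a \<in> arcs (orientation s E) \<Longrightarrow>
      real (out_degree (orientation s E) (tail (orientation s E) a))
      \<le> (1 + 3 / real b) * real (out_degree (orientation s E) (head (orientation s E) a))"
    and orientation_sparse: "n \<le> 2 ^ m \<Longrightarrow> v < n \<Longrightarrow>
      real (s 3 v) \<le> 2 * (1 + 3 / real b) ^ m * (real b * max_density {..<n} E)"
proof -
  define A where "A = ids_of E"
  have O: "out_ok s A" and G: "good s A" and T: "tails_ok s A" and B: "bags M n (s 2) (s 3) (s 4) (s 1) A"
    using C by (auto simp: core_def A_def out_ok_def)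
  have finA: "finite A" by (rule finite_subset[OF _ finite_ids]) (auto simp: A_def ids_of_def)
  note cp = code_props[OF E, folded A_def]
  have tl: "tail (orientation s E) a = s 1 (code a)" and hd: "head (orientation s E) a = hd_of s (code a)" for a
    by (simp_all add: orientation_def code_def split: prod.splits)
  have ends: "{s 1 x, hd_of s x} = {lo x, hi x}" if "x \<in> A" for x
    using T that ids_bounds[of x] by (auto simp: tails_ok_def hd_of_def)
  have cA: "code a \<in> A" if "a \<in> E \<times> {..<b}" for a using cp(2) that by blast
  show "orientation_of_power {..<n} E b (orientation s E)"
    unfolding orientation_of_power_def orientation_of_def
  proof (intro conjI ballI)
    fix a assume a: "a \<in> E \<times> {..<b}"
    show "{tail (orientation s E) a, head (orientation s E) a} = fst a"
      unfolding tl hd ends[OF cA[OF a]] by (rule cp(3)[OF a, symmetric])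
  qed (simp_all add: orientation_def)
  show "stores_orientation n b s (orientation s E)"
    by (simp add: stores_orientation_def orientation_def)
  have cnt: "s 3 v = card {a \<in> A. s 1 a = v}" if "v < n" for v using bags_cnt[OF B that] .
  show od: "out_degree (orientation s E) v = s 3 v" if "v < n" for v
  proof -
    have "{x \<in> A. s 1 x = v} = code ` {a \<in> E \<times> {..<b}. s 1 (code a) = v}"
      unfolding cp(2)[symmetric] by auto
    moreover have "card (code ` {a \<in> E \<times> {..<b}. s 1 (code a) = v}) = card {a \<in> E \<times> {..<b}. s 1 (code a) = v}"
      by (rule card_image) (auto intro: inj_on_subset[OF cp(1)])
    moreover have "out_arcs (orientation s E) v = {a \<in> E \<times> {..<b}. s 1 (code a) = v}"
      unfolding out_arcs_def tl by (simp add: orientation_def)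
    ultimately show ?thesis using cnt[OF that] by (simp add: out_degree_def)
  qed
  have bal: "real (s 3 (s 1 x)) \<le> (1 + 3 / real b) * real (s 3 (hd_of s x))" if x: "x \<in> A" for x
  proof (rule fresh_valid[OF b])
    note tx = tailsD[OF T x]
    have xE: "{lo x, hi x} \<in> E" using x by (simp add: A_def ids_of_def)
    have eq: "{s 1 x, hd_of s x} = {lo x, hi x}" by (rule ends[OF x])
    \<comment> \<open>Each of the \<open>b\<close> copies of the edge leaves one of its two ends, so
      the degrees of the ends sum to at least \<open>b\<close>, as \<open>fresh_valid\<close>
      demands.\<close>
    have "ids_of {{s 1 x, hd_of s x}} \<subseteq> {a \<in> A. s 1 a = s 1 x} \<union> {a \<in> A. s 1 a = hd_of s x}"
    proof
      fix y assume "y \<in> ids_of {{s 1 x, hd_of s x}}"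
      then have y: "y \<in> ids" "{lo y, hi y} = {s 1 x, hd_of s x}" by (auto simp: ids_of_def)
      then have yA: "y \<in> A" using xE eq by (simp add: A_def ids_of_def)
      have "s 1 y \<in> {s 1 x, hd_of s x}" using ends[OF yA] y(2) by blast
      then show "y \<in> {a \<in> A. s 1 a = s 1 x} \<union> {a \<in> A. s 1 a = hd_of s x}" using yA by blast
    qed
    then have "card (ids_of {{s 1 x, hd_of s x}}) \<le> card ({a \<in> A. s 1 a = s 1 x} \<union> {a \<in> A. s 1 a = hd_of s x})"
      using finA by (intro card_mono) auto
    also have "\<dots> \<le> card {a \<in> A. s 1 a = s 1 x} + card {a \<in> A. s 1 a = hd_of s x}" by (rule card_Un_le)
    also have "\<dots> = s 3 (s 1 x) + s 3 (hd_of s x)" using cnt tx by simp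
    finally show "b \<le> s 3 (s 1 x) + s 3 (hd_of s x)" unfolding copies_of_edge[OF tx(4,2,3)] by simp
    show "est s x \<le> slack_bound b (s 3 (hd_of s x))" "fresh b (s 4 x) (est s x) (s 3 (s 1 x))"
      using G x by (auto simp: good_def)
  qed
  show "real (out_degree (orientation s E) (tail (orientation s E) a))
      \<le> (1 + 3 / real b) * real (out_degree (orientation s E) (head (orientation s E) a))"
    if "a \<in> arcs (orientation s E)" for a
  proof -
    have ca: "code a \<in> A" by (rule cA) (use that in \<open>simp add: orientation_def\<close>)
    show ?thesis unfolding tl hd using bal[OF ca] od tailsD(2,3)[OF T ca] by simp
  qed
  show "real (s 3 v) \<le> 2 * (1 + 3 / real b) ^ m * (real b * max_density {..<n} E)" if m: "n \<le> 2 ^ m" and v: "v < n" for m v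
  proof -
    have "real (card {a \<in> A. s 1 a = v}) \<le> 2 * (1 + 3 / real b) ^ m * (real b * max_density {..<n} E)"
    proof (rule outdegree_le_density[where hd = "hd_of s" and V = "{..<n}"])
      show "real (card {x \<in> A. s 1 x = s 1 a}) \<le> (1 + 3 / real b) * real (card {x \<in> A. s 1 x = hd_of s a})"
        if "a \<in> A" for a
        using bal[OF that] cnt[OF tailsD(2)[OF T that]] cnt[OF tailsD(3)[OF T that]] by simp
      fix U :: "nat set" assume U: "U \<subseteq> {..<n}" "U \<noteq> {}"
      define F where "F = {e \<in> E. e \<subseteq> U}"
      have finF: "finite F" and finE: "finite E" using simple_edges_props(1)[OF E] by (auto simp: F_def)
      \<comment> \<open>An edge inside \<open>U\<close> accounts for at most \<open>b\<close> arcs,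
        told apart by copy number; thus the density of the multigraph is at most \<open>b\<close>
        times that of the graph.\<close>
      have "inj_on (\<lambda>a. ({lo a, hi a}, a mod b)) {a \<in> A. s 1 a \<in> U \<and> hd_of s a \<in> U}"
      proof (rule inj_onI)
        fix x y assume x: "x \<in> {a \<in> A. s 1 a \<in> U \<and> hd_of s a \<in> U}" and y: "y \<in> {a \<in> A. s 1 a \<in> U \<and> hd_of s a \<in> U}"
          and eq: "({lo x, hi x}, x mod b) = ({lo y, hi y}, y mod b)"
        have "lo x < hi x" "lo y < hi y" using x y tailsD(1)[OF T] ids_bounds(3) by auto
        then have "lo x = lo y" "hi x = hi y" using eq by (auto simp: doubleton_eq_iff)
        then show "x = y" using eq id_eq[of x] id_eq[of y] by simp
      qed
      moreover have "(\<lambda>a. ({lo a, hi a}, a mod b)) ` {a \<in> A. s 1 a \<in> U \<and> hd_of s a \<in> U} \<subseteq> F \<times> {..<b}"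
      proof (rule image_subsetI)
        fix a assume a: "a \<in> {a \<in> A. s 1 a \<in> U \<and> hd_of s a \<in> U}"
        then have "{s 1 a, hd_of s a} \<subseteq> U" and aA: "a \<in> A" by auto
        then have "{lo a, hi a} \<subseteq> U" unfolding ends[OF aA] by blast
        then show "({lo a, hi a}, a mod b) \<in> F \<times> {..<b}" using a b0 by (auto simp: F_def A_def ids_of_def)
      qed
      ultimately have "card {a \<in> A. s 1 a \<in> U \<and> hd_of s a \<in> U} \<le> card (F \<times> {..<b})"
        using finF by (intro card_inj_on_le) auto
      then have "real (card {a \<in> A. s 1 a \<in> U \<and> hd_of s a \<in> U}) \<le> real (card F * b)"
        by (intro of_nat_mono) (simp add: card_cartesian_product)
      moreover have "real (card F) \<le> max_density {..<n} E * real (card U)"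
      proof -
        have "real (card F) / real (card U) \<le> max_density {..<n} E"
          using U n by (intro max_density_ge[OF _ _ finE]) (auto simp: F_def)
        moreover have "card U > 0" using U finite_subset by (auto simp: card_gt_0_iff)
        ultimately show ?thesis by (simp add: field_simps)
      qed
      then have "real (card F) * real b \<le> max_density {..<n} E * real (card U) * real b"
        by (rule mult_right_mono) simp
      ultimately show "real (card {a \<in> A. s 1 a \<in> U \<and> hd_of s a \<in> U}) \<le> real b * max_density {..<n} E * real (card U)"
        by (simp add: mult_ac)
    qed (use finA b0 tailsD(2,3)[OF T] m v in auto)
    then show ?thesis using cnt[OF v] by simp
  qed
qed

end

section \<open>Running time and word size\<close>

lemma linear_in_sum:
  fixes b lg x y :: nat
  assumes "b \<ge> 1"
  shows "x \<le> x * (b + lg)" "Suc lg * y \<le> 2 * y * (b + lg)" "Suc (8 * b) * y \<le> 9 * y * (b + lg)"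
proof -
  have "x * 1 \<le> x * (b + lg)" using assms by (intro mult_left_mono) auto
  then show "x \<le> x * (b + lg)" by simp
  have "Suc lg * y \<le> (b + lg) * y" using assms by (intro mult_right_mono) auto
  also have "\<dots> \<le> (2 * (b + lg)) * y" by (intro mult_right_mono) auto
  finally show "Suc lg * y \<le> 2 * y * (b + lg)" by (simp add: mult_ac)
  have "Suc (8 * b) * y \<le> (9 * (b + lg)) * y" using assms by (intro mult_right_mono) auto
  then show "Suc (8 * b) * y \<le> 9 * y * (b + lg)" by (simp add: mult_ac)
qed

text \<open>All costs are fixed by the program text. They are grouped into constant work
  \<open>x\<close>, the doublings for the step \<open>y\<close>, at most \<open>lg\<close> of them,
  and the loops \<open>z\<close> of at most \<open>8 * b\<close> rounds.\<close>

lemma insert_step_time_linear: "\<exists>K. \<forall>b lg. b \<ge> 1 \<longrightarrow> insert_step_time b lg + cost (reg 12) + 1 \<le> K * (b + lg)"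
proof -
  define x where "x = max_cost prepare_scan + max_cost (setreg 21 (Const 1)) + max_cost (setreg 23 (Const 0)) +
     max_cost (setreg 22 (Mod (reg 20) (reg 21))) + cost (reg 23) + 1 + passed_time +
     max_cost (push_cmd 2 3 4 1 10 11) + max_cost (add_in 10 20) + max_cost (setreg 26 (reg 20)) +
     max_cost (setreg 22 (Mod (reg 20) (reg 21))) + max_cost (setreg 12 (Const 0)) + cost (reg 12) + 1"
  define y where "y = max_cost (setreg 21 (Add (reg 21) (reg 21))) +
       cost (Less (Mul (Mul (Const 8) b_exp) (reg 21)) (Add (reg 20) (Const 1))) + 1"
  define z where "z = max_cost scan_body + cost scan_cond + 1 + (max_cost refresh_body + cost (Less (reg 22) (reg 13)) + 1)"
  have "insert_step_time b lg + cost (reg 12) + 1 \<le> (x + 2 * y + 9 * z) * (b + lg)" if "b \<ge> 1" for b lg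
  proof -
    have "insert_step_time b lg + cost (reg 12) + 1 = x + Suc lg * y + Suc (8 * b) * z"
      unfolding insert_step_time_def step_time_def scan_time_def settled_time_def refresh_time_def x_def y_def z_def
      by (simp only: distrib_left add.assoc add.commute add.left_commute)
    also have "\<dots> \<le> x * (b + lg) + 2 * y * (b + lg) + 9 * z * (b + lg)"
      by (intro add_mono linear_in_sum that)
    finally show ?thesis by (simp only: distrib_right)
  qed
  then show ?thesis by blast
qed

lemma delete_step_time_linear: "\<exists>K. \<forall>b lg. b \<ge> 1 \<longrightarrow> delete_step_time b lg + cost (reg 12) + 1 \<le> K * (b + lg)"
proof -
  define x where "x = max_cost find_violation + cost (Read 7 (reg 28)) + 1 + moved_time +
     max_cost (remove_cmd 2 3 4 1 10) + max_cost prepare_move +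
     cost (Less (reg 22) (reg 13)) + 1 + max_cost (setreg 24 out_arc_exp) + max_cost (refresh_arc 24 26) +
     max_cost (setreg 21 (Const 1)) +
     max_cost (setreg 22 (Mod (reg 20) (reg 21))) + max_cost (setreg 12 (Const 0)) + cost (reg 12) + 1"
  define y where "y = max_cost (setreg 21 (Add (reg 21) (reg 21))) +
       cost (Less (Mul (Mul (Const 8) b_exp) (reg 21)) (Add (reg 20) (Const 1))) + 1"
  define z where "z = max_cost refresh_body + cost (Less (reg 22) (reg 13)) + 1"
  have "delete_step_time b lg + cost (reg 12) + 1 \<le> (x + 2 * y + 9 * z) * (b + lg)" if "b \<ge> 1" for b lg
  proof -
    have "delete_step_time b lg + cost (reg 12) + 1 = x + Suc lg * y + Suc (8 * b) * z"
      unfolding delete_step_time_def dropped_time_def step_time_def refresh_time_def x_def y_def z_def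
      by (simp only: distrib_left add.assoc add.commute add.left_commute)
    also have "\<dots> \<le> x * (b + lg) + 2 * y * (b + lg) + 9 * z * (b + lg)"
      by (intro add_mono linear_in_sum that)
    finally show ?thesis by (simp only: distrib_right)
  qed
  then show ?thesis by blast
qed

lemma for_time_bound:
  assumes b: "b \<ge> 1" and T: "T \<le> c + Suc (Suc m) * (K * (b + lg))"
  shows "for_time b T \<le>
    (max_cost (Seq base_cmd (setreg 14 (Const 0))) +
     2 * (c + K + max_cost (setreg 14 (Add (reg 14) (Const 1))) + cost (Less (reg 14) b_exp) + 1)) *
    (b * Suc (Suc m) * (b + lg))"
proof -
  define a0 c0 P where "a0 = max_cost (Seq base_cmd (setreg 14 (Const 0)))"
    and "c0 = max_cost (setreg 14 (Add (reg 14) (Const 1))) + cost (Less (reg 14) b_exp) + 1"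
    and "P = Suc (Suc m) * (b + lg)"
  have P: "P \<ge> 1" using b by (simp add: P_def)
  have bP: "1 \<le> b * P" using b P by simp
  have "for_time b T = a0 + Suc b * (T + c0)"
    by (simp add: for_time_def a0_def c0_def)
  also have "\<dots> \<le> a0 * (b * P) + (2 * b) * ((c + K + c0) * P)"
  proof (intro add_mono mult_mono)
    show "a0 \<le> a0 * (b * P)" using bP by simp
    have "c + c0 \<le> (c + c0) * P" using P by simp
    moreover have "T \<le> c + K * P" using T by (simp add: P_def mult_ac)
    ultimately show "T + c0 \<le> (c + K + c0) * P" by (simp add: distrib_right)
  qed (use b in auto)
  also have "\<dots> = (a0 + 2 * (c + K + c0)) * (b * P)" by (simp add: distrib_right distrib_left mult_ac)
  finally show ?thesis unfolding a0_def c0_def P_def by (simp only: mult.assoc add.assoc)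
qed

text \<open>The three factors count the copies, the rounds per chain and the time per round.\<close>

lemma update_time_bound:
  "\<exists>K. \<forall>b lg d. b \<ge> 1 \<longrightarrow> update_time b lg d \<le> K * (b * Suc (Suc (chain_potential b d)) * (b + lg))"
proof -
  obtain K1 where K1: "\<And>b lg. b \<ge> 1 \<Longrightarrow> insert_step_time b lg + cost (reg 12) + 1 \<le> K1 * (b + lg)"
    using insert_step_time_linear by blast
  obtain K2 where K2: "\<And>b lg. b \<ge> 1 \<Longrightarrow> delete_step_time b lg + cost (reg 12) + 1 \<le> K2 * (b + lg)"
    using delete_step_time_linear by blast
  show ?thesis
  proof (intro exI allI impI)
    fix b lg d :: nat assume b: "b \<ge> 1"
    let ?G = "\<lambda>c K. max_cost (Seq base_cmd (setreg 14 (Const 0))) +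
     2 * (c + K + max_cost (setreg 14 (Add (reg 14) (Const 1))) + cost (Less (reg 14) b_exp) + 1)"
    have "for_time b (max_cost insert_start + insert_chain_time b lg d) \<le>
       ?G (max_cost insert_start) K1 * (b * Suc (Suc (chain_potential b d)) * (b + lg))"
      unfolding insert_chain_time_def
      by (intro for_time_bound[OF b] add_left_mono mult_left_mono K1[OF b]) simp
    moreover have "for_time b (max_cost delete_start + delete_chain_time b lg d) \<le>
       ?G (max_cost delete_start) K2 * (b * Suc (Suc (chain_potential b d)) * (b + lg))"
      unfolding delete_chain_time_def
      by (intro for_time_bound[OF b] add_left_mono mult_left_mono K2[OF b]) simp
    ultimately show "update_time b lg d \<le> (?G (max_cost insert_start) K1 + ?G (max_cost delete_start) K2) *
        (b * Suc (Suc (chain_potential b d)) * (b + lg))"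
      unfolding update_time_def by (subst distrib_right) (rule add_mono)
  qed
qed

section \<open>Numerical constants and word size\<close>

lemma bigtheta_ln_bounds:
  fixes b :: "nat \<Rightarrow> nat"
  assumes th: "(\<lambda>n. real (b n)) \<in> \<Theta>(\<lambda>n. ln (real n))" and b2: "\<And>n. b n \<ge> 2"
  obtains c C :: real where "c > 0" "C > 0"
    "\<And>n. n \<ge> 2 \<Longrightarrow> c * ln (real n) \<le> real (b n)" "\<And>n. n \<ge> 2 \<Longrightarrow> real (b n) \<le> C * ln (real n)"
proof -
  obtain C0 where C0: "C0 > 0" "eventually (\<lambda>n. norm (real (b n)) \<le> C0 * norm (ln (real n))) sequentially"
    using landau_o.bigE[OF bigthetaD1[OF th]] by blast
  obtain c0 where c0: "c0 > 0" "eventually (\<lambda>n. norm (real (b n)) \<ge> c0 * norm (ln (real n))) sequentially"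
    using landau_omega.bigE[OF bigthetaD2[OF th]] by blast
  from eventually_conj[OF C0(2) c0(2)] obtain N where
    N: "\<And>n. n \<ge> N \<Longrightarrow> norm (real (b n)) \<le> C0 * norm (ln (real n)) \<and> norm (real (b n)) \<ge> c0 * norm (ln (real n))"
    unfolding eventually_sequentially by blast
  define B where "B = (\<Sum>i\<le>N. real (b i))"
  define LN where "LN = ln (real (N + 2))"
  have LN: "LN > 0" by (simp add: LN_def)
  have l2: "ln (2::real) > 0" by simp
  have B: "B \<ge> 0" by (auto simp: B_def intro: sum_nonneg)
  \<comment> \<open>The finitely many \<open>n < N\<close> are absorbed by the constants: for them
    \<open>ln n \<le> LN\<close>, so the reduced lower bound is at most one, and the sum
    \<open>B\<close> dominates all values of \<open>b\<close>. The case \<open>n = 1\<close> stays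
    out, as its logarithm is zero.\<close>
  show ?thesis
  proof (rule that[of "min c0 (1 / LN)" "C0 + B / ln 2"])
    show "min c0 (1 / LN) > 0" using c0 LN by simp
    show "C0 + B / ln 2 > 0" using C0 B by (simp add: add_pos_nonneg)
    fix n :: nat assume n: "n \<ge> 2"
    have ln_n: "ln (real n) \<ge> ln 2" using n by simp
    then have ln_n0: "ln (real n) \<ge> 0" using l2 by linarith
    show "min c0 (1 / LN) * ln (real n) \<le> real (b n)"
    proof (cases "n \<ge> N")
      case True
      have "min c0 (1 / LN) * ln (real n) \<le> c0 * ln (real n)" using ln_n0 by (intro mult_right_mono) auto
      then show ?thesis using N[OF True] ln_n0 by simp
    next
      case False
      have "ln (real n) \<le> LN" unfolding LN_def using False n by simp
      then have "1 / LN * ln (real n) \<le> 1" using LN by (simp add: field_simps)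
      moreover have "min c0 (1 / LN) * ln (real n) \<le> 1 / LN * ln (real n)"
        using ln_n0 by (intro mult_right_mono) auto
      ultimately show ?thesis using b2[of n] by linarith
    qed
    show "real (b n) \<le> (C0 + B / ln 2) * ln (real n)"
    proof (cases "n \<ge> N")
      case True
      have "C0 * ln (real n) \<le> (C0 + B / ln 2) * ln (real n)" using ln_n0 B l2 by (intro mult_right_mono) auto
      then show ?thesis using N[OF True] ln_n0 by simp
    next
      case False
      have "real (b n) \<le> B" unfolding B_def using False by (intro member_le_sum) auto
      also have "B = B / ln 2 * ln 2" using l2 by simp
      also have "\<dots> \<le> B / ln 2 * ln (real n)" using ln_n B l2 by (intro mult_left_mono) auto
      also have "\<dots> \<le> (C0 + B / ln 2) * ln (real n)" using ln_n0 C0 by (intro mult_right_mono) auto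
      finally show ?thesis .
    qed
  qed
qed

definition log_ceil :: "nat \<Rightarrow> nat" where
  "log_ceil n = nat \<lceil>log 2 (real n)\<rceil>"

lemma le_two_power_log_ceil: "n > 0 \<Longrightarrow> n \<le> 2 ^ log_ceil n"
proof -
  assume n: "n > 0"
  have "log 2 (real n) \<le> real (log_ceil n)" unfolding log_ceil_def by linarith
  then have "real n \<le> 2 powr real (log_ceil n)" using n by (simp add: log_le_iff)
  then have "real n \<le> real (2 ^ log_ceil n)" by (simp add: powr_realpow)
  then show ?thesis by (rule of_nat_le_iff[THEN iffD1])
qed

lemma log_ceil_le: "n \<ge> 2 \<Longrightarrow> real (log_ceil n) \<le> 2 / ln 2 * ln (real n)"
proof -
  assume n: "n \<ge> 2"
  have "1 \<le> log 2 (real n)" using n by simp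
  then have "real (log_ceil n) \<le> 2 * log 2 (real n)" unfolding log_ceil_def by linarith
  then show ?thesis by (simp add: log_def)
qed

text \<open>The left-hand side is at most \<open>16 * B ^ 2 * n ^ 5\<close>. Five factors
  \<open>q\<close> beat the power of \<open>n\<close>, and \<open>x < 2 ^ x\<close> lets
  \<open>16 * B ^ 2\<close> further factors beat the coefficient.\<close>

lemma word_modulus_large:
  assumes n: "n > 0" and b: "b \<le> B * n" and k: "k \<ge> 16 * B ^ 2 + 5"
  shows "n * (4 * (n * b)) * (4 * (n * b)) < word_modulus k n"
proof -
  define q where "q = (2::nat) ^ nat \<lceil>log 2 (real (n + 2))\<rceil>"
  have qn: "n + 2 \<le> q" using le_two_power_log_ceil[of "n + 2"] by (simp add: q_def log_ceil_def)
  have W: "word_modulus k n = q ^ k" by (simp only: word_modulus_def q_def mult.commute[of k] power_mult)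
  have "n * (4 * (n * b)) * (4 * (n * b)) \<le> n * (4 * (n * (B * n))) * (4 * (n * (B * n)))"
    using b by (intro mult_mono) auto
  also have "\<dots> = 16 * B ^ 2 * n ^ 5"
  proof -
    have "n ^ 5 = n * n * n * n * n" by (simp add: eval_nat_numeral)
    then show ?thesis by (simp add: power2_eq_square mult_ac)
  qed
  also have "\<dots> \<le> q ^ (16 * B ^ 2) * n ^ 5"
  proof (rule mult_right_mono)
    have "16 * B ^ 2 < 2 ^ (16 * B ^ 2)" by (rule less_exp)
    also have "\<dots> \<le> q ^ (16 * B ^ 2)" using qn by (intro power_mono) auto
    finally show "16 * B ^ 2 \<le> q ^ (16 * B ^ 2)" by simp
  qed simp
  also have "\<dots> < q ^ (16 * B ^ 2) * q ^ 5"
  proof (rule mult_strict_left_mono)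
    show "n ^ 5 < q ^ 5" using qn by (intro power_strict_mono) auto
  qed (use qn in simp)
  also have "\<dots> = q ^ (16 * B ^ 2 + 5)" by (simp add: power_add)
  also have "\<dots> \<le> q ^ k" using k qn by (intro power_increasing) auto
  finally show ?thesis unfolding W .
qed

text \<open>The quotient \<open>d / (4 * b)\<close> is linear in \<open>\<rho> + 1\<close>, so
  \<open>b\<close> disappears inside the logarithm. The extra summand \<open>real b\<close> allows
  for the copies of one inserted edge. Since \<open>ln (2 + \<rho>)\<close> is at least
  \<open>ln 2\<close>, additive constants can be absorbed into it.\<close>

lemma chain_potential_density:
  assumes b: "b > 0" and K: "K \<ge> 0" and \<rho>: "\<rho> \<ge> 0" and d: "real d \<le> K * (real b * (\<rho> + 1)) + real b"
  shows "real (chain_potential b d) \<le> 16 * real b * ((ln (2 + K) / ln 2 + 1) * ln (2 + \<rho>))"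
proof -
  have arg: "1 + real d / (4 * real b) \<le> (2 + K) * (2 + \<rho>)"
  proof -
    have "real d / (4 * real b) \<le> (K * (real b * (\<rho> + 1)) + real b) / (4 * real b)"
      using d b by (intro divide_right_mono) auto
    also have "\<dots> = (K * (\<rho> + 1) + 1) / 4" using b by (simp add: field_simps)
    also have "\<dots> \<le> K * (\<rho> + 1) + 1" using K \<rho> by simp
    finally have "1 + real d / (4 * real b) \<le> K * (\<rho> + 1) + 2" by linarith
    also have "\<dots> \<le> (2 + K) * (2 + \<rho>)" using K \<rho> by (simp add: algebra_simps)
    finally show ?thesis .
  qed
  have "real (chain_potential b d) \<le> 16 * real b * ln (1 + real d / (4 * real b))"
    unfolding chain_potential_def using b by (simp add: of_nat_nat)
  also have "\<dots> \<le> 16 * real b * ((ln (2 + K) / ln 2 + 1) * ln (2 + \<rho>))"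
  proof (rule mult_left_mono)
    have "ln (1 + real d / (4 * real b)) \<le> ln ((2 + K) * (2 + \<rho>))"
      using arg b by (intro ln_mono) (auto intro!: add_pos_nonneg)
    also have "\<dots> = ln (2 + K) + ln (2 + \<rho>)" using K \<rho> by (simp add: ln_mult)
    finally have "ln (1 + real d / (4 * real b)) \<le> ln (2 + K) + ln (2 + \<rho>)" .
    moreover have "ln (2 + K) / ln 2 * ln 2 \<le> ln (2 + K) / ln 2 * ln (2 + \<rho>)"
      using K \<rho> by (intro mult_left_mono) auto
    ultimately show "ln (1 + real d / (4 * real b)) \<le> (ln (2 + K) / ln 2 + 1) * ln (2 + \<rho>)"
      by (simp add: distrib_right)
  qed simp
  finally show ?thesis .
qed

section \<open>Histories of updates\<close>

lemma edges_after_snoc: "edges_after (us @ [u]) = apply_update u (edges_after us)"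
  by (simp add: edges_after_def)

lemma valid_history_snoc:
  "valid_history n (us @ [u]) \<longleftrightarrow> valid_history n us \<and> admissible n (edges_after us) u"
  unfolding valid_history_def by (auto simp: nth_append less_Suc_eq)

lemma exec_update_deterministic:
  "exec_update W ins del u s t s' \<Longrightarrow> exec_update W ins del u s t' s'' \<Longrightarrow> s'' = s'"
  by (cases u) (auto dest: exec_deterministic)

text \<open>The two programs, the word size and the constants are chosen before \<open>n\<close>, so
  one algorithm serves all sizes. \<open>\<sigma>\<close> records the memory reached after each
  history, consecutive values being linked by actual runs. The argument \<open>2 + \<rho>\<close>
  keeps the logarithm positive for sparse graphs.\<close>

theorem theorem15:
  fixes b :: "nat \<Rightarrow> nat"
  assumes "(\<lambda>n. real (b n)) \<in> \<Theta>(\<lambda>n. ln (real n))"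
    and "\<And>n. b n \<ge> 2"
  shows "\<exists>ins del k (C\<^sub>t :: real) (C\<^sub>1 :: real) (C\<^sub>2 :: real). \<forall>n\<ge>1. \<exists>\<sigma> :: update list \<Rightarrow> memory.
    \<sigma> [] = initial_memory (word_modulus k n) n (b n) \<and>
    (\<forall>us u. valid_history n (us @ [u]) \<longrightarrow>
       (\<exists>t. exec_update (word_modulus k n) ins del u (\<sigma> us) t (\<sigma> (us @ [u])) \<and>
            real t \<le> C\<^sub>t * (ln (real n) ^ 3 *
                        ln (2 + max_density {..<n} (edges_after (us @ [u])))))) \<and>
    (\<forall>us. valid_history n us \<longrightarrow>
       (let V = {..<n}; E = edges_after us; \<rho> = max_density V E in
        \<exists>D. orientation_of_power V E (b n) D \<and>
            stores_orientation n (b n) (\<sigma> us) D \<and>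
            (\<forall>a\<in>arcs D. real (out_degree D (tail D a))
                          \<le> (1 + 3 / real (b n)) * real (out_degree D (head D a))) \<and>
            (\<forall>v\<in>V. real (out_degree D v) \<le> C\<^sub>1 * (real (b n) * \<rho>)) \<and>
            (\<forall>H. induced_orientation V E D H \<longrightarrow>
               (\<forall>u\<in>V. real (out_degree H u) \<le> C\<^sub>2 * \<rho>))))"
proof -
  obtain c C where cC: "c > 0" "C > 0" "\<And>n. n \<ge> 2 \<Longrightarrow> c * ln (real n) \<le> real (b n)"
      "\<And>n. n \<ge> 2 \<Longrightarrow> real (b n) \<le> C * ln (real n)"
    using bigtheta_ln_bounds[OF assms] by metis
  \<comment> \<open>\<open>b 1\<close> is added because \<open>C * ln 1\<close> is zero and bounds
    nothing at \<open>n = 1\<close>.\<close>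
  define B where "B = nat \<lceil>C\<rceil> + b 1"
  have bB: "b n \<le> B * n" if n: "n \<ge> 1" for n
  proof (cases "n = 1")
    case False
    then have "real (b n) \<le> C * ln (real n)" using n by (intro cC) simp
    also have "\<dots> \<le> C * real n" using n cC(2) ln_le_minus_one[of "real n"] by (intro mult_left_mono) auto
    also have "\<dots> \<le> real B * real n" unfolding B_def by (intro mult_right_mono) linarith+
    finally have "real (b n) \<le> real (B * n)" by simp
    then show ?thesis by (rule of_nat_le_iff[THEN iffD1])
  qed (simp add: B_def)
  define k where "k = 16 * B ^ 2 + 5"
  \<comment> \<open>This comes from \<open>(1 + 3 / b) ^ lg \<le> exp (3 * lg / b)\<close> with
    \<open>lg \<le> 2 / ln 2 * ln n\<close> and \<open>b \<ge> c * ln n\<close>; the leading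
    \<open>2\<close> is the doubling in \<open>outdegree_le_density\<close>.\<close>
  define C1 where "C1 = 2 * exp (6 / (ln 2 * c))"
  have C1: "C1 > 0" by (simp add: C1_def)
  obtain K where K: "\<And>b lg d. b \<ge> 1 \<Longrightarrow> update_time b lg d \<le> K * (b * Suc (Suc (chain_potential b d)) * (b + lg))"
    using update_time_bound by blast
  define K0 where "K0 = 16 * (ln (2 + C1) / ln 2 + 1)"
  have K0: "K0 \<ge> 0" unfolding K0_def using C1 by simp
  define Ct where "Ct = real K * C * (K0 * C + 2 / (ln 2 * ln 2)) * (C + 2 / ln 2)"
  show ?thesis
  proof (rule exI[of _ insert_cmd], rule exI[of _ delete_cmd], rule exI[of _ k], rule exI[of _ Ct],
      rule exI[of _ C1], rule exI[of _ "2 * C1"], intro allI impI)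
    fix n :: nat assume n: "n \<ge> 1"
    define W where "W = word_modulus k n"
    define bn where "bn = b n"
    define lg where "lg = log_ceil n"
    have lg: "n \<le> 2 ^ lg" unfolding lg_def by (rule le_two_power_log_ceil) (use n in simp)
    interpret ram n bn W
    proof
      show "n * (4 * (n * bn)) * (4 * (n * bn)) < W"
        unfolding W_def bn_def by (rule word_modulus_large[OF _ bB]) (use n in \<open>auto simp: k_def\<close>)
    qed (use n assms(2) in \<open>auto simp: bn_def\<close>)
    \<comment> \<open>Choice makes \<open>\<sigma>\<close> total, invalid histories included; on
      valid ones determinism makes the chosen memory the one that was reached.\<close>
    define next_state where "next_state = (\<lambda>u s. SOME s'. \<exists>t. exec_update W insert_cmd delete_cmd u s t s')"
    define \<sigma> where "\<sigma> = (\<lambda>us. fold next_state us (initial_memory W n bn))"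
    have \<sigma>_snoc: "\<sigma> (us @ [u]) = next_state u (\<sigma> us)" for us u by (simp add: \<sigma>_def)
    have V: "finite {..<n}" "{..<n} \<noteq> {}" using n by auto
    have pow: "2 * (1 + 3 / real bn) ^ lg \<le> C1"
    proof (cases "n = 1")
      case True
      then have "lg = 0" by (simp add: lg_def log_ceil_def)
      then show ?thesis using cC(1) by (simp add: C1_def)
    next
      case False
      then have n2: "n \<ge> 2" using n by simp
      have "(1 + 3 / real bn) ^ lg \<le> exp (3 / real bn) ^ lg"
        by (intro power_mono) (auto simp: exp_ge_add_one_self add_nonneg_nonneg)
      also have "\<dots> = exp (real lg * (3 / real bn))" by (rule exp_of_nat_mult[symmetric])
      also have "\<dots> \<le> exp (6 / (ln 2 * c))"
      proof -
        have "real lg * 3 \<le> 2 / ln 2 * ln (real n) * 3" using log_ceil_le[OF n2] by (simp add: lg_def)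
        also have "\<dots> = 6 / (ln 2 * c) * (c * ln (real n))" using cC(1) by simp
        also have "\<dots> \<le> 6 / (ln 2 * c) * real bn"
          using cC(1) cC(3)[OF n2] by (intro mult_left_mono) (auto simp: bn_def)
        finally have "real lg * 3 / real bn \<le> 6 / (ln 2 * c)" using b0 by (simp add: divide_le_eq)
        then show ?thesis by simp
      qed
      finally show ?thesis by (simp add: C1_def)
    qed
    have sparse: "real (s 3 v) \<le> C1 * (real bn * max_density {..<n} E)"
      if "core s (ids_of E)" "simple_edges n E" "v < n" for s E v
    proof -
      have "real (s 3 v) \<le> 2 * (1 + 3 / real bn) ^ lg * (real bn * max_density {..<n} E)"
        by (rule orientation_sparse[OF that(1,2) lg that(3)])
      also have "\<dots> \<le> C1 * (real bn * max_density {..<n} E)"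
        using pow max_density_nonneg[OF V simple_edges_props(1)[OF that(2)]] by (intro mult_right_mono) auto
      finally show ?thesis .
    qed
    have step: "\<exists>t s'. exec_update W insert_cmd delete_cmd u s t s' \<and> bounded_memory W s' \<and>
        core s' (ids_of (apply_update u E)) \<and>
        real t \<le> Ct * (ln (real n) ^ 3 * ln (2 + max_density {..<n} (apply_update u E)))"
      if s: "bounded_memory W s" "core s (ids_of E)" and E: "simple_edges n E" and adm: "admissible n E u" for s E u
    proof -
      define \<rho> where "\<rho> = max_density {..<n} (apply_update u E)"
      define \<rho>0 where "\<rho>0 = max_density {..<n} E"
      note E' = simple_edges_update[OF E adm]
      have fE: "finite E" "finite (apply_update u E)" using simple_edges_props(1) E E' by auto
      have \<rho>: "\<rho> \<ge> 0" "\<rho>0 \<ge> 0" unfolding \<rho>_def \<rho>0_def using max_density_nonneg[OF V] fE by auto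
      have \<rho>0: "\<rho>0 \<le> \<rho> + 1"
      proof (cases u)
        case (Insert x y)
        then have "\<rho>0 \<le> \<rho>" unfolding \<rho>_def \<rho>0_def using fE by (intro max_density_mono[OF V]) auto
        then show ?thesis by simp
      next
        case (Delete x y)
        then show ?thesis unfolding \<rho>_def \<rho>0_def using max_density_Diff[OF V fE(1)] by simp
      qed
      \<comment> \<open>An admissible update involves two distinct vertices, so the degenerate bound
        \<open>ln 1 = 0\<close> is never tested.\<close>
      have n2: "n \<ge> 2"
      proof -
        have "\<exists>x y. x < n \<and> y < n \<and> x \<noteq> y"
        proof (cases u)
          case (Insert x y) then show ?thesis using adm by auto
        next
          case (Delete x y)
          then obtain p q where "p < q" "q < n" using adm E by (auto simp: simple_edges_def)
          then show ?thesis by (intro exI[of _ p] exI[of _ q]) simp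
        qed
        then show ?thesis by auto
      qed
      define d where "d = nat \<lfloor>C1 * (real bn * \<rho>0)\<rfloor>"
      have deg: "s 3 w \<le> d" if "w < n" for w
        unfolding d_def using sparse[OF s(2) E that] by (simp add: \<rho>0_def le_nat_floor)
      obtain t s' where ts: "exec_update W insert_cmd delete_cmd u s t s'" "t \<le> update_time bn lg (d + bn)"
        "bounded_memory W s'" "core s' (ids_of (apply_update u E))"
        using update_step[OF s E adm lg deg] by blast
      define Y X where "Y = ln (real n)" and "X = ln (2 + \<rho>)"
      have Y: "Y \<ge> ln 2" using n2 by (simp add: Y_def)
      have X: "X \<ge> ln 2" using \<rho> by (simp add: X_def)
      have l2: "ln (2::real) > 0" by simp
      have Y0: "Y \<ge> 0" and X0: "X \<ge> 0" using X Y l2 by linarith+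
      have bY: "real bn \<le> C * Y" using cC(4)[OF n2] by (simp add: bn_def Y_def)
      have lgY: "real lg \<le> 2 / ln 2 * Y" using log_ceil_le[OF n2] by (simp add: lg_def Y_def)
      have pot: "real (chain_potential bn (d + bn)) \<le> K0 * real bn * X"
      proof -
        have "real d \<le> C1 * (real bn * \<rho>0)" unfolding d_def using C1 \<rho> by simp
        also have "\<dots> \<le> C1 * (real bn * (\<rho> + 1))" using \<rho>0 C1 by (intro mult_left_mono) auto
        finally have "real (d + bn) \<le> C1 * (real bn * (\<rho> + 1)) + real bn" by simp
        from chain_potential_density[OF b0 _ \<rho>(1) this] C1
        show ?thesis by (simp add: K0_def X_def mult_ac)
      qed
      \<comment> \<open>Both logarithms are at least \<open>ln 2\<close>, so their product absorbs
        the two additional rounds of a chain.\<close>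
      have XY: "2 \<le> 2 / (ln 2 * ln 2) * (Y * X)"
      proof -
        have "ln 2 * ln 2 \<le> Y * X" using X Y l2 Y0 by (intro mult_mono) auto
        then have "2 / (ln 2 * ln 2) * (ln 2 * ln 2) \<le> 2 / (ln 2 * ln 2) * (Y * X)"
          using l2 by (intro mult_left_mono) auto
        then show ?thesis by simp
      qed
      have pot1: "K0 * real bn * X \<le> K0 * (C * Y) * X" using bY K0 X0 by (intro mult_right_mono mult_left_mono) auto
      have pot2: "real (Suc (Suc (chain_potential bn (d + bn)))) \<le> (K0 * C + 2 / (ln 2 * ln 2)) * (Y * X)"
      proof -
        have "real (Suc (Suc (chain_potential bn (d + bn)))) \<le> K0 * (C * Y) * X + 2 / (ln 2 * ln 2) * (Y * X)"
          using pot1 pot XY unfolding of_nat_Suc by linarith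
        also have "\<dots> = (K0 * C + 2 / (ln 2 * ln 2)) * (Y * X)" by (simp only: distrib_right mult.assoc)
        finally show ?thesis .
      qed
      have bl: "real (bn + lg) \<le> (C + 2 / ln 2) * Y" using bY lgY by (simp add: distrib_right)
      have "t \<le> K * (bn * Suc (Suc (chain_potential bn (d + bn))) * (bn + lg))"
        using ts(2) K[of bn lg "d + bn"] b by linarith
      then have "real t \<le> real (K * (bn * Suc (Suc (chain_potential bn (d + bn))) * (bn + lg)))" by (rule of_nat_mono)
      also have "\<dots> = real K * (real bn * real (Suc (Suc (chain_potential bn (d + bn)))) * real (bn + lg))"
        by (simp only: of_nat_mult)
      \<comment> \<open>Each factor \<open>Y\<close> has its own source: the number of copies, the
        length of a chain, and the work per round.\<close>
      also have "\<dots> \<le> real K * ((C * Y) * ((K0 * C + 2 / (ln 2 * ln 2)) * (Y * X)) * ((C + 2 / ln 2) * Y))"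
        using cC(2) K0 X0 Y0 l2 by (intro mult_left_mono mult_mono bY pot2 bl mult_nonneg_nonneg add_nonneg_nonneg) auto
      also have "\<dots> = Ct * (Y ^ 3 * X)" by (simp add: Ct_def power3_eq_cube mult_ac)
      finally show ?thesis using ts unfolding Y_def X_def \<rho>_def by blast
    qed
    have inv: "bounded_memory W (\<sigma> us) \<and> core (\<sigma> us) (ids_of (edges_after us)) \<and> simple_edges n (edges_after us)"
      if "valid_history n us" for us
      using that
    proof (induction us rule: rev_induct)
      case Nil
      have "ids_of {} = {}" by (simp add: ids_of_def)
      then show ?case using core_initial bounded_initial by (simp add: \<sigma>_def edges_after_def simple_edges_def)
    next
      case (snoc u us)
      then have I: "bounded_memory W (\<sigma> us)" "core (\<sigma> us) (ids_of (edges_after us))" "simple_edges n (edges_after us)"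
        and adm: "admissible n (edges_after us) u" by (auto simp: valid_history_snoc)
      from step[OF I adm] obtain t s' where ts: "exec_update W insert_cmd delete_cmd u (\<sigma> us) t s'"
        "bounded_memory W s'" "core s' (ids_of (apply_update u (edges_after us)))" by blast
      have "next_state u (\<sigma> us) = s'"
        unfolding next_state_def using ts(1) by (intro some_equality) (auto dest: exec_update_deterministic)
      then show ?case using ts simple_edges_update[OF I(3) adm] by (simp add: \<sigma>_snoc edges_after_snoc)
    qed
    show "\<exists>\<sigma> :: update list \<Rightarrow> memory.
      \<sigma> [] = initial_memory (word_modulus k n) n (b n) \<and>
      (\<forall>us u. valid_history n (us @ [u]) \<longrightarrow>
         (\<exists>t. exec_update (word_modulus k n) insert_cmd delete_cmd u (\<sigma> us) t (\<sigma> (us @ [u])) \<and>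
              real t \<le> Ct * (ln (real n) ^ 3 *
                          ln (2 + max_density {..<n} (edges_after (us @ [u])))))) \<and>
      (\<forall>us. valid_history n us \<longrightarrow>
         (let V = {..<n}; E = edges_after us; \<rho> = max_density V E in
          \<exists>D. orientation_of_power V E (b n) D \<and>
              stores_orientation n (b n) (\<sigma> us) D \<and>
              (\<forall>a\<in>arcs D. real (out_degree D (tail D a))
                            \<le> (1 + 3 / real (b n)) * real (out_degree D (head D a))) \<and>
              (\<forall>v\<in>V. real (out_degree D v) \<le> C1 * (real (b n) * \<rho>)) \<and>
              (\<forall>H. induced_orientation V E D H \<longrightarrow>
                 (\<forall>u\<in>V. real (out_degree H u) \<le> 2 * C1 * \<rho>))))"
      unfolding W_def[symmetric] bn_def[symmetric] Let_def
    proof (intro exI[of _ \<sigma>] conjI allI impI)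
      show "\<sigma> [] = initial_memory W n bn" by (simp add: \<sigma>_def)
    next
      fix us u assume v: "valid_history n (us @ [u])"
      then have adm: "admissible n (edges_after us) u" and vu: "valid_history n us" by (auto simp: valid_history_snoc)
      from inv[OF vu] have I: "bounded_memory W (\<sigma> us)" "core (\<sigma> us) (ids_of (edges_after us))"
        "simple_edges n (edges_after us)" by auto
      from step[OF I adm] obtain t s' where ts: "exec_update W insert_cmd delete_cmd u (\<sigma> us) t s'"
        "real t \<le> Ct * (ln (real n) ^ 3 * ln (2 + max_density {..<n} (apply_update u (edges_after us))))" by blast
      have "next_state u (\<sigma> us) = s'"
        unfolding next_state_def using ts(1) by (intro some_equality) (auto dest: exec_update_deterministic)
      then show "\<exists>t. exec_update W insert_cmd delete_cmd u (\<sigma> us) t (\<sigma> (us @ [u])) \<and>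
        real t \<le> Ct * (ln (real n) ^ 3 * ln (2 + max_density {..<n} (edges_after (us @ [u]))))"
        using ts by (auto simp: \<sigma>_snoc edges_after_snoc)
    next
      fix us assume "valid_history n us"
      from inv[OF this] have I: "core (\<sigma> us) (ids_of (edges_after us))" "simple_edges n (edges_after us)" by auto
      define E where "E = edges_after us"
      define D where "D = orientation (\<sigma> us) E"
      note op = orientation_props[OF I, folded E_def, folded D_def]
      have od: "real (out_degree D v) \<le> C1 * (real bn * max_density {..<n} E)" if "v < n" for v
        using sparse[OF I that] op(3)[OF that] by (simp add: E_def)
      show "\<exists>D. orientation_of_power {..<n} (edges_after us) bn D \<and>
            stores_orientation n bn (\<sigma> us) D \<and>
            (\<forall>a\<in>arcs D. real (out_degree D (tail D a)) \<le> (1 + 3 / real bn) * real (out_degree D (head D a))) \<and>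
            (\<forall>v\<in>{..<n}. real (out_degree D v) \<le> C1 * (real bn * max_density {..<n} (edges_after us))) \<and>
            (\<forall>H. induced_orientation {..<n} (edges_after us) D H \<longrightarrow>
               (\<forall>u\<in>{..<n}. real (out_degree H u) \<le> 2 * C1 * max_density {..<n} (edges_after us)))"
        unfolding E_def[symmetric]
      proof (intro exI[of _ D] conjI ballI allI impI)
        show "orientation_of_power {..<n} E bn D" by (rule op(1))
        show "stores_orientation n bn (\<sigma> us) D" by (rule op(2))
        show "real (out_degree D (tail D a)) \<le> (1 + 3 / real bn) * real (out_degree D (head D a))" if "a \<in> arcs D" for a
          by (rule op(4)[OF that])
        show "real (out_degree D v) \<le> C1 * (real bn * max_density {..<n} E)" if "v \<in> {..<n}" for v
          using od that by simp
        fix H u assume H: "induced_orientation {..<n} E D H" and u: "u \<in> {..<n}"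
        have "bn * out_degree H u \<le> 2 * out_degree D u"
          by (rule induced_outdegree_le[OF op(1) H]) (use simple_edges_props[OF I(2)] in \<open>auto simp: E_def\<close>)
        then have "real (bn * out_degree H u) \<le> real (2 * out_degree D u)" by (rule of_nat_mono)
        also have "\<dots> \<le> real bn * (2 * C1 * max_density {..<n} E)" using od[of u] u by (simp add: mult_ac)
        finally show "real (out_degree H u) \<le> 2 * C1 * max_density {..<n} E" using b0 by simp
      qed
    qed
  qed
qed

end
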